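(* Let $p=2n$ with $n\ge1$, $d=2p+2=4n+2$, and let $\mathcal V(\Lambda_{\mu(p+1)},g_{\mu\nu})$ be an arbitrary scalar function of a self-dual $(p+1)$-form $\Lambda$ and of the metric. Then the action $$S[A,a,\Lambda]=\int d^dx\sqrt{-g}\left\{\frac1{p!}\left[\frac12E\cdot B-\frac12B\cdot B+(B+\lambda)\cdot(B+\lambda)\right]-\mathcal V(\Lambda_{\mu(p+1)},g_{\mu\nu})\right\}$$ is invariant (up to boundary terms, to first order in the parameters) under each of the following two local transformations with arbitrary parameters $\psi_{\mu_1\dots\mu_{p-1}}(x)$ and $\varphi(x)$: 1. $\delta A_{\mu_1\dots\mu_p}=p\,v_{[\mu_1}\psi_{\mu_2\dots\mu_p]}$, $\ \delta a=0$, $\ \delta\Lambda_{\mu(p+1)}=0$; 2. $\delta A_{\mu(p)}=-\dfrac{\varphi}{\sqrt{-\partial a\cdot\partial a}}\,\left(E_{\mu(p)}+B_{\mu(p)}+2\lambda_{\mu(p)}\right)$, $\ \delta a=\varphi$, $\ \delta\Lambda_{\mu(p+1)}=0$.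
   Context: The space-time is a $d$-dimensional Lorentzian manifold with metric $g_{\mu\nu}$ of signature $(-,+,\dots,+)$; the metric is not varied. $A_{\mu(p)}=A_{\mu_1\dots\mu_p}$ is a $p$-form gauge potential with field strength $F_{\mu_1\dots\mu_{p+1}}=(p+1)\partial_{[\mu_1}A_{\mu_2\dots\mu_{p+1}]}$ (antisymmetrization with weight one). The Hodge dual of a $(p+1)$-form is $F^{*\,\mu_1\dots\mu_{p+1}}=\frac1{(p+1)!}\boldsymbol\varepsilon^{\mu_1\dots\mu_{p+1}\nu_1\dots\nu_{p+1}}F_{\nu_1\dots\nu_{p+1}}$ with $\boldsymbol\varepsilon^{\mu_1\dots\mu_d}=\frac{1}{\sqrt{-g}}\varepsilon^{\mu_1\dots\mu_d}$ the Levi-Civita tensor; then $(F^* )^*=F$. The scalar field $a(x)$ has timelike gradient, and $v_\mu=\partial_\mu a/\sqrt{-\partial a\cdot\partial a}$, so $v^\mu v_\mu=-1$. One sets $E_{\mu(p)}=F_{\mu_1\dots\mu_p\nu}v^\nu$, $B_{\mu(p)}=F^*_{\mu_1\dots\mu_p\nu}v^\nu$. $\Lambda_{\mu(p+1)}$ is an auxiliary self-dual $(p+1)$-form, $\Lambda^*=\Lambda$, and $\lambda_{\mu(p)}=\Lambda_{\mu_1\dots\mu_p\nu}v^\nu$. A dot denotes full contraction, e.g. $E\cdot B=E_{\mu_1\dots\mu_p}B^{\mu_1\dots\mu_p}$. *)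

theory Defs
  imports "HOL-Analysis.Analysis"
begin

section \<open>Partial derivatives and smooth functions\<close>

type_synonym 'd coords = "real^'d"
type_synonym 'd matrix = "real^'d^'d"

definition partial :: "'d::finite \<Rightarrow> ('d coords \<Rightarrow> real) \<Rightarrow> 'd coords \<Rightarrow> real" where
  "partial i f x = deriv (\<lambda>t. f (x + t *\<^sub>R axis i 1)) 0"

primrec iterated_partial :: "'d::finite list \<Rightarrow> ('d coords \<Rightarrow> real) \<Rightarrow> 'd coords \<Rightarrow> real" where
  "iterated_partial [] f = f"
| "iterated_partial (i # is) f = partial i (iterated_partial is f)"

text \<open>On an open set this is \<open>C\<^sup>\<infinity>\<close>: differentiability of all iterated partial derivatives
  makes all of them continuous.\<close>

definition smooth_on :: "'d::finite coords set \<Rightarrow> ('d coords \<Rightarrow> real) \<Rightarrow> bool" where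
  "smooth_on U f \<longleftrightarrow> (\<forall>is. \<forall>x\<in>U. iterated_partial is f differentiable (at x))"


section \<open>Tensor algebra in one basis\<close>

text \<open>The components \<open>T\<^bsub>\<mu>1\<dots>\<mu>r\<^esub>\<close> of a tensor of rank \<open>r\<close> form a function of the index list
  \<open>[\<mu>1, \<dots>, \<mu>r]\<close>; by convention it is zero on lists of any other length. The metric components
  and the components of vectors and covectors are matrices and vectors.\<close>

type_synonym 'd tensor = "'d list \<Rightarrow> real"

definition antisymmetric :: "nat \<Rightarrow> 'd tensor \<Rightarrow> bool" where
  "antisymmetric r T \<longleftrightarrow>
     (\<forall>\<mu>s \<pi>. length \<mu>s = r \<and> \<pi> permutes {..<r} \<longrightarrow> T (permute_list \<pi> \<mu>s) = of_int (sign \<pi>) * T \<mu>s)"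

definition tensor_of_rank :: "nat \<Rightarrow> 'd tensor \<Rightarrow> bool" where
  "tensor_of_rank r T \<longleftrightarrow> (\<forall>\<mu>s. length \<mu>s \<noteq> r \<longrightarrow> T \<mu>s = 0)"

definition antisymmetrize :: "nat \<Rightarrow> 'd tensor \<Rightarrow> 'd tensor" where
  "antisymmetrize r T = (\<lambda>\<mu>s. if length \<mu>s = r
     then (\<Sum>\<pi> | \<pi> permutes {..<r}. of_int (sign \<pi>) * T (permute_list \<pi> \<mu>s)) / fact r else 0)"

text \<open>Contraction of all indices of \<open>T\<close> with copies of a matrix; with \<open>M\<close> the metric or the
  inverse metric this lowers or raises all indices.\<close>

definition contract_all :: "'d matrix \<Rightarrow> nat \<Rightarrow> 'd::finite tensor \<Rightarrow> 'd tensor" where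
  "contract_all M r T = (\<lambda>\<mu>s. if length \<mu>s = r
     then (\<Sum>\<nu>s | length \<nu>s = r. (\<Prod>i<r. M $ (\<mu>s ! i) $ (\<nu>s ! i)) * T \<nu>s) else 0)"

definition full_contraction :: "'d matrix \<Rightarrow> nat \<Rightarrow> 'd::finite tensor \<Rightarrow> 'd tensor \<Rightarrow> real" where
  "full_contraction g r S T =
     (\<Sum>\<mu>s | length \<mu>s = r. S \<mu>s * contract_all (matrix_inv g) r T \<mu>s)"

text \<open>\<open>T\<^bsub>\<mu>1\<dots>\<mu>r \<nu>\<^esub> w\<^sup>\<nu>\<close>\<close>

definition contract_last :: "nat \<Rightarrow> 'd::finite tensor \<Rightarrow> 'd coords \<Rightarrow> 'd tensor" where
  "contract_last r T w = (\<lambda>\<mu>s. if length \<mu>s = r then (\<Sum>\<nu>\<in>UNIV. T (\<mu>s @ [\<nu>]) * w $ \<nu>) else 0)"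

text \<open>The order of the index type numbers the coordinates: \<open>card {..<i}\<close> is the position of \<open>i\<close>.\<close>

definition levi_civita :: "'d::{finite,linorder} tensor" where
  "levi_civita \<mu>s = (if length \<mu>s = CARD('d) \<and> distinct \<mu>s
     then of_int (sign (\<lambda>i. \<mu>s ! card {..<i})) else 0)"

definition sqrt_minus_det :: "'d::finite matrix \<Rightarrow> real" where
  "sqrt_minus_det g = sqrt (- det g)"

definition hodge_upper :: "'d matrix \<Rightarrow> nat \<Rightarrow> 'd::{finite,linorder} tensor \<Rightarrow> 'd tensor" where
  "hodge_upper g r F = (\<lambda>\<mu>s. if length \<mu>s = r
     then (\<Sum>\<nu>s | length \<nu>s = r. levi_civita (\<mu>s @ \<nu>s) / sqrt_minus_det g * F \<nu>s) / fact r else 0)"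

text \<open>The dual of an \<open>r\<close>-form in dimension \<open>2 r\<close>, with lowered indices.\<close>

definition hodge :: "'d matrix \<Rightarrow> nat \<Rightarrow> 'd::{finite,linorder} tensor \<Rightarrow> 'd tensor" where
  "hodge g r F = contract_all g r (hodge_upper g r F)"

definition lorentzian :: "'d::finite matrix \<Rightarrow> bool" where
  "lorentzian g \<longleftrightarrow> (\<exists>(P :: 'd matrix) i0. invertible P \<and>
     transpose P ** g ** P = (\<chi> i j. if i = j then (if i = i0 then -1 else 1) else 0))"

definition covector_norm2 :: "'d::finite matrix \<Rightarrow> 'd coords \<Rightarrow> real" where
  "covector_norm2 g w = w \<bullet> (matrix_inv g *v w)"

definition unit_covector :: "'d::finite matrix \<Rightarrow> 'd coords \<Rightarrow> 'd coords" where
  "unit_covector g w = (1 / sqrt (- covector_norm2 g w)) *\<^sub>R w"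

definition unit_vector :: "'d::finite matrix \<Rightarrow> 'd coords \<Rightarrow> 'd coords" where
  "unit_vector g w = matrix_inv g *v unit_covector g w"

text \<open>The behaviour of covariant components under a change of basis: \<open>J\<^bsub>\<nu>\<mu>\<^esub>\<close> stands for
  \<open>\<partial>x'\<^sup>\<nu>/\<partial>x\<^sup>\<mu>\<close>, and components with respect to \<open>x'\<close> are turned into components with respect to \<open>x\<close>.\<close>

definition pull :: "nat \<Rightarrow> 'd matrix \<Rightarrow> 'd::finite tensor \<Rightarrow> 'd tensor" where
  "pull r J = contract_all (transpose J) r"

definition pull_metric :: "'d::finite matrix \<Rightarrow> 'd matrix \<Rightarrow> 'd matrix" where
  "pull_metric J g = transpose J ** g ** J"

definition self_dual :: "'d matrix \<Rightarrow> nat \<Rightarrow> 'd::{finite,linorder} tensor \<Rightarrow> bool" where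
  "self_dual g r \<Lambda> \<longleftrightarrow> hodge g r \<Lambda> = \<Lambda>"

text \<open>A scalar function of a self-dual form and the metric: its value does not depend on the
  (oriented) basis used to express its arguments. No regularity is required of it.\<close>

definition scalar_function ::
    "nat \<Rightarrow> ('d::{finite,linorder} tensor \<Rightarrow> 'd matrix \<Rightarrow> real) \<Rightarrow> bool" where
  "scalar_function r V \<longleftrightarrow> (\<forall>J g \<Lambda>. det J > 0 \<and> lorentzian g \<and> tensor_of_rank r \<Lambda> \<and>
     antisymmetric r \<Lambda> \<and> self_dual g r \<Lambda> \<longrightarrow> V (pull r J \<Lambda>) (pull_metric J g) = V \<Lambda> g)"

text \<open>The integrand in braces, as a function of the metric, \<open>\<partial>a\<close>, the field strength and \<open>\<Lambda>\<close>
  at one point.\<close>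

definition lagrangian :: "nat \<Rightarrow> ('d::{finite,linorder} tensor \<Rightarrow> 'd matrix \<Rightarrow> real) \<Rightarrow>
    'd matrix \<Rightarrow> 'd coords \<Rightarrow> 'd tensor \<Rightarrow> 'd tensor \<Rightarrow> real" where
  "lagrangian p V g da F \<Lambda> = (let
      v = unit_vector g da;
      E = contract_last p F v;
      B = contract_last p (hodge g (p + 1) F) v;
      l = contract_last p \<Lambda> v;
      Bl = (\<lambda>\<mu>s. B \<mu>s + l \<mu>s)
    in 1 / fact p * (1/2 * full_contraction g p E B - 1/2 * full_contraction g p B B
         + full_contraction g p Bl Bl) - V \<Lambda> g)"


section \<open>Oriented Lorentzian manifolds and tensor fields\<close>

text \<open>A chart is a pair of a domain and a coordinate map. The manifold is the whole type \<open>'m\<close>,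
  and an atlas is a set of charts.\<close>

type_synonym ('m, 'd) chart = "'m set \<times> ('m \<Rightarrow> 'd coords)"

abbreviation dom_ch :: "('m, 'd) chart \<Rightarrow> 'm set" where "dom_ch \<equiv> fst"
abbreviation coord :: "('m, 'd) chart \<Rightarrow> 'm \<Rightarrow> 'd coords" where "coord \<equiv> snd"

definition coord_range :: "('m, 'd) chart \<Rightarrow> ('d::finite coords) set" where
  "coord_range c = coord c ` dom_ch c"

definition coord_inv :: "('m, 'd) chart \<Rightarrow> 'd::finite coords \<Rightarrow> 'm" where
  "coord_inv c = inv_into (dom_ch c) (coord c)"

definition smooth_in_chart :: "('m, 'd::finite) chart \<Rightarrow> ('m \<Rightarrow> real) \<Rightarrow> bool" where
  "smooth_in_chart c f \<longleftrightarrow> smooth_on (coord_range c) (\<lambda>x. f (coord_inv c x))"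

text \<open>\<open>\<partial>f/\<partial>x\<^sup>\<mu>\<close> at a point of the manifold, \<open>x\<close> being the coordinates of the chart \<open>c\<close>.\<close>

definition chart_partial :: "('m, 'd::finite) chart \<Rightarrow> 'd \<Rightarrow> ('m \<Rightarrow> real) \<Rightarrow> 'm \<Rightarrow> real" where
  "chart_partial c \<mu> f q = partial \<mu> (\<lambda>x. f (coord_inv c x)) (coord c q)"

definition jacobian :: "('m, 'd::finite) chart \<Rightarrow> ('m, 'd) chart \<Rightarrow> 'm \<Rightarrow> 'd matrix" where
  "jacobian c c' q = (\<chi> \<nu> \<mu>. chart_partial c \<mu> (\<lambda>q'. coord c' q' $ \<nu>) q)"

definition is_chart :: "('m::topological_space, 'd::finite) chart \<Rightarrow> bool" where
  "is_chart c \<longleftrightarrow> open (dom_ch c) \<and> open (coord_range c) \<and>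
     homeomorphism (dom_ch c) (coord_range c) (coord c) (coord_inv c)"

definition oriented_atlas :: "('m::topological_space, 'd::finite) chart set \<Rightarrow> bool" where
  "oriented_atlas \<A> \<longleftrightarrow> (\<forall>c\<in>\<A>. is_chart c) \<and> (\<Union>c\<in>\<A>. dom_ch c) = UNIV \<and>
     (\<forall>c\<in>\<A>. \<forall>c'\<in>\<A>.
        (\<forall>\<nu>. smooth_on (coord c ` (dom_ch c \<inter> dom_ch c')) (\<lambda>x. coord c' (coord_inv c x) $ \<nu>)) \<and>
        (\<forall>q \<in> dom_ch c \<inter> dom_ch c'. det (jacobian c c' q) > 0))"

text \<open>Tensor fields are given by their components in every chart, subject to the transformation
  law on overlaps. Only values \<open>T c q\<close> with \<open>c \<in> \<A>\<close> and \<open>q \<in> dom_ch c\<close> are meaningful.\<close>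

type_synonym ('m, 'd) tensor_field = "('m, 'd) chart \<Rightarrow> 'm \<Rightarrow> 'd tensor"
type_synonym ('m, 'd) metric_field = "('m, 'd) chart \<Rightarrow> 'm \<Rightarrow> 'd matrix"
type_synonym ('m, 'd) vector_field = "('m, 'd) chart \<Rightarrow> 'm \<Rightarrow> 'd coords"

definition lorentzian_metric ::
    "('m::topological_space, 'd::finite) chart set \<Rightarrow> ('m, 'd) metric_field \<Rightarrow> bool" where
  "lorentzian_metric \<A> g \<longleftrightarrow>
     (\<forall>c\<in>\<A>. \<forall>q\<in>dom_ch c. lorentzian (g c q)) \<and>
     (\<forall>c\<in>\<A>. \<forall>\<mu> \<nu>. smooth_in_chart c (\<lambda>q. g c q $ \<mu> $ \<nu>)) \<and>
     (\<forall>c\<in>\<A>. \<forall>c'\<in>\<A>. \<forall>q \<in> dom_ch c \<inter> dom_ch c'. g c q = pull_metric (jacobian c c' q) (g c' q))"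

definition covariant_field ::
    "('m::topological_space, 'd::finite) chart set \<Rightarrow> nat \<Rightarrow> ('m, 'd) tensor_field \<Rightarrow> bool" where
  "covariant_field \<A> r T \<longleftrightarrow>
     (\<forall>c\<in>\<A>. \<forall>q\<in>dom_ch c. tensor_of_rank r (T c q)) \<and>
     (\<forall>c\<in>\<A>. \<forall>\<mu>s. smooth_in_chart c (\<lambda>q. T c q \<mu>s)) \<and>
     (\<forall>c\<in>\<A>. \<forall>c'\<in>\<A>. \<forall>q \<in> dom_ch c \<inter> dom_ch c'. T c q = pull r (jacobian c c' q) (T c' q))"

definition form_field ::
    "('m::topological_space, 'd::finite) chart set \<Rightarrow> nat \<Rightarrow> ('m, 'd) tensor_field \<Rightarrow> bool" where
  "form_field \<A> r T \<longleftrightarrow> covariant_field \<A> r T \<and> (\<forall>c\<in>\<A>. \<forall>q\<in>dom_ch c. antisymmetric r (T c q))"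

definition contravariant_vector_field ::
    "('m::topological_space, 'd::finite) chart set \<Rightarrow> ('m, 'd) vector_field \<Rightarrow> bool" where
  "contravariant_vector_field \<A> K \<longleftrightarrow>
     (\<forall>c\<in>\<A>. \<forall>\<mu>. smooth_in_chart c (\<lambda>q. K c q $ \<mu>)) \<and>
     (\<forall>c\<in>\<A>. \<forall>c'\<in>\<A>. \<forall>q \<in> dom_ch c \<inter> dom_ch c'. K c' q = jacobian c c' q *v K c q)"

definition smooth_scalar :: "('m::topological_space, 'd::finite) chart set \<Rightarrow> ('m \<Rightarrow> real) \<Rightarrow> bool" where
  "smooth_scalar \<A> f \<longleftrightarrow> (\<forall>c\<in>\<A>. smooth_in_chart c f)"

text \<open>The measure \<open>d\<^sup>dx \<surd>-g\<close>; the conditions determine it uniquely.\<close>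

definition volume_measure ::
    "('m::topological_space, 'd::finite) chart set \<Rightarrow> ('m, 'd) metric_field \<Rightarrow> 'm measure \<Rightarrow> bool" where
  "volume_measure \<A> g vol \<longleftrightarrow> sets vol = sets borel \<and>
     (\<forall>c\<in>\<A>. \<forall>S\<in>sets borel. S \<subseteq> dom_ch c \<longrightarrow>
        emeasure vol S = (\<integral>\<^sup>+x\<in>coord c ` S. ennreal (sqrt_minus_det (g c (coord_inv c x))) \<partial>lborel))"

text \<open>Scalar quantities are computed at each point in some chart around that point.\<close>

definition chart_at :: "('m, 'd) chart set \<Rightarrow> 'm \<Rightarrow> ('m, 'd) chart" where
  "chart_at \<A> q = (SOME c. c \<in> \<A> \<and> q \<in> dom_ch c)"

definition gradient :: "('m, 'd::finite) chart \<Rightarrow> ('m \<Rightarrow> real) \<Rightarrow> 'm \<Rightarrow> 'd coords" where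
  "gradient c f q = (\<chi> \<mu>. chart_partial c \<mu> f q)"

definition timelike_gradient ::
    "('m, 'd::finite) chart set \<Rightarrow> ('m, 'd) metric_field \<Rightarrow> ('m \<Rightarrow> real) \<Rightarrow> bool" where
  "timelike_gradient \<A> g a \<longleftrightarrow> (\<forall>c\<in>\<A>. \<forall>q\<in>dom_ch c. covector_norm2 (g c q) (gradient c a q) < 0)"

definition divergence ::
    "('m, 'd::finite) metric_field \<Rightarrow> ('m, 'd) vector_field \<Rightarrow> ('m, 'd) chart \<Rightarrow> 'm \<Rightarrow> real" where
  "divergence g K c q = 1 / sqrt_minus_det (g c q) *
     (\<Sum>\<mu>\<in>UNIV. chart_partial c \<mu> (\<lambda>q'. sqrt_minus_det (g c q') * K c q' $ \<mu>) q)"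


section \<open>The action and its local transformations\<close>

definition field_strength :: "nat \<Rightarrow> ('m, 'd::finite) tensor_field \<Rightarrow> ('m, 'd) tensor_field" where
  "field_strength p A c q = (\<lambda>\<mu>s. real (p + 1) *
     antisymmetrize (p + 1) (\<lambda>\<nu>s. chart_partial c (hd \<nu>s) (\<lambda>q'. A c q' (tl \<nu>s)) q) \<mu>s)"

definition lagrangian_field ::
    "('m, 'd::{finite,linorder}) chart set \<Rightarrow> ('m, 'd) metric_field \<Rightarrow> nat \<Rightarrow>
     ('d tensor \<Rightarrow> 'd matrix \<Rightarrow> real) \<Rightarrow>
     ('m, 'd) tensor_field \<Rightarrow> ('m \<Rightarrow> real) \<Rightarrow> ('m, 'd) tensor_field \<Rightarrow> 'm \<Rightarrow> real" where
  "lagrangian_field \<A> g p V A a \<Lambda> q = (let c = chart_at \<A> q in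
     lagrangian p V (g c q) (gradient c a q) (field_strength p A c q) (\<Lambda> c q))"

text \<open>The action over a region \<open>C\<close> of the manifold.\<close>

definition action ::
    "('m, 'd::{finite,linorder}) chart set \<Rightarrow> ('m, 'd) metric_field \<Rightarrow> 'm measure \<Rightarrow> nat \<Rightarrow>
     ('d tensor \<Rightarrow> 'd matrix \<Rightarrow> real) \<Rightarrow> 'm set \<Rightarrow>
     ('m, 'd) tensor_field \<Rightarrow> ('m \<Rightarrow> real) \<Rightarrow> ('m, 'd) tensor_field \<Rightarrow> real" where
  "action \<A> g vol p V C A a \<Lambda> = (LINT q:C|vol. lagrangian_field \<A> g p V A a \<Lambda> q)"

text \<open>First-order invariance up to boundary terms: over every compact region on which the action
  of the given fields is defined, its first variation is the integral of the divergence of one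
  smooth vector field \<open>K\<close>. (The integrability condition only matters because \<open>V\<close> is
  arbitrary; it holds on all compact sets if \<open>V\<close> is continuous.) On a non-compact
  manifold the mere existence of \<open>K\<close> would say nothing, so \<open>K\<close> is moreover required to be
  local: it vanishes on every open set on which the parameter of the transformation vanishes
  (\<open>Z\<close> is the zero set of the parameter). By Gauss's theorem the variation is then zero for
  every parameter with compact support in the interior of the region.\<close>

definition invariant_up_to_boundary_terms ::
    "('m::topological_space, 'd::{finite,linorder}) chart set \<Rightarrow> ('m, 'd) metric_field \<Rightarrow>
     'm measure \<Rightarrow> nat \<Rightarrow> ('d tensor \<Rightarrow> 'd matrix \<Rightarrow> real) \<Rightarrow>
     ('m, 'd) tensor_field \<Rightarrow> ('m \<Rightarrow> real) \<Rightarrow> ('m, 'd) tensor_field \<Rightarrow>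
     ('m, 'd) tensor_field \<Rightarrow> ('m \<Rightarrow> real) \<Rightarrow> ('m, 'd) tensor_field \<Rightarrow> 'm set \<Rightarrow> bool" where
  "invariant_up_to_boundary_terms \<A> g vol p V A a \<Lambda> \<delta>A \<delta>a \<delta>\<Lambda> Z \<longleftrightarrow>
     (\<exists>K. contravariant_vector_field \<A> K \<and>
        (\<forall>c\<in>\<A>. \<forall>q \<in> dom_ch c \<inter> interior Z. K c q = 0) \<and>
        (\<forall>C. compact C \<and> set_integrable vol C (lagrangian_field \<A> g p V A a \<Lambda>) \<longrightarrow>
           ((\<lambda>\<epsilon>. action \<A> g vol p V C
                   (\<lambda>c q \<mu>s. A c q \<mu>s + \<epsilon> * \<delta>A c q \<mu>s)
                   (\<lambda>q. a q + \<epsilon> * \<delta>a q)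
                   (\<lambda>c q \<mu>s. \<Lambda> c q \<mu>s + \<epsilon> * \<delta>\<Lambda> c q \<mu>s))
             has_real_derivative (LINT q:C|vol. divergence g K (chart_at \<A> q) q)) (at 0)))"

definition delta_A_psi :: "('m, 'd::finite) metric_field \<Rightarrow> nat \<Rightarrow> ('m \<Rightarrow> real) \<Rightarrow>
    ('m, 'd) tensor_field \<Rightarrow> ('m, 'd) tensor_field" where
  "delta_A_psi g p a \<psi> c q = (\<lambda>\<mu>s. real p *
     antisymmetrize p (\<lambda>\<nu>s. unit_covector (g c q) (gradient c a q) $ hd \<nu>s * \<psi> c q (tl \<nu>s)) \<mu>s)"

definition delta_A_phi :: "('m, 'd::{finite,linorder}) metric_field \<Rightarrow> nat \<Rightarrow>
    ('m, 'd) tensor_field \<Rightarrow> ('m \<Rightarrow> real) \<Rightarrow> ('m, 'd) tensor_field \<Rightarrow> ('m \<Rightarrow> real) \<Rightarrow>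
    ('m, 'd) tensor_field" where
  "delta_A_phi g p A a \<Lambda> \<phi> c q = (let
      da = gradient c a q;
      v = unit_vector (g c q) da;
      F = field_strength p A c q;
      E = contract_last p F v;
      B = contract_last p (hodge (g c q) (p + 1) F) v;
      l = contract_last p (\<Lambda> c q) v
    in (\<lambda>\<mu>s. - (\<phi> q / sqrt (- covector_norm2 (g c q) da)) * (E \<mu>s + B \<mu>s + 2 * l \<mu>s)))"

end

(*
  Contraction with the dual of a form can be written with the Levi-Civita symbol alone, without
  the metric: X.(i_v Y* ) is the top form X ^ v ^ Y up to a factor, and so are all terms of the
  Lagrangian other than V. Antisymmetrization over d + 1 indices (Schouten's identity) together
  with F** = F and Lambda* = Lambda then shows that, with G = E + B + 2 lambda, the first variation
  is the sum of -1/2 (delta F ^ F), which is exact, of G ^ v ^ delta F, and of 1/2 (G ^ v ^ w ^ G),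
  where w is the variation of the unit covector v = N da.

  For delta A = v ^ psi the form delta F is divisible by v, because dv = d(ln N) ^ v, and w = 0.
  For delta A = -chi G with chi = phi N, both remaining terms together are the exterior derivative
  of a multiple of chi (v ^ G ^ G), since w = N d phi modulo v and d chi = N d phi + phi dN.

  The boundary current is the dual of these two (d-1)-forms and is algebraic in the parameter,
  hence local.
*)
theory Submission
  imports Defs "HOL-Combinatorics.Multiset_Permutations"
begin

section \<open>Partial derivatives\<close>

text \<open>Two obstacles shape the development. The function \<open>V\<close> is arbitrary, so
  nothing can be expanded in it; since neither \<Lambda> nor the metric is varied, only the
  difference between the perturbed and the unperturbed Lagrangian is expanded, and there
  \<open>V\<close> cancels. To differentiate under the integral, the remainder of this expansion is
  bounded by a multiple of \<epsilon>^2 uniformly on compact sets, and a compact region is cut into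
  finitely many compact pieces, each inside one chart. Moreover, tensor fields are mere families of
  components, so every field built on the way (field strength, dual, normal, current) has to be
  shown to transform correctly before a convenient chart may be chosen. Evenness of p enters only
  through signs: in Lorentzian signature the dual is an involution on forms of the odd degree p + 1,
  two such forms anticommute under the wedge, and forms of degree p commute with everything. With
  the coefficients 1/2, -1/2 and 1 of the action, the terms bilinear in E, B and \<lambda> that
  multiply w add up to the square of G.\<close>

lemma partial_eqI:
  assumes "(f has_derivative f') (at x)"
  shows "partial i f x = f' (axis i 1)"
proof -
  interpret f': bounded_linear f' using assms by (rule has_derivative_bounded_linear)
  have "((\<lambda>t. f (x + t *\<^sub>R axis i 1)) has_derivative (\<lambda>t. f' (t *\<^sub>R axis i 1))) (at (0::real))"
    by (rule has_derivative_compose[of "\<lambda>t. x + t *\<^sub>R axis i 1" _ 0 UNIV f f', simplified])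
       (use assms in \<open>auto intro!: derivative_eq_intros\<close>)
  hence "((\<lambda>t. f (x + t *\<^sub>R axis i 1)) has_field_derivative f' (axis i 1)) (at (0::real))"
    by (simp add: has_field_derivative_def f'.scaleR mult.commute[of _ "f' (axis i 1)"] mult_commute_abs)
  thus ?thesis unfolding partial_def by (rule DERIV_imp_deriv)
qed

text \<open>A derivative is linear, so it is determined by its values on the basis vectors, and
  these are the partial derivatives.\<close>

lemma has_derivative_partial:
  fixes f :: "'d::finite coords \<Rightarrow> real"
  assumes "f differentiable (at x)"
  shows "(f has_derivative (\<lambda>h. \<Sum>i\<in>UNIV. h $ i * partial i f x)) (at x)"
proof -
  obtain f' where f': "(f has_derivative f') (at x)"
    using assms by (auto simp: differentiable_def)
  interpret f': bounded_linear f' using f' by (rule has_derivative_bounded_linear)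
  have "f' h = (\<Sum>i\<in>UNIV. h $ i * partial i f x)" for h
  proof -
    have "f' h = f' (\<Sum>i\<in>UNIV. h $ i *\<^sub>R axis i 1)"
      by (metis (no_types) scalar_mult_eq_scaleR basis_expansion)
    thus ?thesis by (simp add: f'.sum f'.scaleR partial_eqI[OF f'])
  qed
  hence "f' = (\<lambda>h. \<Sum>i\<in>UNIV. h $ i * partial i f x)" by auto
  with f' show ?thesis by simp
qed

lemma eventually_line_in_open:
  fixes x :: "'d::finite coords"
  assumes "open U" "x \<in> U"
  shows "\<forall>\<^sub>F t in nhds 0. x + t *\<^sub>R y \<in> U"
proof -
  have "((\<lambda>t. x + t *\<^sub>R y) \<longlongrightarrow> x + 0 *\<^sub>R y) (nhds 0)"
    by (intro tendsto_intros filterlim_ident)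
  thus ?thesis using topological_tendstoD[OF _ assms(1)] assms(2) by simp
qed

lemma partial_cong:
  assumes "open U" "x \<in> U" "\<And>y. y \<in> U \<Longrightarrow> f y = g y"
  shows "partial i f x = partial i g x"
  unfolding partial_def using eventually_line_in_open[OF assms(1,2), of "axis i 1"]
  by (intro deriv_cong_ev) (auto elim!: eventually_mono simp: assms(3))

lemma differentiable_cong_open:
  assumes "open U" "x \<in> U" "\<And>y. y \<in> U \<Longrightarrow> f y = g y" "f differentiable (at x)"
  shows "g differentiable (at x)"
  using assms has_derivative_transform_within_open[OF _ assms(1,2), of f _ UNIV g]
  unfolding differentiable_def by auto

lemma partial_add:
  assumes "f differentiable (at x)" "g differentiable (at x)"
  shows "partial i (\<lambda>x. f x + g x) x = partial i f x + partial i g x"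
  using partial_eqI[OF has_derivative_add[OF has_derivative_partial[OF assms(1)]
    has_derivative_partial[OF assms(2)]], of i]
  by (simp add: axis_def if_distrib[of "\<lambda>t. t * _"] cong: if_cong)

lemma partial_mult:
  assumes "f differentiable (at x)" "g differentiable (at x)"
  shows "partial i (\<lambda>x. f x * g x) x = partial i f x * g x + f x * partial i g x"
  using partial_eqI[OF has_derivative_mult[OF has_derivative_partial[OF assms(1)]
    has_derivative_partial[OF assms(2)]], of i]
  by (simp add: axis_def if_distrib[of "\<lambda>t. t * _"] cong: if_cong)

lemma partial_const [simp]: "partial i (\<lambda>x. c) x = 0"
  using partial_eqI[OF has_derivative_const] .

lemma partial_DERIV:
  assumes "f differentiable (at x)" "(h has_real_derivative D) (at (f x))"
  shows "partial i (\<lambda>x. h (f x)) x = D * partial i f x"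
proof -
  have "((\<lambda>x. h (f x)) has_derivative (\<lambda>y. D * (\<Sum>i\<in>UNIV. y $ i * partial i f x))) (at x)"
    using has_derivative_compose[OF has_derivative_partial[OF assms(1)], of h "(*) D"] assms(2)
    by (simp add: has_field_derivative_def)
  from partial_eqI[OF this, of i] show ?thesis
    by (simp add: axis_def if_distrib[of "\<lambda>t. t * _"] cong: if_cong)
qed

lemma partial_compose:
  fixes \<Phi> :: "'d::finite coords \<Rightarrow> 'd coords"
  assumes "\<And>\<nu>. (\<lambda>x. \<Phi> x $ \<nu>) differentiable (at x)" "f differentiable (at (\<Phi> x))"
  shows "partial i (\<lambda>x. f (\<Phi> x)) x = (\<Sum>\<nu>\<in>UNIV. partial i (\<lambda>x. \<Phi> x $ \<nu>) x * partial \<nu> f (\<Phi> x))"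
    and "(\<lambda>x. f (\<Phi> x)) differentiable (at x)"
proof -
  have "(\<Phi> has_derivative (\<lambda>h. \<chi> \<nu>. \<Sum>i\<in>UNIV. h $ i * partial i (\<lambda>x. \<Phi> x $ \<nu>) x)) (at x)"
    unfolding has_derivative_componentwise_within[of \<Phi>]
    by (auto simp: Basis_vec_def inner_axis has_derivative_partial[OF assms(1)])
  from has_derivative_compose[OF this has_derivative_partial[OF assms(2)]]
  have *: "((\<lambda>x. f (\<Phi> x)) has_derivative
    (\<lambda>h. \<Sum>\<nu>\<in>UNIV. (\<Sum>i\<in>UNIV. h $ i * partial i (\<lambda>x. \<Phi> x $ \<nu>) x) * partial \<nu> f (\<Phi> x))) (at x)"
    by simp
  show "partial i (\<lambda>x. f (\<Phi> x)) x = (\<Sum>\<nu>\<in>UNIV. partial i (\<lambda>x. \<Phi> x $ \<nu>) x * partial \<nu> f (\<Phi> x))"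
    using partial_eqI[OF *, of i]
    by (simp add: axis_def if_distrib[of "\<lambda>t. t * _"] cong: if_cong)
  show "(\<lambda>x. f (\<Phi> x)) differentiable (at x)" using * by (auto simp: differentiable_def)
qed


section \<open>Smooth functions\<close>

text \<open>Differentiability up to order n + 1. The finite levels make closure under sums,
  products, inverses and roots provable by induction on n.\<close>

primrec nsmooth :: "nat \<Rightarrow> 'd::finite coords set \<Rightarrow> ('d coords \<Rightarrow> real) \<Rightarrow> bool" where
  "nsmooth 0 U f \<longleftrightarrow> (\<forall>x\<in>U. f differentiable (at x))"
| "nsmooth (Suc n) U f \<longleftrightarrow> (\<forall>x\<in>U. f differentiable (at x)) \<and> (\<forall>i. nsmooth n U (partial i f))"

text \<open>\<open>iterated_partial\<close> applies the head of its list last, whereas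
  \<open>nsmooth\<close> recurses into a function that has been differentiated already; this
  mediates between the two orders.\<close>

lemma iterated_partial_snoc: "iterated_partial (is @ [i]) f = iterated_partial is (partial i f)"
  by (induction "is") auto

lemma nsmooth_iff_iterated_partial:
  "nsmooth n U f \<longleftrightarrow> (\<forall>is. length is \<le> n \<longrightarrow> (\<forall>x\<in>U. iterated_partial is f differentiable (at x)))"
proof (induction n arbitrary: f)
  case (Suc n)
  show ?case
  proof (intro iffI allI impI)
    fix "is" :: "'a list"
    assume "nsmooth (Suc n) U f" "length is \<le> Suc n"
    thus "\<forall>x\<in>U. iterated_partial is f differentiable (at x)"
      by (cases "is" rule: rev_cases) (auto simp: Suc iterated_partial_snoc)
  next
    assume *: "\<forall>is. length is \<le> Suc n \<longrightarrow> (\<forall>x\<in>U. iterated_partial is f differentiable (at x))"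
    have "iterated_partial is (partial i f) differentiable (at x)" if "length is \<le> n" "x \<in> U" for i x "is"
      using *[rule_format, of "is @ [i]" x] that by (simp add: iterated_partial_snoc)
    with *[rule_format, of "[]"] show "nsmooth (Suc n) U f" by (auto simp: Suc)
  qed
qed auto

lemma smooth_on_iff_nsmooth: "smooth_on U f \<longleftrightarrow> (\<forall>n. nsmooth n U f)"
  unfolding nsmooth_iff_iterated_partial smooth_on_def by (meson order_refl)

lemma nsmooth_differentiable: "nsmooth n U f \<Longrightarrow> x \<in> U \<Longrightarrow> f differentiable (at x)"
  by (cases n) auto

lemma nsmooth_SucD: "nsmooth (Suc n) U f \<Longrightarrow> nsmooth n U f"
  by (induction n arbitrary: f) auto

text \<open>Partial derivatives are local, so a formula for a derivative that holds only on the open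
  set U may be substituted there at every level.\<close>

lemma nsmooth_cong:
  assumes "open U" "\<And>y. y \<in> U \<Longrightarrow> f y = g y" "nsmooth n U f"
  shows "nsmooth n U g"
  using assms(2,3)
proof (induction n arbitrary: f g)
  case 0
  have "g differentiable (at x)" if "x \<in> U" for x
    by (rule differentiable_cong_open[OF assms(1) that 0(1)]) (use 0(2) that in auto)
  thus ?case by simp
next
  case (Suc n)
  have "nsmooth n U (partial i g)" for i
    by (rule Suc.IH[of "partial i f"]) (use Suc.prems partial_cong[OF assms(1) _ Suc.prems(1)] in auto)
  moreover have "g differentiable (at x)" if "x \<in> U" for x
    by (rule differentiable_cong_open[OF assms(1) that Suc.prems(1)]) (use Suc.prems(2) that in auto)
  ultimately show ?case by simp
qed

lemma nsmooth_const: "open U \<Longrightarrow> nsmooth n U (\<lambda>x. c)"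
proof (induction n arbitrary: c)
  case (Suc n)
  have "nsmooth n U (partial i (\<lambda>x. c))" for i
    by (rule nsmooth_cong[OF Suc.prems _ Suc.IH[OF Suc.prems, of 0]]) simp
  thus ?case by simp
qed simp

lemma nsmooth_add: "open U \<Longrightarrow> nsmooth n U f \<Longrightarrow> nsmooth n U g \<Longrightarrow> nsmooth n U (\<lambda>x. f x + g x)"
proof (induction n arbitrary: f g)
  case (Suc n)
  have "nsmooth n U (partial i (\<lambda>x. f x + g x))" for i
    by (rule nsmooth_cong[OF Suc.prems(1) _ Suc.IH[of "partial i f" "partial i g"]])
       (use Suc.prems in \<open>auto simp: partial_add\<close>)
  thus ?case using Suc.prems by auto
qed auto

text \<open>Each summand of the product rule pairs a derivative of level n with an undifferentiated
  factor, which \<open>nsmooth_SucD\<close> lowers to level n as well.\<close>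

lemma nsmooth_mult: "open U \<Longrightarrow> nsmooth n U f \<Longrightarrow> nsmooth n U g \<Longrightarrow> nsmooth n U (\<lambda>x. f x * g x)"
proof (induction n arbitrary: f g)
  case (Suc n)
  have "nsmooth n U (partial i (\<lambda>x. f x * g x))" for i
    by (rule nsmooth_cong[OF Suc.prems(1) _ nsmooth_add[OF _ Suc.IH[of "partial i f" g] Suc.IH[of f "partial i g"]]])
       (use Suc.prems nsmooth_SucD[OF Suc.prems(2)] nsmooth_SucD[OF Suc.prems(3)] in \<open>auto simp: partial_mult\<close>)
  thus ?case using Suc.prems by auto
qed auto

text \<open>The derivative of 1/f is -(1/f)^2 times that of f, so level n + 1 of 1/f rests on level
  n of 1/f itself, that is, on the induction hypothesis.\<close>

lemma nsmooth_inverse: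
  "open U \<Longrightarrow> nsmooth n U f \<Longrightarrow> (\<And>x. x \<in> U \<Longrightarrow> f x \<noteq> 0) \<Longrightarrow> nsmooth n U (\<lambda>x. inverse (f x))"
proof (induction n)
  case 0
  thus ?case by (auto intro!: differentiable_inverse)
next
  case (Suc n)
  have IH: "nsmooth n U (\<lambda>x. inverse (f x))"
    using Suc nsmooth_SucD by blast
  have "nsmooth n U (partial i (\<lambda>x. inverse (f x)))" for i
  proof (rule nsmooth_cong[OF Suc.prems(1)])
    show "nsmooth n U (\<lambda>x. (- 1 * (inverse (f x) * inverse (f x))) * partial i f x)"
      using Suc.prems IH by (intro nsmooth_mult nsmooth_const) auto
    fix x assume x: "x \<in> U"
    have "(inverse has_real_derivative - 1 * (inverse (f x) * inverse (f x))) (at (f x))"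
      using DERIV_inverse'[OF DERIV_ident, of "f x"] Suc.prems(3)[OF x] by simp
    from partial_DERIV[OF nsmooth_differentiable[OF Suc.prems(2) x] this, of i]
    show "(- 1 * (inverse (f x) * inverse (f x))) * partial i f x = partial i (\<lambda>x. inverse (f x)) x"
      by simp
  qed
  thus ?case using Suc.prems by (auto intro!: differentiable_inverse)
qed

text \<open>The derivative contains the reciprocal of sqrt f, whose level n follows from the
  induction hypothesis for sqrt f together with \<open>nsmooth_inverse\<close>.\<close>

lemma nsmooth_sqrt:
  "open U \<Longrightarrow> nsmooth n U f \<Longrightarrow> (\<And>x. x \<in> U \<Longrightarrow> f x > 0) \<Longrightarrow> nsmooth n U (\<lambda>x. sqrt (f x))"
proof (induction n)
  case 0
  have "(\<lambda>x. sqrt (f x)) differentiable (at x)" if "x \<in> U" for x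
    using 0 that differentiable_compose[of sqrt f x UNIV] DERIV_real_sqrt[of "f x"]
    by (auto simp: real_differentiable_def)
  thus ?case by simp
next
  case (Suc n)
  have IH: "nsmooth n U (\<lambda>x. sqrt (f x))"
    using Suc nsmooth_SucD by blast
  have "nsmooth n U (partial i (\<lambda>x. sqrt (f x)))" for i
  proof (rule nsmooth_cong[OF Suc.prems(1)])
    show "nsmooth n U (\<lambda>x. (inverse (sqrt (f x)) * (1/2)) * partial i f x)"
      using Suc.prems IH
      by (intro nsmooth_mult nsmooth_const nsmooth_inverse) (auto dest: Suc.prems(3))
    fix x assume x: "x \<in> U"
    from partial_DERIV[OF nsmooth_differentiable[OF Suc.prems(2) x] DERIV_real_sqrt[OF Suc.prems(3)[OF x]], of i]
    show "(inverse (sqrt (f x)) * (1/2)) * partial i f x = partial i (\<lambda>x. sqrt (f x)) x"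
      by simp
  qed
  moreover have "(\<lambda>x. sqrt (f x)) differentiable (at x)" if "x \<in> U" for x
    using IH nsmooth_differentiable that by blast
  ultimately show ?case by auto
qed

lemma smooth_on_cong: "open U \<Longrightarrow> (\<And>y. y \<in> U \<Longrightarrow> f y = g y) \<Longrightarrow> smooth_on U f \<Longrightarrow> smooth_on U g"
  unfolding smooth_on_iff_nsmooth using nsmooth_cong by blast

lemma smooth_on_const: "open U \<Longrightarrow> smooth_on U (\<lambda>x. c)"
  unfolding smooth_on_iff_nsmooth using nsmooth_const by blast

lemma smooth_on_add: "open U \<Longrightarrow> smooth_on U f \<Longrightarrow> smooth_on U g \<Longrightarrow> smooth_on U (\<lambda>x. f x + g x)"
  unfolding smooth_on_iff_nsmooth using nsmooth_add by blast

lemma smooth_on_mult: "open U \<Longrightarrow> smooth_on U f \<Longrightarrow> smooth_on U g \<Longrightarrow> smooth_on U (\<lambda>x. f x * g x)"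
  unfolding smooth_on_iff_nsmooth using nsmooth_mult by blast

lemma smooth_on_inverse:
  "open U \<Longrightarrow> smooth_on U f \<Longrightarrow> (\<And>x. x \<in> U \<Longrightarrow> f x \<noteq> 0) \<Longrightarrow> smooth_on U (\<lambda>x. inverse (f x))"
  unfolding smooth_on_iff_nsmooth using nsmooth_inverse by blast

lemma smooth_on_sqrt:
  "open U \<Longrightarrow> smooth_on U f \<Longrightarrow> (\<And>x. x \<in> U \<Longrightarrow> f x > 0) \<Longrightarrow> smooth_on U (\<lambda>x. sqrt (f x))"
  unfolding smooth_on_iff_nsmooth using nsmooth_sqrt by blast

lemma smooth_on_partial: "smooth_on U f \<Longrightarrow> smooth_on U (partial i f)"
  unfolding smooth_on_iff_nsmooth by (meson nsmooth.simps(2))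

lemma smooth_on_differentiable: "smooth_on U f \<Longrightarrow> x \<in> U \<Longrightarrow> f differentiable (at x)"
  unfolding smooth_on_iff_nsmooth using nsmooth_differentiable by blast

lemma smooth_on_subset: "smooth_on U f \<Longrightarrow> W \<subseteq> U \<Longrightarrow> smooth_on W f"
  unfolding smooth_on_def by blast


section \<open>Symmetry of second partial derivatives\<close>

text \<open>The mean value theorem along e_i turns the second difference into an increment of the
  i-th partial derivative in direction e_j, and differentiability of that partial at the single
  point x evaluates the increment up to o(h).\<close>

lemma second_difference_tendsto:
  fixes f :: "'d::finite coords \<Rightarrow> real"
  assumes "open U" "x \<in> U" "\<And>y. y \<in> U \<Longrightarrow> f differentiable (at y)" "partial i f differentiable (at x)"
  shows "((\<lambda>h. (f (x + h *\<^sub>R axis i 1 + h *\<^sub>R axis j 1) - f (x + h *\<^sub>R axis i 1)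
      - f (x + h *\<^sub>R axis j 1) + f x) / h\<^sup>2) \<longlongrightarrow> partial j (partial i f) x) (at_right 0)"
proof (rule tendstoI)
  fix e :: real assume e: "e > 0"
  define ei ej :: "'d coords" where "ei = axis i 1" and "ej = axis j 1"
  have norms: "norm ei = 1" "norm ej = 1" by (auto simp: ei_def ej_def)
  obtain L where L: "(partial i f has_derivative L) (at x)"
    using assms(4) by (auto simp: differentiable_def)
  interpret L: bounded_linear L using L by (rule has_derivative_bounded_linear)
  have Lj: "partial j (partial i f) x = L ej" unfolding ej_def by (rule partial_eqI[OF L])
  obtain d1 where d1: "d1 > 0"
    "\<And>y. norm (y - x) < d1 \<Longrightarrow> \<bar>partial i f y - partial i f x - L (y - x)\<bar> \<le> e / 4 * norm (y - x)"
    using L[unfolded has_derivative_at_alt] e by (auto dest!: spec[of _ "e/4"])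
  obtain d2 where d2: "d2 > 0" "ball x d2 \<subseteq> U" using assms(1,2) openE by blast
  \<comment> \<open>\<open>d1\<close> guards the linear approximation and \<open>d2\<close> keeps
    points inside U. The halving accounts for x + s e_i + t e_j with s, t \<le> h being as far as 2h
    from x.\<close>
  define d where "d = min d1 d2 / 2"
  have dpos: "d > 0" using d1 d2 by (auto simp: d_def)
  have "dist ((f (x + h *\<^sub>R ei + h *\<^sub>R ej) - f (x + h *\<^sub>R ei) - f (x + h *\<^sub>R ej) + f x) / h\<^sup>2) (L ej) < e"
    if h: "0 < h" "h < d" for h
  proof -
    have small: "norm (s *\<^sub>R ei + t *\<^sub>R ej) \<le> s + t" if "0 \<le> s" "0 \<le> t" for s t
      using norm_triangle_ineq[of "s *\<^sub>R ei" "t *\<^sub>R ej"] that norms by simp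
    have in_ball: "x + s *\<^sub>R ei + t *\<^sub>R ej \<in> U \<and> norm (s *\<^sub>R ei + t *\<^sub>R ej) < d1"
      if "0 \<le> s" "s \<le> h" "0 \<le> t" "t \<le> h" for s t
    proof -
      have "norm (s *\<^sub>R ei + t *\<^sub>R ej) < 2 * d" using small[of s t] that h by simp
      thus ?thesis using d2(2) by (auto simp: d_def dist_norm norm_minus_commute subset_iff algebra_simps
            simp flip: scaleR_add_right)
    qed
    \<comment> \<open>The increment of \<open>g\<close> over [0, h] is the second
      difference.\<close>
    define g where "g s = f (x + s *\<^sub>R ei + h *\<^sub>R ej) - f (x + s *\<^sub>R ei)" for s
    have deriv1: "((\<lambda>s. f (x + s *\<^sub>R ei + t *\<^sub>R ej)) has_real_derivative
        partial i f (x + s *\<^sub>R ei + t *\<^sub>R ej)) (at s)"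
      if st: "0 \<le> s" "s \<le> h" "0 \<le> t" "t \<le> h" for s t
    proof -
      obtain f' where f': "(f has_derivative f') (at (x + s *\<^sub>R ei + t *\<^sub>R ej))"
        using assms(3) in_ball[OF st] by (auto simp: differentiable_def)
      interpret f': bounded_linear f' using f' by (rule has_derivative_bounded_linear)
      have "((\<lambda>s. f (x + s *\<^sub>R ei + t *\<^sub>R ej)) has_derivative (\<lambda>k. f' (k *\<^sub>R ei))) (at s)"
        by (rule has_derivative_compose[of "\<lambda>s. x + s *\<^sub>R ei + t *\<^sub>R ej" _ s UNIV f f', simplified])
           (use f' in \<open>auto intro!: derivative_eq_intros\<close>)
      thus ?thesis
        by (simp add: has_field_derivative_def f'.scaleR partial_eqI[OF f', of i, folded ei_def] mult_commute_abs)
    qed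
    have "(g has_real_derivative partial i f (x + s *\<^sub>R ei + h *\<^sub>R ej) - partial i f (x + s *\<^sub>R ei)) (at s)"
      if "0 \<le> s" "s \<le> h" for s
      unfolding g_def using deriv1[of s h] deriv1[of s 0] that h by (auto intro!: DERIV_diff)
    then obtain \<xi> where \<xi>: "0 < \<xi>" "\<xi> < h"
      "g h - g 0 = (h - 0) * (partial i f (x + \<xi> *\<^sub>R ei + h *\<^sub>R ej) - partial i f (x + \<xi> *\<^sub>R ei))"
      using MVT2[of 0 h g "\<lambda>s. partial i f (x + s *\<^sub>R ei + h *\<^sub>R ej) - partial i f (x + s *\<^sub>R ei)"] h by auto
    have "\<bar>partial i f (x + \<xi> *\<^sub>R ei + h *\<^sub>R ej) - partial i f x - L (\<xi> *\<^sub>R ei + h *\<^sub>R ej)\<bar>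
        \<le> e / 4 * norm (\<xi> *\<^sub>R ei + h *\<^sub>R ej)"
      using d1(2)[of "x + \<xi> *\<^sub>R ei + h *\<^sub>R ej"] in_ball[of \<xi> h] \<xi> h by (simp add: add.assoc)
    moreover have "norm (\<xi> *\<^sub>R ei + h *\<^sub>R ej) < 2 * h" using small[of \<xi> h] \<xi> h by simp
    moreover have "\<bar>partial i f (x + \<xi> *\<^sub>R ei) - partial i f x - L (\<xi> *\<^sub>R ei)\<bar> \<le> e / 4 * \<xi>"
      using d1(2)[of "x + \<xi> *\<^sub>R ei"] in_ball[of \<xi> 0] \<xi> h norms by simp
    moreover have "L (\<xi> *\<^sub>R ei + h *\<^sub>R ej) - L (\<xi> *\<^sub>R ei) = h * L ej" by (simp add: L.add L.scaleR)
    moreover have "e / 4 * norm (\<xi> *\<^sub>R ei + h *\<^sub>R ej) \<le> e / 4 * (2 * h)" "e / 4 * \<xi> \<le> e / 4 * h"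
      using calculation(2) \<xi> e by (auto intro!: mult_left_mono)
    \<comment> \<open>The two errors are at most e/4 times 2h and e/4 times h, which leaves a margin
      below e h.\<close>
    ultimately have "\<bar>(partial i f (x + \<xi> *\<^sub>R ei + h *\<^sub>R ej) - partial i f (x + \<xi> *\<^sub>R ei)) - h * L ej\<bar>
        \<le> e / 4 * (3 * h)" by argo
    also have "\<dots> < e * h" using e h by simp
    finally have "\<bar>(g h - g 0) / h - h * L ej\<bar> < e * h" using \<xi>(3) h by simp
    hence "\<bar>(g h - g 0) / h - h * L ej\<bar> / h < e" using h by (simp add: divide_simps)
    moreover have "\<bar>(g h - g 0) / h - h * L ej\<bar> / h = \<bar>(g h - g 0) / h\<^sup>2 - L ej\<bar>"
      using h by (simp add: abs_if field_simps power2_eq_square)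
    moreover have "g h - g 0 = f (x + h *\<^sub>R ei + h *\<^sub>R ej) - f (x + h *\<^sub>R ei) - f (x + h *\<^sub>R ej) + f x"
      by (simp add: g_def)
    ultimately show ?thesis by (simp add: dist_real_def)
  qed
  thus "\<forall>\<^sub>F h in at_right 0. dist ((f (x + h *\<^sub>R axis i 1 + h *\<^sub>R axis j 1) - f (x + h *\<^sub>R axis i 1)
      - f (x + h *\<^sub>R axis j 1) + f x) / h\<^sup>2) (partial j (partial i f) x) < e"
    unfolding Lj eventually_at_right_field ei_def ej_def using dpos by auto
qed

text \<open>The second difference quotient is symmetric in i and j, so both mixed derivatives are
  limits of one and the same function.\<close>

lemma partial_commute:
  fixes f :: "'d::finite coords \<Rightarrow> real"
  assumes "open U" "x \<in> U" "smooth_on U f"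
  shows "partial i (partial j f) x = partial j (partial i f) x"
proof -
  note diff = smooth_on_differentiable[OF assms(3)]
    smooth_on_differentiable[OF smooth_on_partial[OF assms(3)] assms(2)]
  have "((\<lambda>h. (f (x + h *\<^sub>R axis i 1 + h *\<^sub>R axis j 1) - f (x + h *\<^sub>R axis i 1)
      - f (x + h *\<^sub>R axis j 1) + f x) / h\<^sup>2) \<longlongrightarrow> partial i (partial j f) x) (at_right 0)"
    using second_difference_tendsto[OF assms(1,2) diff, of j i] by (simp add: algebra_simps)
  from tendsto_unique[OF _ this second_difference_tendsto[OF assms(1,2) diff, of i j]]
  show ?thesis by simp
qed


section \<open>Sums over index lists\<close>

lemma lists_of_length_Suc:
  "{xs :: 'a list. length xs = Suc k} = (\<lambda>(a, xs). a # xs) ` (UNIV \<times> {xs. length xs = k})"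
  by (auto simp: length_Suc_conv image_iff)

lemma finite_lists_of_length [simp]: "finite {xs :: 'a::finite list. length xs = k}"
  by (induction k) (auto simp: lists_of_length_Suc)

lemma sum_lists_0 [simp]: "(\<Sum>\<mu> | length \<mu> = 0. f \<mu>) = f []"
  by simp

lemma sum_lists_Suc:
  fixes f :: "'a::finite list \<Rightarrow> 'b::comm_monoid_add"
  shows "(\<Sum>\<mu> | length \<mu> = Suc k. f \<mu>) = (\<Sum>a\<in>UNIV. \<Sum>\<mu> | length \<mu> = k. f (a # \<mu>))"
  unfolding lists_of_length_Suc
  by (subst sum.reindex) (auto simp: inj_on_def sum.cartesian_product case_prod_beta)

lemma sum_lists_append:
  fixes f :: "'a::finite list \<Rightarrow> 'b::comm_monoid_add"
  shows "(\<Sum>\<mu> | length \<mu> = k + l. f \<mu>) = (\<Sum>\<mu> | length \<mu> = k. \<Sum>\<nu> | length \<nu> = l. f (\<mu> @ \<nu>))"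
  by (induction k arbitrary: f) (simp_all add: sum_lists_Suc)

lemma sum_lists_snoc:
  fixes f :: "'a::finite list \<Rightarrow> 'b::comm_monoid_add"
  shows "(\<Sum>\<mu> | length \<mu> = Suc k. f \<mu>) = (\<Sum>\<mu> | length \<mu> = k. \<Sum>a\<in>UNIV. f (\<mu> @ [a]))"
  using sum_lists_append[where k = k and l = 1 and f = f] by (simp add: sum_lists_Suc)

lemma inj_on_permute_list:
  assumes "\<pi> permutes {..<k}"
  shows "inj_on (permute_list \<pi>) {xs. length xs = k}"
proof (rule inj_on_inverseI)
  fix xs :: "'a list" assume "xs \<in> {xs. length xs = k}"
  hence *: "length xs = k" by simp
  show "permute_list (inv \<pi>) (permute_list \<pi> xs) = xs"
    using permute_list_compose[of "inv \<pi>" xs \<pi>] assms permutes_inv[OF assms] permutes_inv_o[OF assms] *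
    by simp
qed

lemma sum_lists_permute:
  fixes f :: "'a::finite list \<Rightarrow> 'b::comm_monoid_add"
  assumes "\<pi> permutes {..<k}"
  shows "(\<Sum>\<mu> | length \<mu> = k. f (permute_list \<pi> \<mu>)) = (\<Sum>\<mu> | length \<mu> = k. f \<mu>)"
proof -
  have "permute_list \<pi> ` {xs :: 'a list. length xs = k} = {xs. length xs = k}"
    by (rule endo_inj_surj) (auto simp: inj_on_permute_list[OF assms])
  thus ?thesis
    using sum.reindex[OF inj_on_permute_list[OF assms], of f] by (simp add: o_def)
qed


section \<open>Contraction with matrices\<close>

text \<open>The product of matrix entries inside \<open>contract_all\<close>, recast recursively so
  that it splits along \<open>Cons\<close> and append.\<close>

fun index_prod :: "'d::finite matrix \<Rightarrow> 'd list \<Rightarrow> 'd list \<Rightarrow> real" where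
  "index_prod M (a # \<mu>) (b # \<nu>) = M $ a $ b * index_prod M \<mu> \<nu>"
| "index_prod M _ _ = 1"

lemma index_prod_eq_prod:
  "length \<mu> = length \<nu> \<Longrightarrow> index_prod M \<mu> \<nu> = (\<Prod>i<length \<mu>. M $ (\<mu> ! i) $ (\<nu> ! i))"
  by (induction \<mu> \<nu> rule: list_induct2) (simp_all add: prod.lessThan_Suc_shift del: prod.lessThan_Suc)

lemma index_prod_append:
  "length \<mu> = length \<nu> \<Longrightarrow> index_prod M (\<mu> @ \<mu>') (\<nu> @ \<nu>') = index_prod M \<mu> \<nu> * index_prod M \<mu>' \<nu>'"
  by (induction \<mu> \<nu> rule: list_induct2) simp_all

lemma index_prod_permute:
  assumes "\<pi> permutes {..<length \<mu>}" "length \<nu> = length \<mu>"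
  shows "index_prod M (permute_list \<pi> \<mu>) (permute_list \<pi> \<nu>) = index_prod M \<mu> \<nu>"
proof -
  have "index_prod M (permute_list \<pi> \<mu>) (permute_list \<pi> \<nu>) = (\<Prod>i<length \<mu>. M $ (\<mu> ! \<pi> i) $ (\<nu> ! \<pi> i))"
    using assms by (simp add: index_prod_eq_prod permute_list_nth)
  also have "\<dots> = (\<Prod>i<length \<mu>. M $ (\<mu> ! i) $ (\<nu> ! i))"
    using prod.permute[OF assms(1), of "\<lambda>i. M $ (\<mu> ! i) $ (\<nu> ! i)"] by (simp add: o_def)
  finally show ?thesis using assms(2) by (simp add: index_prod_eq_prod)
qed

lemma index_prod_mult:
  assumes "length \<mu> = k" "length \<rho> = k"
  shows "(\<Sum>\<nu> | length \<nu> = k. index_prod M \<mu> \<nu> * index_prod N \<nu> \<rho>) = index_prod (M ** N) \<mu> \<rho>"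
  using assms
proof (induction k arbitrary: \<mu> \<rho>)
  case (Suc k)
  then obtain a \<mu>' c \<rho>' where *: "\<mu> = a # \<mu>'" "\<rho> = c # \<rho>'" "length \<mu>' = k" "length \<rho>' = k"
    by (metis length_Suc_conv)
  have "(\<Sum>\<nu> | length \<nu> = Suc k. index_prod M \<mu> \<nu> * index_prod N \<nu> \<rho>)
      = (\<Sum>b\<in>UNIV. M $ a $ b * N $ b $ c * (\<Sum>\<nu> | length \<nu> = k. index_prod M \<mu>' \<nu> * index_prod N \<nu> \<rho>'))"
    by (simp add: sum_lists_Suc * sum_distrib_left mult_ac)
  also have "\<dots> = index_prod (M ** N) \<mu> \<rho>"
    using Suc.IH[OF *(3,4)] by (simp add: * matrix_matrix_mult_def sum_distrib_right)
  finally show ?case .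
qed simp

lemma index_prod_mat_1:
  "length \<mu> = length \<nu> \<Longrightarrow> index_prod (mat 1) \<mu> \<nu> = (if \<mu> = \<nu> then 1 else 0)"
  by (induction \<mu> \<nu> rule: list_induct2) (simp_all add: mat_def)

lemma index_prod_transpose: "index_prod (transpose M) \<mu> \<nu> = index_prod M \<nu> \<mu>"
  by (induction M \<mu> \<nu> rule: index_prod.induct) (simp_all add: transpose_def)

lemma contract_all_eq:
  "contract_all M r T \<mu> = (if length \<mu> = r then \<Sum>\<nu> | length \<nu> = r. index_prod M \<mu> \<nu> * T \<nu> else 0)"
  unfolding contract_all_def by (auto intro!: sum.cong simp: index_prod_eq_prod)

lemma tensor_of_rank_contract_all [simp]: "tensor_of_rank r (contract_all M r T)"
  by (simp add: tensor_of_rank_def contract_all_def)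

lemma contract_all_cong:
  "(\<And>\<mu>. length \<mu> = r \<Longrightarrow> S \<mu> = T \<mu>) \<Longrightarrow> contract_all M r S = contract_all M r T"
  unfolding contract_all_def by (auto intro!: sum.cong ext)

lemma contract_all_contract_all:
  "contract_all M r (contract_all N r T) = contract_all (M ** N) r T"
proof
  fix \<mu> :: "'a list"
  show "contract_all M r (contract_all N r T) \<mu> = contract_all (M ** N) r T \<mu>"
  proof (cases "length \<mu> = r")
    case True
    have "contract_all M r (contract_all N r T) \<mu>
        = (\<Sum>\<nu> | length \<nu> = r. \<Sum>\<rho> | length \<rho> = r. index_prod M \<mu> \<nu> * index_prod N \<nu> \<rho> * T \<rho>)"
      using True by (simp add: contract_all_eq sum_distrib_left mult.assoc)
    also have "\<dots> = (\<Sum>\<rho> | length \<rho> = r. (\<Sum>\<nu> | length \<nu> = r. index_prod M \<mu> \<nu> * index_prod N \<nu> \<rho>) * T \<rho>)"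
      by (subst sum.swap) (simp add: sum_distrib_right)
    also have "\<dots> = contract_all (M ** N) r T \<mu>"
      using True by (simp add: contract_all_eq index_prod_mult)
    finally show ?thesis .
  qed (simp add: contract_all_eq)
qed

lemma contract_all_mat_1: "tensor_of_rank r T \<Longrightarrow> contract_all (mat 1) r T = T"
proof
  fix \<mu> :: "'a list" assume T: "tensor_of_rank r T"
  have "(\<Sum>\<nu> | length \<nu> = r. index_prod (mat 1) \<mu> \<nu> * T \<nu>)
      = (\<Sum>\<nu> | length \<nu> = r. if \<mu> = \<nu> then T \<nu> else 0)" if "length \<mu> = r"
    using that by (intro sum.cong) (auto simp: index_prod_mat_1)
  thus "contract_all (mat 1) r T \<mu> = T \<mu>"
    using T by (simp add: contract_all_eq tensor_of_rank_def)
qed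

lemma sum_contract_all_transpose:
  "(\<Sum>\<mu> | length \<mu> = r. S \<mu> * contract_all M r T \<mu>)
    = (\<Sum>\<mu> | length \<mu> = r. contract_all (transpose M) r S \<mu> * T \<mu>)"
proof -
  have "(\<Sum>\<mu> | length \<mu> = r. S \<mu> * contract_all M r T \<mu>)
      = (\<Sum>\<mu> | length \<mu> = r. \<Sum>\<nu> | length \<nu> = r. S \<mu> * index_prod M \<mu> \<nu> * T \<nu>)"
    by (simp add: contract_all_eq sum_distrib_left mult.assoc)
  also have "\<dots> = (\<Sum>\<nu> | length \<nu> = r. \<Sum>\<mu> | length \<mu> = r. S \<mu> * index_prod M \<mu> \<nu> * T \<nu>)"
    by (rule sum.swap)
  finally show ?thesis
    by (simp add: contract_all_eq sum_distrib_left sum_distrib_right index_prod_transpose mult_ac)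
qed

lemma contract_all_scale: "contract_all M r (\<lambda>\<mu>. c * T \<mu>) = (\<lambda>\<mu>. c * contract_all M r T \<mu>)"
  by (auto simp: contract_all_eq sum_distrib_left mult_ac)

lemma contract_all_add:
  "contract_all M r (\<lambda>\<mu>. S \<mu> + T \<mu>) = (\<lambda>\<mu>. contract_all M r S \<mu> + contract_all M r T \<mu>)"
  by (auto simp: contract_all_eq sum.distrib distrib_left)

text \<open>The matrix factor of the last index is split off and absorbed into the contracted
  vector. It serves both for lowering indices and for changes of basis.\<close>

lemma contract_last_contract_all:
  "contract_last k (contract_all M (Suc k) T) u = contract_all M k (contract_last k T (transpose M *v u))"
proof
  fix \<mu> :: "'a list"
  show "contract_last k (contract_all M (Suc k) T) u \<mu>
      = contract_all M k (contract_last k T (transpose M *v u)) \<mu>"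
  proof (cases "length \<mu> = k")
    case True
    have "contract_last k (contract_all M (Suc k) T) u \<mu>
      = (\<Sum>a\<in>UNIV. \<Sum>\<nu> | length \<nu> = k. \<Sum>b\<in>UNIV. index_prod M \<mu> \<nu> * M $ a $ b * T (\<nu> @ [b]) * u $ a)"
      using True by (simp add: contract_last_def contract_all_eq sum_lists_snoc index_prod_append
          sum_distrib_right)
    also have "\<dots> = (\<Sum>\<nu> | length \<nu> = k. \<Sum>a\<in>UNIV. \<Sum>b\<in>UNIV. index_prod M \<mu> \<nu> * M $ a $ b * T (\<nu> @ [b]) * u $ a)"
      by (rule sum.swap)
    also have "\<dots> = (\<Sum>\<nu> | length \<nu> = k. \<Sum>b\<in>UNIV. \<Sum>a\<in>UNIV. index_prod M \<mu> \<nu> * M $ a $ b * T (\<nu> @ [b]) * u $ a)"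
      by (intro sum.cong refl sum.swap)
    also have "\<dots> = contract_all M k (contract_last k T (transpose M *v u)) \<mu>"
      using True by (simp add: contract_last_def contract_all_eq matrix_vector_mult_def transpose_def
          sum_distrib_left sum_distrib_right mult_ac)
    finally show ?thesis .
  qed (simp add: contract_last_def contract_all_eq)
qed


section \<open>Antisymmetric tensors\<close>

lemma permutes_transpose: "a \<in> S \<Longrightarrow> b \<in> S \<Longrightarrow> Transposition.transpose a b permutes S"
  by (rule permutes_swap_id)

lemma antisymmetricD:
  "antisymmetric r T \<Longrightarrow> length \<mu> = r \<Longrightarrow> \<pi> permutes {..<r} \<Longrightarrow>
    T (permute_list \<pi> \<mu>) = of_int (sign \<pi>) * T \<mu>"
  by (simp add: antisymmetric_def)

lemma antisymmetric_transposeD: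
  "antisymmetric r T \<Longrightarrow> length \<mu> = r \<Longrightarrow> i < r \<Longrightarrow> j < r \<Longrightarrow> i \<noteq> j \<Longrightarrow>
    T (permute_list (Transposition.transpose i j) \<mu>) = - T \<mu>"
  using antisymmetricD[of r T \<mu> "Transposition.transpose i j"]
  by (simp add: permutes_transpose sign_swap_id)

text \<open>Transpositions generate the permutations, and the sign is multiplicative.\<close>

lemma antisymmetricI:
  assumes "\<And>\<mu> i j. length \<mu> = r \<Longrightarrow> i < r \<Longrightarrow> j < r \<Longrightarrow> i \<noteq> j \<Longrightarrow>
    T (permute_list (Transposition.transpose i j) \<mu>) = - T \<mu>"
  shows "antisymmetric r T"
proof -
  have "\<forall>\<mu>. length \<mu> = r \<longrightarrow> T (permute_list \<pi> \<mu>) = of_int (sign \<pi>) * T \<mu>"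
    if "\<pi> permutes {..<r}" for \<pi>
    using that finite_lessThan
  proof (induction \<pi> rule: permutes_induct)
    case (swap a b p)
    show ?case
    proof (intro allI impI)
      fix \<mu> :: "'a list" assume \<mu>: "length \<mu> = r"
      have "sign (Transposition.transpose a b \<circ> p) = - sign p"
        using sign_compose[of "Transposition.transpose a b" p] swap.hyps
          permutes_imp_permutation[of "{..<r}" p] by (simp add: sign_swap_id permutation_swap_id)
      thus "T (permute_list (Transposition.transpose a b \<circ> p) \<mu>)
          = of_int (sign (Transposition.transpose a b \<circ> p)) * T \<mu>"
        using swap \<mu> assms[OF \<mu>, of a b] by (simp add: permute_list_compose)
    qed
  qed simp
  thus ?thesis by (simp add: antisymmetric_def)
qed

text \<open>A transposition inside the block is a transposition of the whole list at shifted
  positions. With the remaining indices frozen, the Levi-Civita symbol is thereby antisymmetric in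
  any group of adjacent indices.\<close>

lemma antisymmetric_block:
  assumes "antisymmetric r T" "length xs + k + length zs = r"
  shows "antisymmetric k (\<lambda>\<mu>. T (xs @ \<mu> @ zs))"
proof (rule antisymmetricI)
  fix \<mu> :: "'a list" and i j assume *: "length \<mu> = k" "i < k" "j < k" "i \<noteq> j"
  let ?n = "length xs"
  have perm: "Transposition.transpose (?n + i) (?n + j) permutes {..<length (xs @ \<mu> @ zs)}"
    by (rule permutes_transpose) (use * in auto)
  have perm': "Transposition.transpose i j permutes {..<length \<mu>}"
    by (rule permutes_transpose) (use * in auto)
  have "xs @ permute_list (Transposition.transpose i j) \<mu> @ zs
      = permute_list (Transposition.transpose (?n + i) (?n + j)) (xs @ \<mu> @ zs)"
  proof (rule nth_equalityI, goal_cases)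
    case (2 m)
    hence m: "m < length (xs @ \<mu> @ zs)" by simp
    show ?case
    proof (cases "?n \<le> m \<and> m < ?n + k")
      case True
      then obtain l where l: "m = ?n + l" "l < k" by (metis add_less_cancel_left le_Suc_ex)
      show ?thesis using l * unfolding permute_list_nth[OF perm m]
        by (simp add: nth_append permute_list_nth[OF perm'] Transposition.transpose_def)
    next
      case False
      hence "Transposition.transpose (?n + i) (?n + j) m = m"
        using * by (auto simp: Transposition.transpose_def)
      thus ?thesis unfolding permute_list_nth[OF perm m] using False * by (auto simp: nth_append)
    qed
  qed simp
  thus "T (xs @ permute_list (Transposition.transpose i j) \<mu> @ zs) = - T (xs @ \<mu> @ zs)"
    using antisymmetric_transposeD[OF assms(1), of "xs @ \<mu> @ zs" "?n + i" "?n + j"] * assms(2) by simp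
qed

lemma antisymmetric_swap:
  assumes "antisymmetric r T" "length (xs @ a # b # ys) = r"
  shows "T (xs @ a # b # ys) = - T (xs @ b # a # ys)"
proof -
  have "permute_list (Transposition.transpose 0 1) [b, a] = [a, b]"
    by (simp add: permute_list_def)
  thus ?thesis
    using antisymmetric_transposeD[OF antisymmetric_block[OF assms(1), of xs 2 ys], of "[b, a]" 0 1] assms(2)
    by simp
qed

lemma antisymmetric_move:
  assumes "antisymmetric r T" "length (xs @ a # ys @ zs) = r"
  shows "T (xs @ a # ys @ zs) = (-1) ^ length ys * T (xs @ ys @ a # zs)"
  using assms(2)
proof (induction ys arbitrary: xs)
  case (Cons b ys)
  have "T (xs @ a # b # ys @ zs) = - T ((xs @ [b]) @ a # ys @ zs)"
    using antisymmetric_swap[OF assms(1), of xs a b "ys @ zs"] Cons.prems by simp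
  also have "\<dots> = - ((-1) ^ length ys * T ((xs @ [b]) @ ys @ a # zs))"
    by (subst Cons.IH) (use Cons.prems in auto)
  finally show ?case by simp
qed simp

text \<open>Each entry of \<open>as\<close> passes each entry of \<open>bs\<close>. All later sign
  rules come from here: a block of even length moves freely, two blocks of odd length
  anticommute.\<close>

lemma antisymmetric_move_block:
  assumes "antisymmetric r T" "length (xs @ as @ bs @ zs) = r"
  shows "T (xs @ as @ bs @ zs) = (-1) ^ (length as * length bs) * T (xs @ bs @ as @ zs)"
  using assms(2)
proof (induction as arbitrary: xs)
  case (Cons a as)
  have "T (xs @ (a # as) @ bs @ zs) = T ((xs @ [a]) @ as @ bs @ zs)" by simp
  also have "\<dots> = (-1) ^ (length as * length bs) * T ((xs @ [a]) @ bs @ as @ zs)"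
    by (rule Cons.IH) (use Cons.prems in simp)
  also have "T ((xs @ [a]) @ bs @ as @ zs) = (-1) ^ length bs * T (xs @ bs @ a # as @ zs)"
    using antisymmetric_move[OF assms(1), of xs a bs "as @ zs"] Cons.prems by simp
  finally show ?case by (simp add: power_add)
qed simp

lemma antisymmetric_not_distinct:
  assumes "antisymmetric r T" "length \<mu> = r" "\<not> distinct \<mu>"
  shows "T \<mu> = 0"
proof -
  obtain i j where ij: "i < r" "j < r" "i \<noteq> j" "\<mu> ! i = \<mu> ! j"
    using assms(2,3) by (auto simp: distinct_conv_nth)
  have perm: "Transposition.transpose i j permutes {..<length \<mu>}"
    by (rule permutes_transpose) (use ij assms(2) in auto)
  have "permute_list (Transposition.transpose i j) \<mu> = \<mu>"
    by (rule nth_equalityI) (use ij in \<open>auto simp: permute_list_nth[OF perm] Transposition.transpose_def\<close>)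
  thus ?thesis using antisymmetric_transposeD[OF assms(1,2) ij(1-3)] by simp
qed

text \<open>Permuting the summation list along with the free indices leaves the product of matrix
  entries unchanged, so the sign comes from T alone.\<close>

lemma antisymmetric_contract_all:
  assumes "antisymmetric r T"
  shows "antisymmetric r (contract_all M r T)"
  unfolding antisymmetric_def
proof (intro allI impI, elim conjE)
  fix \<mu> :: "'a list" and \<pi> assume *: "length \<mu> = r" "\<pi> permutes {..<r}"
  have "contract_all M r T (permute_list \<pi> \<mu>)
      = (\<Sum>\<nu> | length \<nu> = r. index_prod M (permute_list \<pi> \<mu>) (permute_list \<pi> \<nu>) * T (permute_list \<pi> \<nu>))"
    using * sum_lists_permute[OF *(2), of "\<lambda>\<nu>. index_prod M (permute_list \<pi> \<mu>) \<nu> * T \<nu>"]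
    by (simp add: contract_all_eq)
  also have "\<dots> = (\<Sum>\<nu> | length \<nu> = r. of_int (sign \<pi>) * (index_prod M \<mu> \<nu> * T \<nu>))"
    using * assms by (intro sum.cong) (auto simp: index_prod_permute antisymmetricD)
  finally show "contract_all M r T (permute_list \<pi> \<mu>) = of_int (sign \<pi>) * contract_all M r T \<mu>"
    using * by (simp add: contract_all_eq sum_distrib_left)
qed

lemma antisymmetrize_contract_all:
  "antisymmetrize r (contract_all M r T) = contract_all M r (antisymmetrize r T)"
proof
  fix \<mu> :: "'a list"
  show "antisymmetrize r (contract_all M r T) \<mu> = contract_all M r (antisymmetrize r T) \<mu>"
  proof (cases "length \<mu> = r")
    case True
    have "contract_all M r T (permute_list \<pi> \<mu>) = (\<Sum>\<nu> | length \<nu> = r. index_prod M \<mu> \<nu> * T (permute_list \<pi> \<nu>))"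
      if \<pi>: "\<pi> permutes {..<r}" for \<pi>
    proof -
      have "contract_all M r T (permute_list \<pi> \<mu>)
          = (\<Sum>\<nu> | length \<nu> = r. index_prod M (permute_list \<pi> \<mu>) (permute_list \<pi> \<nu>) * T (permute_list \<pi> \<nu>))"
        using True sum_lists_permute[OF \<pi>, of "\<lambda>\<nu>. index_prod M (permute_list \<pi> \<mu>) \<nu> * T \<nu>"]
        by (simp add: contract_all_eq)
      also have "\<dots> = (\<Sum>\<nu> | length \<nu> = r. index_prod M \<mu> \<nu> * T (permute_list \<pi> \<nu>))"
        using True \<pi> by (intro sum.cong) (auto simp: index_prod_permute)
      finally show ?thesis .
    qed
    hence "antisymmetrize r (contract_all M r T) \<mu> = (\<Sum>\<pi> | \<pi> permutes {..<r}. \<Sum>\<nu> | length \<nu> = r.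
        of_int (sign \<pi>) * (index_prod M \<mu> \<nu> * T (permute_list \<pi> \<nu>))) / fact r"
      using True by (simp add: antisymmetrize_def sum_distrib_left)
    also have "\<dots> = (\<Sum>\<nu> | length \<nu> = r. \<Sum>\<pi> | \<pi> permutes {..<r}.
        of_int (sign \<pi>) * (index_prod M \<mu> \<nu> * T (permute_list \<pi> \<nu>))) / fact r"
      by (subst sum.swap) simp
    also have "\<dots> = contract_all M r (antisymmetrize r T) \<mu>"
      using True by (simp add: contract_all_eq antisymmetrize_def sum_distrib_left sum_divide_distrib mult_ac)
    finally show ?thesis .
  qed (simp add: antisymmetrize_def contract_all_eq)
qed

text \<open>Both parts reindex the sum over permutations by composition with \<rho>, on the left
  when the index list is permuted and on the right when the slots of T are.\<close>

lemma antisymmetrize_permute: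
  assumes "length \<mu> = r" "\<rho> permutes {..<r}"
  shows "antisymmetrize r T (permute_list \<rho> \<mu>) = of_int (sign \<rho>) * antisymmetrize r T \<mu>"
    and "antisymmetrize r (\<lambda>\<nu>. T (permute_list \<rho> \<nu>)) \<mu> = of_int (sign \<rho>) * antisymmetrize r T \<mu>"
proof -
  have perm\<rho>: "permutation \<rho>" using assms(2) permutes_imp_permutation finite_lessThan by blast
  have pinv: "inv \<rho> permutes {..<r}" using assms(2) by (rule permutes_inv)
  have s: "sign \<rho> * sign \<rho> = 1" by simp
  have "(\<Sum>\<pi> | \<pi> permutes {..<r}. of_int (sign \<pi>) * T (permute_list \<pi> (permute_list \<rho> \<mu>)))
     = (\<Sum>\<pi> | \<pi> permutes {..<r}. of_int (sign \<rho>) * (of_int (sign (\<rho> \<circ> \<pi>)) * T (permute_list (\<rho> \<circ> \<pi>) \<mu>)))"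
  proof (intro sum.cong refl)
    fix \<pi> assume "\<pi> \<in> {\<pi>. \<pi> permutes {..<r}}"
    hence \<pi>: "\<pi> permutes {..<r}" by simp
    hence "sign (\<rho> \<circ> \<pi>) = sign \<rho> * sign \<pi>"
      using sign_compose[OF perm\<rho>, of \<pi>] permutes_imp_permutation[OF finite_lessThan \<pi>] by simp
    thus "of_int (sign \<pi>) * T (permute_list \<pi> (permute_list \<rho> \<mu>))
        = of_int (sign \<rho>) * (of_int (sign (\<rho> \<circ> \<pi>)) * T (permute_list (\<rho> \<circ> \<pi>) \<mu>))"
      using assms \<pi> by (simp add: permute_list_compose flip: of_int_mult mult.assoc)
  qed
  also have "\<dots> = of_int (sign \<rho>) * (\<Sum>\<pi> | \<pi> permutes {..<r}. of_int (sign \<pi>) * T (permute_list \<pi> \<mu>))"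
    unfolding sum_distrib_left[symmetric]
    using sum.reindex_bij_betw[OF bij_betw_byWitness[of "{\<pi>. \<pi> permutes {..<r}}" "\<lambda>\<pi>. inv \<rho> \<circ> \<pi>" "\<lambda>\<pi>. \<rho> \<circ> \<pi>"],
      of "{\<pi>. \<pi> permutes {..<r}}" "\<lambda>\<pi>. of_int (sign \<pi>) * T (permute_list \<pi> \<mu>)"]
      permutes_inv_o[OF assms(2)] assms(2) pinv
    by (auto simp: o_assoc intro: permutes_compose)
  finally show "antisymmetrize r T (permute_list \<rho> \<mu>) = of_int (sign \<rho>) * antisymmetrize r T \<mu>"
    using assms(1) by (simp add: antisymmetrize_def)
  have "(\<Sum>\<pi> | \<pi> permutes {..<r}. of_int (sign \<pi>) * T (permute_list \<rho> (permute_list \<pi> \<mu>)))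
     = (\<Sum>\<pi> | \<pi> permutes {..<r}. of_int (sign \<rho>) * (of_int (sign (\<pi> \<circ> \<rho>)) * T (permute_list (\<pi> \<circ> \<rho>) \<mu>)))"
  proof (intro sum.cong refl)
    fix \<pi> assume "\<pi> \<in> {\<pi>. \<pi> permutes {..<r}}"
    hence \<pi>: "\<pi> permutes {..<r}" by simp
    hence "sign (\<pi> \<circ> \<rho>) = sign \<rho> * sign \<pi>"
      using sign_compose[OF _ perm\<rho>, of \<pi>] permutes_imp_permutation[OF finite_lessThan \<pi>] by simp
    thus "of_int (sign \<pi>) * T (permute_list \<rho> (permute_list \<pi> \<mu>))
        = of_int (sign \<rho>) * (of_int (sign (\<pi> \<circ> \<rho>)) * T (permute_list (\<pi> \<circ> \<rho>) \<mu>))"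
      using assms \<pi> by (simp add: permute_list_compose flip: of_int_mult mult.assoc)
  qed
  also have "\<dots> = of_int (sign \<rho>) * (\<Sum>\<pi> | \<pi> permutes {..<r}. of_int (sign \<pi>) * T (permute_list \<pi> \<mu>))"
    unfolding sum_distrib_left[symmetric]
    using sum.reindex_bij_betw[OF bij_betw_byWitness[of "{\<pi>. \<pi> permutes {..<r}}" "\<lambda>\<pi>. \<pi> \<circ> inv \<rho>" "\<lambda>\<pi>. \<pi> \<circ> \<rho>"],
      of "{\<pi>. \<pi> permutes {..<r}}" "\<lambda>\<pi>. of_int (sign \<pi>) * T (permute_list \<pi> \<mu>)"]
      permutes_inv_o[OF assms(2)] assms(2) pinv
    by (auto simp: o_assoc[symmetric] intro: permutes_compose)
  finally show "antisymmetrize r (\<lambda>\<nu>. T (permute_list \<rho> \<nu>)) \<mu> = of_int (sign \<rho>) * antisymmetrize r T \<mu>"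
    using assms(1) by (simp add: antisymmetrize_def)
qed

lemma antisymmetric_antisymmetrize: "antisymmetric r (antisymmetrize r T)"
  by (simp add: antisymmetric_def antisymmetrize_permute)

text \<open>The transposition leaves T fixed but reverses the sign of its antisymmetrization. This
  is what later removes second derivatives of transition maps.\<close>

lemma antisymmetrize_symmetric_eq_0:
  assumes "i < r" "j < r" "i \<noteq> j"
    and "\<And>\<nu>. length \<nu> = r \<Longrightarrow> T (permute_list (Transposition.transpose i j) \<nu>) = T \<nu>"
  shows "antisymmetrize r T \<mu> = 0"
proof (cases "length \<mu> = r")
  case True
  have perm: "Transposition.transpose i j permutes {..<r}"
    by (rule permutes_transpose) (use assms in auto)
  have "antisymmetrize r (\<lambda>\<nu>. T (permute_list (Transposition.transpose i j) \<nu>)) \<mu> = antisymmetrize r T \<mu>"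
    using True by (auto simp: antisymmetrize_def assms(4) intro!: sum.cong)
  thus ?thesis using antisymmetrize_permute(2)[OF True perm, of T] assms(3) by (simp add: sign_swap_id)
qed (simp add: antisymmetrize_def)

text \<open>Against an antisymmetric S every signed permuted copy of T gives the same sum, and the
  r! copies cancel the normalization.\<close>

lemma sum_antisymmetric_antisymmetrize:
  fixes S T :: "'d::finite tensor"
  assumes "antisymmetric r S"
  shows "(\<Sum>\<mu> | length \<mu> = r. S \<mu> * antisymmetrize r T \<mu>) = (\<Sum>\<mu> | length \<mu> = r. S \<mu> * T \<mu>)"
proof -
  have perm: "(\<Sum>\<mu> | length \<mu> = r. S \<mu> * (of_int (sign \<pi>) * T (permute_list \<pi> \<mu>))) = (\<Sum>\<mu> | length \<mu> = r. S \<mu> * T \<mu>)"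
    if \<pi>: "\<pi> permutes {..<r}" for \<pi>
  proof -
    have "S \<mu> * (of_int (sign \<pi>) * T (permute_list \<pi> \<mu>)) = S (permute_list \<pi> \<mu>) * T (permute_list \<pi> \<mu>)"
      if "length \<mu> = r" for \<mu>
      using antisymmetricD[OF assms that \<pi>] by simp
    hence "(\<Sum>\<mu> | length \<mu> = r. S \<mu> * (of_int (sign \<pi>) * T (permute_list \<pi> \<mu>)))
        = (\<Sum>\<mu> | length \<mu> = r. S (permute_list \<pi> \<mu>) * T (permute_list \<pi> \<mu>))"
      by (intro sum.cong) auto
    thus ?thesis using sum_lists_permute[OF \<pi>, of "\<lambda>\<mu>. S \<mu> * T \<mu>"] by simp
  qed
  have "(\<Sum>\<mu> | length \<mu> = r. S \<mu> * antisymmetrize r T \<mu>)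
      = (\<Sum>\<mu> | length \<mu> = r. \<Sum>\<pi> | \<pi> permutes {..<r}. S \<mu> * (of_int (sign \<pi>) * T (permute_list \<pi> \<mu>))) / fact r"
    by (simp add: antisymmetrize_def sum_distrib_left sum_divide_distrib)
  also have "\<dots> = (\<Sum>\<pi> | \<pi> permutes {..<r}. \<Sum>\<mu> | length \<mu> = r. S \<mu> * (of_int (sign \<pi>) * T (permute_list \<pi> \<mu>))) / fact r"
    by (subst sum.swap) simp
  also have "\<dots> = (\<Sum>\<pi> | \<pi> permutes {..<r}. \<Sum>\<mu> | length \<mu> = r. S \<mu> * T \<mu>) / fact r"
    by (simp add: perm)
  finally show ?thesis by (simp add: card_permutations)
qed


section \<open>The Levi-Civita symbol\<close>

text \<open>The coordinate numbering hidden in \<open>levi_civita\<close>, isolated so that it can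
  be shown to be a bijection onto the numbers below d.\<close>

definition index_position :: "'d::{finite,linorder} \<Rightarrow> nat" where
  "index_position i = card {..<i}"

lemma bij_index_position: "bij_betw index_position (UNIV :: 'd::{finite,linorder} set) {..<CARD('d)}"
proof -
  have mono: "index_position i < index_position j" if "i < j" for i j :: 'd
    unfolding index_position_def using that by (intro psubset_card_mono) auto
  have inj: "inj (index_position :: 'd \<Rightarrow> nat)"
    by (rule injI) (metis mono less_irrefl linorder_neq_iff)
  have "index_position i < CARD('d)" for i :: 'd
    unfolding index_position_def by (intro psubset_card_mono) auto
  hence "range (index_position :: 'd \<Rightarrow> nat) \<subseteq> {..<CARD('d)}" by auto
  hence "range (index_position :: 'd \<Rightarrow> nat) = {..<CARD('d)}"
    using inj by (intro card_subset_eq) (auto simp: card_image)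
  thus ?thesis using inj by (simp add: bij_betw_def)
qed

lemma index_position_less: "index_position (i :: 'd::{finite,linorder}) < CARD('d)"
  using bij_index_position by (auto simp: bij_betw_def)

lemma inj_index_position: "inj (index_position :: 'd::{finite,linorder} \<Rightarrow> nat)"
  using bij_index_position by (auto simp: bij_betw_def)

definition index_at :: "nat \<Rightarrow> 'd::{finite,linorder}" where
  "index_at = the_inv_into UNIV index_position"

lemma index_at_position [simp]: "index_at (index_position i) = i"
  unfolding index_at_def by (rule the_inv_into_f_f[OF inj_index_position]) simp

lemma index_position_at:
  "n < CARD('d) \<Longrightarrow> index_position (index_at n :: 'd::{finite,linorder}) = n"
  unfolding index_at_def using bij_index_position[where 'd = 'd]
  by (intro f_the_inv_into_f) (auto simp: bij_betw_def)

lemma prod_index_position: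
  "(\<Prod>i\<in>UNIV. f (index_position (i :: 'd::{finite,linorder}))) = (\<Prod>k<CARD('d). f k)"
  using prod.reindex_bij_betw[OF bij_index_position[where 'd = 'd], of f] by simp

lemma det_axis:
  fixes p :: "'d::finite \<Rightarrow> 'd"
  shows "det ((\<chi> i. axis (p i) 1) :: 'd matrix) = (if p permutes UNIV then of_int (sign p) else 0)"
proof -
  have "(\<Prod>i\<in>UNIV. (axis (p i) 1 :: real^'d) $ q i) = (if q = p then 1 else 0)" for q
    by (auto simp: axis_def fun_eq_iff intro!: prod.neutral)
  hence "det ((\<chi> i. axis (p i) 1) :: 'd matrix)
      = (\<Sum>q | q permutes UNIV. of_int (sign q) * (if q = p then 1 else 0))"
    by (simp add: det_def)
  also have "\<dots> = (\<Sum>q | q permutes UNIV. if q = p then of_int (sign q) else 0)"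
    by (intro sum.cong) auto
  finally show ?thesis by simp
qed

lemma permutes_UNIV_iff_distinct:
  fixes \<mu> :: "'d::{finite,linorder} list"
  assumes "length \<mu> = CARD('d)"
  shows "(\<lambda>i. \<mu> ! index_position i) permutes UNIV \<longleftrightarrow> distinct \<mu>"
proof -
  have "distinct \<mu> \<longleftrightarrow> inj_on ((!) \<mu>) (index_position ` (UNIV :: 'd set))"
    using assms bij_index_position[where 'd = 'd]
    by (auto simp: bij_betw_def distinct_conv_nth inj_on_def)
  also have "\<dots> \<longleftrightarrow> inj ((!) \<mu> \<circ> (index_position :: 'd \<Rightarrow> nat))"
    using comp_inj_on_iff[OF inj_index_position[where 'd = 'd], of "(!) \<mu>"] by simp
  also have "\<dots> \<longleftrightarrow> bij ((!) \<mu> \<circ> (index_position :: 'd \<Rightarrow> nat))"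
    by (meson bij_def finite_UNIV_inj_surj finite)
  finally show ?thesis
    using bij_imp_permutes[of _ UNIV] permutes_bij by (auto simp: o_def)
qed

text \<open>As the determinant of a matrix whose rows are basis vectors, the symbol inherits
  alternation and multiplicativity from \<open>det\<close>.\<close>

lemma levi_civita_eq_det:
  fixes \<mu> :: "'d::{finite,linorder} list"
  assumes "length \<mu> = CARD('d)"
  shows "levi_civita \<mu> = det ((\<chi> i. axis (\<mu> ! index_position i) 1) :: 'd matrix)"
  using permutes_UNIV_iff_distinct[OF assms] assms
  unfolding levi_civita_def det_axis by (simp add: index_position_def)

lemma antisymmetric_levi_civita: "antisymmetric CARD('d) (levi_civita :: 'd::{finite,linorder} tensor)"
proof (rule antisymmetricI)
  fix \<mu> :: "'d list" and k l
  assume *: "length \<mu> = CARD('d)" "k < CARD('d)" "l < CARD('d)" "k \<noteq> l"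
  define \<tau> where "\<tau> = Transposition.transpose (index_at k :: 'd) (index_at l)"
  have ne: "index_at k \<noteq> (index_at l :: 'd)" using * index_position_at by metis
  have perm: "Transposition.transpose k l permutes {..<length \<mu>}"
    by (rule permutes_transpose) (use * in auto)
  have pos: "index_position (\<tau> i) = Transposition.transpose k l (index_position i)" for i :: 'd
    using *(2,3) by (auto simp: \<tau>_def Transposition.transpose_def index_position_at)
  define E :: "'d matrix" where "E = (\<chi> i. axis (\<mu> ! index_position i) 1)"
  have "((\<chi> i. axis (permute_list (Transposition.transpose k l) \<mu> ! index_position i) 1) :: 'd matrix)
      = (\<chi> i. E $ \<tau> i)"
    by (simp add: E_def permute_list_nth[OF perm] * index_position_less pos)
  moreover have "\<tau> permutes UNIV" "sign \<tau> = -1"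
    using ne by (auto simp: \<tau>_def permutes_transpose sign_swap_id)
  ultimately show "levi_civita (permute_list (Transposition.transpose k l) \<mu>) = - levi_civita \<mu>"
    using * det_permute_rows[of \<tau> E] by (simp add: levi_civita_eq_det E_def[symmetric])
qed

lemma levi_civita_eq_0:
  fixes \<mu> :: "'d::{finite,linorder} list"
  assumes "length \<mu> = CARD('d)" "i < CARD('d)" "j < CARD('d)" "i \<noteq> j" "\<mu> ! i = \<mu> ! j"
  shows "levi_civita \<mu> = 0"
  using assms nth_eq_iff_index_eq[of \<mu> i j] unfolding levi_civita_def by auto

text \<open>Lists without repetition correspond to permutations of the index type, so the sum is the
  Leibniz expansion of det (E M), where the rows of E are the basis vectors named by \<mu>.\<close>

lemma sum_index_prod_levi_civita:
  fixes \<mu> :: "'d::{finite,linorder} list"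
  assumes "length \<mu> = CARD('d)"
  shows "(\<Sum>\<nu> | length \<nu> = CARD('d). index_prod M \<mu> \<nu> * levi_civita \<nu>) = det M * levi_civita \<mu>"
proof -
  let ?E = "(\<chi> i. axis (\<mu> ! index_position i) 1) :: 'd matrix"
  let ?ofp = "\<lambda>q :: 'd \<Rightarrow> 'd. map (\<lambda>n. q (index_at n)) [0..<CARD('d)]"
  have "(\<Sum>\<nu> | length \<nu> = CARD('d). index_prod M \<mu> \<nu> * levi_civita \<nu>)
      = (\<Sum>\<nu> | length \<nu> = CARD('d) \<and> distinct \<nu>. index_prod M \<mu> \<nu> * levi_civita \<nu>)"
    by (rule sum.mono_neutral_right) (auto simp: levi_civita_def)
  also have "\<dots> = (\<Sum>q | q permutes (UNIV :: 'd set). of_int (sign q) * (\<Prod>i\<in>UNIV. (?E ** M) $ i $ q i))"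
  proof (rule sum.reindex_bij_witness[of _ ?ofp "\<lambda>\<nu> i. \<nu> ! index_position i"])
    fix \<nu> :: "'d list" assume "\<nu> \<in> {\<nu>. length \<nu> = CARD('d) \<and> distinct \<nu>}"
    hence \<nu>: "length \<nu> = CARD('d)" "distinct \<nu>" by auto
    show "?ofp (\<lambda>i. \<nu> ! index_position i) = \<nu>"
      by (rule nth_equalityI) (auto simp: \<nu> index_position_at)
    show "(\<lambda>i. \<nu> ! index_position i) \<in> {q. q permutes UNIV}"
      using permutes_UNIV_iff_distinct[OF \<nu>(1)] \<nu>(2) by simp
    have row: "(?E ** M) $ i $ j = M $ (\<mu> ! index_position i) $ j" for i j
      by (simp add: matrix_matrix_mult_def axis_def if_distrib[of "\<lambda>t. t * _"] cong: if_cong)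
    have "index_prod M \<mu> \<nu> = (\<Prod>i\<in>UNIV. M $ (\<mu> ! index_position i) $ (\<nu> ! index_position (i :: 'd)))"
      using prod_index_position[of "\<lambda>k. M $ (\<mu> ! k) $ (\<nu> ! k)", where 'd = 'd] \<nu>(1) assms
      by (simp add: index_prod_eq_prod)
    thus "of_int (sign (\<lambda>i. \<nu> ! index_position i)) * (\<Prod>i\<in>UNIV. (?E ** M) $ i $ (\<nu> ! index_position i))
        = index_prod M \<mu> \<nu> * levi_civita \<nu>"
      using \<nu> unfolding row by (simp add: levi_civita_def index_position_def)
  next
    fix q :: "'d \<Rightarrow> 'd" assume "q \<in> {q. q permutes UNIV}"
    hence q: "q permutes UNIV" by simp
    show eq: "(\<lambda>i. ?ofp q ! index_position i) = q"
      by (auto simp: index_position_less)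
    show "?ofp q \<in> {\<nu>. length \<nu> = CARD('d) \<and> distinct \<nu>}"
      using permutes_UNIV_iff_distinct[of "?ofp q"] q unfolding eq by simp
  qed
  also have "\<dots> = det (?E ** M)" by (simp add: det_def)
  finally show ?thesis using assms by (simp add: det_mul levi_civita_eq_det)
qed

lemma antisymmetric_levi_civita_block:
  "length xs + k + length zs = CARD('d) \<Longrightarrow>
    antisymmetric k (\<lambda>\<mu>. levi_civita (xs @ \<mu> @ zs :: 'd::{finite,linorder} list))"
  by (rule antisymmetric_block[OF antisymmetric_levi_civita])

text \<open>Moving \<open>\<sigma>\<close> into all slots of \<open>\<epsilon>\<close> in turn is antisymmetrization over \<open>d + 1\<close> indices.\<close>

lemma levi_civita_schouten:
  fixes \<mu> :: "'d::{finite,linorder} list"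
  assumes \<mu>: "length \<mu> = CARD('d)"
  shows "levi_civita \<mu> * v $ \<sigma> = (\<Sum>i<CARD('d). v $ (\<mu> ! i) * levi_civita (\<mu>[i := \<sigma>]))"
proof (cases "distinct \<mu>")
  case True
  have "set \<mu> = UNIV" using True \<mu> by (simp add: card_subset_eq distinct_card)
  then obtain j where j: "j < CARD('d)" "\<mu> ! j = \<sigma>" by (metis UNIV_I in_set_conv_nth \<mu>)
  \<comment> \<open>A list of d distinct indices contains \<sigma> exactly once, so overwriting any
    other slot with \<sigma> creates a repetition.\<close>
  have "levi_civita (\<mu>[i := \<sigma>]) = 0" if "i < CARD('d)" "i \<noteq> j" for i
    using that j \<mu> by (intro levi_civita_eq_0[of _ i j]) auto
  hence "(\<Sum>i<CARD('d). v $ (\<mu> ! i) * levi_civita (\<mu>[i := \<sigma>])) = (\<Sum>i\<in>{j}. v $ (\<mu> ! i) * levi_civita (\<mu>[i := \<sigma>]))"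
    using j by (intro sum.mono_neutral_right) auto
  thus ?thesis using j by auto
next
  case False
  then obtain a b where ab: "a < CARD('d)" "b < CARD('d)" "a \<noteq> b" "\<mu> ! a = \<mu> ! b"
    using \<mu> by (auto simp: distinct_conv_nth)
  have "levi_civita (\<mu>[i := \<sigma>]) = 0" if "i < CARD('d)" "i \<noteq> a" "i \<noteq> b" for i
    using that ab \<mu> by (intro levi_civita_eq_0[of _ a b]) auto
  hence "(\<Sum>i<CARD('d). v $ (\<mu> ! i) * levi_civita (\<mu>[i := \<sigma>])) = (\<Sum>i\<in>{a, b}. v $ (\<mu> ! i) * levi_civita (\<mu>[i := \<sigma>]))"
    using ab by (intro sum.mono_neutral_right) auto
  \<comment> \<open>The surviving slots a and b hold the same index, and the two overwritten lists
    differ by exchanging these slots, so their contributions cancel.\<close>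
  moreover have "levi_civita (\<mu>[b := \<sigma>]) = - levi_civita (\<mu>[a := \<sigma>])"
  proof -
    have perm: "Transposition.transpose a b permutes {..<length (\<mu>[a := \<sigma>])}"
      by (rule permutes_transpose) (use ab \<mu> in auto)
    have "permute_list (Transposition.transpose a b) (\<mu>[a := \<sigma>]) = \<mu>[b := \<sigma>]"
      by (rule nth_equalityI)
         (use ab \<mu> in \<open>auto simp: permute_list_nth[OF perm] Transposition.transpose_def nth_list_update\<close>)
    thus ?thesis
      using antisymmetric_transposeD[OF antisymmetric_levi_civita, of "\<mu>[a := \<sigma>]" a b] ab \<mu> by simp
  qed
  moreover have "levi_civita \<mu> = 0"
    using False \<mu> by (intro antisymmetric_not_distinct[OF antisymmetric_levi_civita])
  ultimately show ?thesis using ab by simp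
qed

text \<open>The derivation of the tensor algebra that extends the rank-one map x \<mapsto> (x.v) u
  of covectors is applied to X, and the result is paired with S.\<close>

definition slot_sum :: "nat \<Rightarrow> 'd coords \<Rightarrow> 'd coords \<Rightarrow> 'd::finite tensor \<Rightarrow> 'd tensor \<Rightarrow> real" where
  "slot_sum k u v S X =
     (\<Sum>i<k. \<Sum>\<mu> | length \<mu> = k. S \<mu> * u $ (\<mu> ! i) * (\<Sum>\<rho>\<in>UNIV. v $ \<rho> * X (\<mu>[i := \<rho>])))"

lemma sum_lists_exchange_slot:
  fixes f :: "'d::finite list \<Rightarrow> 'd \<Rightarrow> real"
  assumes "i < k"
  shows "(\<Sum>\<mu> | length \<mu> = k. \<Sum>\<rho>\<in>UNIV. f \<mu> \<rho>)
    = (\<Sum>\<mu> | length \<mu> = k. \<Sum>\<rho>\<in>UNIV. f (\<mu>[i := \<rho>]) (\<mu> ! i))"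
  unfolding sum.cartesian_product
  by (rule sum.reindex_bij_witness[of _ "\<lambda>(\<mu>, \<rho>). (\<mu>[i := \<rho>], \<mu> ! i)" "\<lambda>(\<mu>, \<rho>). (\<mu>[i := \<rho>], \<mu> ! i)"])
     (use assms in auto)

text \<open>On top forms a derivation acts as multiplication by the trace of the underlying linear
  map, and the trace of the rank-one map is u.v. The proof inserts Schouten's identity for v and
  then exchanges, slot by slot, the extra summation index with the index in the slot.\<close>

lemma schouten_sum:
  fixes u v :: "'d::{finite,linorder} coords"
  shows "(u \<bullet> v) * (\<Sum>\<mu> | length \<mu> = CARD('d). levi_civita \<mu> * Z \<mu>)
    = slot_sum CARD('d) u v levi_civita Z"
proof -
  have "(u \<bullet> v) * (\<Sum>\<mu> | length \<mu> = CARD('d). levi_civita \<mu> * Z \<mu>)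
      = (\<Sum>\<mu> | length \<mu> = CARD('d). \<Sum>\<sigma>\<in>UNIV. u $ \<sigma> * Z \<mu> * (levi_civita \<mu> * v $ \<sigma>))"
    by (simp add: inner_vec_def sum_distrib_left sum_distrib_right mult_ac)
  also have "\<dots> = (\<Sum>\<mu> | length \<mu> = CARD('d). \<Sum>\<sigma>\<in>UNIV. \<Sum>i<CARD('d).
      u $ \<sigma> * Z \<mu> * (v $ (\<mu> ! i) * levi_civita (\<mu>[i := \<sigma>])))"
    by (intro sum.cong refl) (simp add: levi_civita_schouten sum_distrib_left)
  also have "\<dots> = (\<Sum>\<mu> | length \<mu> = CARD('d). \<Sum>i<CARD('d). \<Sum>\<sigma>\<in>UNIV.
      u $ \<sigma> * Z \<mu> * (v $ (\<mu> ! i) * levi_civita (\<mu>[i := \<sigma>])))"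
    by (intro sum.cong refl sum.swap)
  also have "\<dots> = (\<Sum>i<CARD('d). \<Sum>\<mu> | length \<mu> = CARD('d). \<Sum>\<sigma>\<in>UNIV.
      u $ \<sigma> * Z \<mu> * (v $ (\<mu> ! i) * levi_civita (\<mu>[i := \<sigma>])))"
    by (rule sum.swap)
  also have "\<dots> = slot_sum CARD('d) u v levi_civita Z"
    unfolding slot_sum_def
  proof (rule sum.cong[OF refl])
    fix i assume "i \<in> {..<CARD('d)}"
    hence i: "i < CARD('d)" by simp
    show "(\<Sum>\<mu> | length \<mu> = CARD('d). \<Sum>\<sigma>\<in>UNIV. u $ \<sigma> * Z \<mu> * (v $ (\<mu> ! i) * levi_civita (\<mu>[i := \<sigma>])))
      = (\<Sum>\<mu> | length \<mu> = CARD('d). levi_civita \<mu> * u $ (\<mu> ! i) * (\<Sum>\<rho>\<in>UNIV. v $ \<rho> * Z (\<mu>[i := \<rho>])))"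
      by (subst sum_lists_exchange_slot[OF i]) (use i in \<open>simp add: sum_distrib_left mult_ac\<close>)
  qed
  finally show ?thesis .
qed

text \<open>The Leibniz rule of the derivation on a tensor product.\<close>

lemma slot_sum_append:
  fixes X Y :: "'d::finite tensor"
  shows "slot_sum (k + l) u v S (\<lambda>\<mu>. X (take k \<mu>) * Y (drop k \<mu>))
    = (\<Sum>\<nu> | length \<nu> = l. Y \<nu> * slot_sum k u v (\<lambda>\<mu>. S (\<mu> @ \<nu>)) X)
    + (\<Sum>\<mu> | length \<mu> = k. X \<mu> * slot_sum l u v (\<lambda>\<nu>. S (\<mu> @ \<nu>)) Y)"
proof -
  let ?f = "\<lambda>i. \<Sum>\<mu> | length \<mu> = k. \<Sum>\<nu> | length \<nu> = l. S (\<mu> @ \<nu>) * u $ ((\<mu> @ \<nu>) ! i) *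
      (\<Sum>\<rho>\<in>UNIV. v $ \<rho> * (X (take k ((\<mu> @ \<nu>)[i := \<rho>])) * Y (drop k ((\<mu> @ \<nu>)[i := \<rho>]))))"
  have "slot_sum (k + l) u v S (\<lambda>\<mu>. X (take k \<mu>) * Y (drop k \<mu>)) = (\<Sum>i<k + l. ?f i)"
    unfolding slot_sum_def sum_lists_append ..
  also have "\<dots> = (\<Sum>i<k. ?f i) + (\<Sum>i<l. ?f (k + i))"
    using sum.atLeastLessThan_concat[of 0 k "k + l" ?f] sum.shift_bounds_nat_ivl[of ?f 0 k l]
    by (simp add: lessThan_atLeast0 add.commute)
  also have "(\<Sum>i<k. ?f i) = (\<Sum>i<k. \<Sum>\<nu> | length \<nu> = l. \<Sum>\<mu> | length \<mu> = k.
      Y \<nu> * (S (\<mu> @ \<nu>) * u $ (\<mu> ! i) * (\<Sum>\<rho>\<in>UNIV. v $ \<rho> * X (\<mu>[i := \<rho>]))))"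
    by (subst (2) sum.swap)
       (intro sum.cong refl, auto simp: nth_append list_update_append sum_distrib_left sum_distrib_right mult_ac)
  also have "\<dots> = (\<Sum>\<nu> | length \<nu> = l. Y \<nu> * slot_sum k u v (\<lambda>\<mu>. S (\<mu> @ \<nu>)) X)"
    by (subst sum.swap) (simp add: slot_sum_def sum_distrib_left)
  also have "(\<Sum>i<l. ?f (k + i)) = (\<Sum>i<l. \<Sum>\<mu> | length \<mu> = k. \<Sum>\<nu> | length \<nu> = l.
      X \<mu> * (S (\<mu> @ \<nu>) * u $ (\<nu> ! i) * (\<Sum>\<rho>\<in>UNIV. v $ \<rho> * Y (\<nu>[i := \<rho>]))))"
    by (intro sum.cong refl) (auto simp: nth_append list_update_append sum_distrib_left sum_distrib_right mult_ac)
  also have "\<dots> = (\<Sum>\<mu> | length \<mu> = k. X \<mu> * slot_sum l u v (\<lambda>\<nu>. S (\<mu> @ \<nu>)) Y)"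
    by (subst sum.swap) (simp add: slot_sum_def sum_distrib_left)
  finally show ?thesis .
qed

text \<open>Transposing a slot with the last one changes the sign of both S and X, so all k + 1
  slots contribute equally and the last one may stand for them.\<close>

lemma slot_sum_antisymmetric:
  fixes X S :: "'d::finite tensor"
  assumes "antisymmetric (Suc k) S" "antisymmetric (Suc k) X"
  shows "slot_sum (Suc k) u v S X
    = Suc k * (\<Sum>\<mu> | length \<mu> = k. \<Sum>\<sigma>\<in>UNIV. S (\<mu> @ [\<sigma>]) * u $ \<sigma> * contract_last k X v \<mu>)"
proof -
  define f where "f i \<mu> = S \<mu> * u $ (\<mu> ! i) * (\<Sum>\<rho>\<in>UNIV. v $ \<rho> * X (\<mu>[i := \<rho>]))" for i \<mu>
  have "(\<Sum>\<mu> | length \<mu> = Suc k. f i \<mu>) = (\<Sum>\<mu> | length \<mu> = Suc k. f k \<mu>)" if i: "i \<le> k" for i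
  proof (cases "i = k")
    case False
    let ?\<tau> = "Transposition.transpose i k"
    have perm: "?\<tau> permutes {..<Suc k}" by (rule permutes_transpose) (use i in auto)
    have "f i (permute_list ?\<tau> \<mu>) = f k \<mu>" if \<mu>: "length \<mu> = Suc k" for \<mu>
    proof -
      have perm': "?\<tau> permutes {..<length \<mu>}" using perm \<mu> by simp
      have perm'': "?\<tau> permutes {..<length (\<mu>[k := \<rho>])}" for \<rho> using perm \<mu> by simp
      have "(permute_list ?\<tau> \<mu>)[i := \<rho>] = permute_list ?\<tau> (\<mu>[k := \<rho>])" for \<rho>
        by (rule nth_equalityI)
           (use i \<mu> in \<open>auto simp: permute_list_nth[OF perm'] permute_list_nth[OF perm''] nth_list_update
              Transposition.transpose_def\<close>)
      moreover have "permute_list ?\<tau> \<mu> ! i = \<mu> ! k"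
        using i \<mu> by (simp add: permute_list_nth[OF perm'])
      ultimately show ?thesis
        using antisymmetric_transposeD[OF assms(1) \<mu>, of i k] False i \<mu>
          antisymmetric_transposeD[OF assms(2), of "\<mu>[k := _]" i k]
        by (simp add: f_def sum_negf)
    qed
    hence "(\<Sum>\<mu> | length \<mu> = Suc k. f k \<mu>) = (\<Sum>\<mu> | length \<mu> = Suc k. f i (permute_list ?\<tau> \<mu>))"
      by (intro sum.cong) auto
    thus ?thesis using sum_lists_permute[OF perm, of "f i"] by simp
  qed simp
  hence "slot_sum (Suc k) u v S X = (\<Sum>i<Suc k. \<Sum>\<mu> | length \<mu> = Suc k. f k \<mu>)"
    unfolding slot_sum_def f_def[symmetric] by (rule sum.cong[OF refl]) auto
  also have "(\<Sum>\<mu> | length \<mu> = Suc k. f k \<mu>)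
      = (\<Sum>\<mu> | length \<mu> = k. \<Sum>\<sigma>\<in>UNIV. S (\<mu> @ [\<sigma>]) * u $ \<sigma> * contract_last k X v \<mu>)"
    unfolding sum_lists_snoc f_def by (intro sum.cong refl) (auto simp: contract_last_def mult_ac)
  finally show ?thesis by simp
qed


section \<open>Lorentzian metrics\<close>

lemma matrix_inv_right_left:
  assumes "invertible (A :: real^'n^'n)"
  shows "A ** matrix_inv A = mat 1" "matrix_inv A ** A = mat 1"
  using someI_ex[of "\<lambda>A'. A ** A' = mat 1 \<and> A' ** A = mat 1"] assms
  unfolding matrix_inv_def invertible_def by auto

lemma matrix_inv_unique:
  fixes A B :: "real^'n^'n"
  assumes "A ** B = mat 1"
  shows "matrix_inv A = B"
proof -
  have "invertible A" using assms by (auto simp: invertible_right_inverse)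
  thus ?thesis
    by (metis assms matrix_inv_right_left(2) matrix_mul_assoc matrix_mul_lid matrix_mul_rid)
qed

lemma det_minkowski:
  fixes i0 :: "'d::finite"
  shows "det ((\<chi> i j. if i = j then (if i = i0 then -1 else 1) else 0) :: 'd matrix) = -1"
proof -
  have "det ((\<chi> i j. if i = j then (if i = i0 then -1 else 1) else 0) :: 'd matrix)
      = (\<Prod>i\<in>UNIV. if i = i0 then -1 else 1)"
    by (subst det_diagonal) auto
  thus ?thesis by (simp add: prod.delta)
qed

lemma lorentzian_det_neg: "lorentzian (g :: 'd::finite matrix) \<Longrightarrow> det g < 0"
proof -
  assume "lorentzian g"
  then obtain P :: "'d matrix" and i0 where P: "transpose P ** g ** P = (\<chi> i j. if i = j then (if i = i0 then -1 else 1) else 0)"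
    by (auto simp: lorentzian_def)
  have "det P * det g * det P = -1"
    using arg_cong[OF P, of det] by (simp add: det_mul det_minkowski)
  hence "(det P)\<^sup>2 * det g = -1" by (simp add: power2_eq_square mult_ac)
  thus "det g < 0" by (smt (verit) mult_nonneg_nonneg zero_le_power2)
qed

text \<open>The Minkowski matrix is symmetric, and symmetry is inherited through the congruence by
  which \<open>lorentzian\<close> is defined.\<close>

lemma lorentzian_symmetric: "lorentzian (g :: 'd::finite matrix) \<Longrightarrow> transpose g = g"
proof -
  assume "lorentzian g"
  then obtain P :: "'d matrix" and i0 where P: "invertible P"
    "transpose P ** g ** P = (\<chi> i j. if i = j then (if i = i0 then -1 else 1) else 0)"
    by (auto simp: lorentzian_def)
  note inv = matrix_inv_right_left[OF P(1)]
  let ?\<eta> = "(\<chi> i j. if i = j then (if i = i0 then -1 else 1) else 0) :: 'd matrix"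
  have inv': "transpose (matrix_inv P) ** transpose P = mat 1"
    using arg_cong[OF inv(1), of transpose] by (simp add: matrix_transpose_mul)
  have "g = (transpose (matrix_inv P) ** transpose P) ** g ** (P ** matrix_inv P)"
    by (simp add: inv inv')
  also have "\<dots> = transpose (matrix_inv P) ** (transpose P ** g ** P) ** matrix_inv P"
    by (simp add: matrix_mul_assoc)
  also have "\<dots> = transpose (matrix_inv P) ** ?\<eta> ** matrix_inv P"
    by (simp only: P)
  finally have g: "g = transpose (matrix_inv P) ** ?\<eta> ** matrix_inv P" .
  have "transpose ?\<eta> = ?\<eta>" by (simp add: transpose_def vec_eq_iff)
  thus ?thesis
    by (subst (1 2) g) (simp add: matrix_transpose_mul matrix_mul_assoc)
qed

lemma lorentzian_inverse:
  assumes "lorentzian (g :: 'd::finite matrix)"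
  shows "g ** matrix_inv g = mat 1" "matrix_inv g ** g = mat 1"
    and "transpose (matrix_inv g) = matrix_inv g"
proof -
  have inv: "invertible g" using lorentzian_det_neg[OF assms] by (simp add: invertible_det_nz)
  note i = matrix_inv_right_left[OF inv]
  show "g ** matrix_inv g = mat 1" "matrix_inv g ** g = mat 1" by (fact i)+
  have "g ** transpose (matrix_inv g) = mat 1"
    using arg_cong[OF i(2), of transpose] by (simp add: matrix_transpose_mul lorentzian_symmetric[OF assms])
  thus "transpose (matrix_inv g) = matrix_inv g" using matrix_inv_unique by metis
qed

lemma sqrt_minus_det_pos: "lorentzian g \<Longrightarrow> sqrt_minus_det g > 0"
  using lorentzian_det_neg by (simp add: sqrt_minus_det_def)

lemma sqrt_minus_det_square: "lorentzian g \<Longrightarrow> sqrt_minus_det g * sqrt_minus_det g = - det g"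
  using lorentzian_det_neg[of g] by (simp add: sqrt_minus_det_def)


section \<open>Contractions and the Hodge dual\<close>

lemma tensor_of_rank_contract_last [simp]: "tensor_of_rank k (contract_last k T v)"
  by (simp add: tensor_of_rank_def contract_last_def)

lemma full_contraction_add_left:
  "full_contraction g r (\<lambda>\<mu>. S \<mu> + T \<mu>) U = full_contraction g r S U + full_contraction g r T U"
  by (simp add: full_contraction_def sum.distrib distrib_right)

lemma full_contraction_add_right:
  "full_contraction g r U (\<lambda>\<mu>. S \<mu> + T \<mu>) = full_contraction g r U S + full_contraction g r U T"
  by (simp add: full_contraction_def contract_all_add sum.distrib distrib_left)

lemma full_contraction_commute:
  "lorentzian g \<Longrightarrow> full_contraction g r S T = full_contraction g r T S"
  unfolding full_contraction_def by (subst sum_contract_all_transpose) (simp add: lorentzian_inverse mult.commute)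

lemma hodge_upper_add: "hodge_upper g r (\<lambda>\<mu>. S \<mu> + T \<mu>) = (\<lambda>\<mu>. hodge_upper g r S \<mu> + hodge_upper g r T \<mu>)"
  by (auto simp: hodge_upper_def sum.distrib distrib_left add_divide_distrib)

lemma hodge_upper_scale: "hodge_upper g r (\<lambda>\<mu>. c * T \<mu>) = (\<lambda>\<mu>. c * hodge_upper g r T \<mu>)"
  by (auto simp: hodge_upper_def sum_distrib_left mult_ac)

lemma hodge_add: "hodge g r (\<lambda>\<mu>. S \<mu> + T \<mu>) = (\<lambda>\<mu>. hodge g r S \<mu> + hodge g r T \<mu>)"
  by (simp add: hodge_def hodge_upper_add contract_all_add)

lemma hodge_scale: "hodge g r (\<lambda>\<mu>. c * T \<mu>) = (\<lambda>\<mu>. c * hodge g r T \<mu>)"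
  by (simp add: hodge_def hodge_upper_scale contract_all_scale)

lemma tensor_of_rank_hodge [simp]: "tensor_of_rank r (hodge g r T)"
  by (simp add: hodge_def)

lemma antisymmetric_hodge:
  fixes F :: "'d::{finite,linorder} tensor"
  assumes "CARD('d) = 2 * r"
  shows "antisymmetric r (hodge g r F)"
proof -
  have "antisymmetric r (hodge_upper g r F)"
    unfolding antisymmetric_def
  proof (intro allI impI, elim conjE)
    fix \<mu> :: "'d list" and \<pi> assume *: "length \<mu> = r" "\<pi> permutes {..<r}"
    have "levi_civita (permute_list \<pi> \<mu> @ \<nu>) = of_int (sign \<pi>) * levi_civita (\<mu> @ \<nu>)" if "length \<nu> = r" for \<nu>
      using antisymmetricD[OF antisymmetric_levi_civita_block[of "[]" r \<nu>] *] assms that by simp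
    thus "hodge_upper g r F (permute_list \<pi> \<mu>) = of_int (sign \<pi>) * hodge_upper g r F \<mu>"
      using * by (simp add: hodge_upper_def sum_distrib_left sum_distrib_right mult_ac)
  qed
  thus ?thesis unfolding hodge_def by (rule antisymmetric_contract_all)
qed

text \<open>A term survives only if \<nu> enumerates the complement of \<mu> and \<rho> is a
  rearrangement of \<mu>. The signs of the second symbol and of Y then cancel, so each of the r! s!
  survivors equals \<open>Y \<mu>\<close>.\<close>

lemma sum_levi_civita_levi_civita:
  fixes Y :: "'d::{finite,linorder} tensor"
  assumes card: "CARD('d) = r + s" and Y: "antisymmetric r Y" and \<mu>: "length \<mu> = r"
  shows "(\<Sum>\<nu> | length \<nu> = s. \<Sum>\<rho> | length \<rho> = r. levi_civita (\<mu> @ \<nu>) * levi_civita (\<rho> @ \<nu>) * Y \<rho>)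
    = fact r * fact s * Y \<mu>"
proof (cases "distinct \<mu>")
  case False
  thus ?thesis using antisymmetric_not_distinct[OF Y \<mu>] by (simp add: levi_civita_def)
next
  case True
  have card\<mu>: "card (set \<mu>) = r" using True \<mu> by (simp add: distinct_card)
  have card': "card (UNIV - set \<mu>) = s" using card card\<mu> by (simp add: card_Diff_subset)
  have inner: "(\<Sum>\<rho> | length \<rho> = r. levi_civita (\<mu> @ \<nu>) * levi_civita (\<rho> @ \<nu>) * Y \<rho>) = fact r * Y \<mu>"
    if \<nu>: "\<nu> \<in> permutations_of_set (UNIV - set \<mu>)" for \<nu>
  proof -
    have \<nu>': "set \<nu> = UNIV - set \<mu>" "distinct \<nu>" "length \<nu> = s"
      using \<nu> card' by (auto simp: permutations_of_set_def distinct_card[symmetric])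
    have nz: "levi_civita (\<mu> @ \<nu>) * levi_civita (\<mu> @ \<nu>) = 1"
      using True \<mu> \<nu>' card by (auto simp: levi_civita_def simp flip: of_int_mult)
    have "(\<Sum>\<rho> | length \<rho> = r. levi_civita (\<mu> @ \<nu>) * levi_civita (\<rho> @ \<nu>) * Y \<rho>)
        = (\<Sum>\<rho>\<in>permutations_of_set (set \<mu>). levi_civita (\<mu> @ \<nu>) * levi_civita (\<rho> @ \<nu>) * Y \<rho>)"
    proof (intro sum.mono_neutral_right ballI)
      show "permutations_of_set (set \<mu>) \<subseteq> {\<rho>. length \<rho> = r}"
        using card\<mu> by (auto simp: permutations_of_set_def distinct_card[symmetric])
      fix \<rho> assume \<rho>: "\<rho> \<in> {\<rho>. length \<rho> = r} - permutations_of_set (set \<mu>)"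
      have "\<not> distinct (\<rho> @ \<nu>)"
      proof
        assume d: "distinct (\<rho> @ \<nu>)"
        hence "set \<rho> \<subseteq> set \<mu>" using \<nu>'(1) by auto
        moreover have "card (set \<rho>) = card (set \<mu>)" using d \<rho> card\<mu> by (simp add: distinct_card)
        ultimately have "set \<rho> = set \<mu>" by (simp add: card_subset_eq)
        thus False using d \<rho> by (simp add: permutations_of_set_def)
      qed
      hence "levi_civita (\<rho> @ \<nu>) = 0" unfolding levi_civita_def by (simp only: simp_thms if_False)
      thus "levi_civita (\<mu> @ \<nu>) * levi_civita (\<rho> @ \<nu>) * Y \<rho> = 0" by simp
    qed simp
    also have "\<dots> = (\<Sum>\<rho>\<in>permutations_of_set (set \<mu>). Y \<mu>)"
    proof (rule sum.cong[OF refl])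
      fix \<rho> assume "\<rho> \<in> permutations_of_set (set \<mu>)"
      hence "mset \<rho> = mset \<mu>" using True by (auto simp: permutations_of_set_def set_eq_iff_mset_eq_distinct)
      then obtain \<pi> where \<pi>: "\<pi> permutes {..<length \<mu>}" "permute_list \<pi> \<mu> = \<rho>"
        by (rule mset_eq_permutation)
      have ss: "real_of_int (sign \<pi>) * real_of_int (sign \<pi>) = 1" by (simp flip: of_int_mult)
      have "levi_civita (\<rho> @ \<nu>) = of_int (sign \<pi>) * levi_civita (\<mu> @ \<nu>)"
        using antisymmetricD[OF antisymmetric_levi_civita_block[of "[]" r \<nu>], of \<mu> \<pi>] \<pi> \<mu> \<nu>' card by simp
      moreover have "Y \<rho> = of_int (sign \<pi>) * Y \<mu>" using antisymmetricD[OF Y \<mu>, of \<pi>] \<pi> \<mu> by simp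
      ultimately have "levi_civita (\<mu> @ \<nu>) * levi_civita (\<rho> @ \<nu>) * Y \<rho>
          = (levi_civita (\<mu> @ \<nu>) * levi_civita (\<mu> @ \<nu>)) * (of_int (sign \<pi>) * of_int (sign \<pi>)) * Y \<mu>"
        by (simp only: mult_ac)
      thus "levi_civita (\<mu> @ \<nu>) * levi_civita (\<rho> @ \<nu>) * Y \<rho> = Y \<mu>" unfolding nz ss by simp
    qed
    finally show ?thesis using card\<mu> by simp
  qed
  have "(\<Sum>\<nu> | length \<nu> = s. \<Sum>\<rho> | length \<rho> = r. levi_civita (\<mu> @ \<nu>) * levi_civita (\<rho> @ \<nu>) * Y \<rho>)
      = (\<Sum>\<nu>\<in>permutations_of_set (UNIV - set \<mu>). \<Sum>\<rho> | length \<rho> = r. levi_civita (\<mu> @ \<nu>) * levi_civita (\<rho> @ \<nu>) * Y \<rho>)"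
  proof (intro sum.mono_neutral_right ballI)
    show "permutations_of_set (UNIV - set \<mu>) \<subseteq> {\<nu>. length \<nu> = s}"
      using card' by (auto simp: permutations_of_set_def distinct_card[symmetric])
    fix \<nu> assume \<nu>: "\<nu> \<in> {\<nu>. length \<nu> = s} - permutations_of_set (UNIV - set \<mu>)"
    have "\<not> distinct (\<mu> @ \<nu>)"
    proof
      assume d: "distinct (\<mu> @ \<nu>)"
      hence "set \<nu> \<subseteq> UNIV - set \<mu>" by auto
      moreover have "card (set \<nu>) = card (UNIV - set \<mu>)" using d \<nu> card' by (simp add: distinct_card)
      ultimately have "set \<nu> = UNIV - set \<mu>" by (simp add: card_subset_eq)
      thus False using d \<nu> by (simp add: permutations_of_set_def)
    qed
    hence "levi_civita (\<mu> @ \<nu>) = 0" unfolding levi_civita_def by (simp only: simp_thms if_False)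
    thus "(\<Sum>\<rho> | length \<rho> = r. levi_civita (\<mu> @ \<nu>) * levi_civita (\<rho> @ \<nu>) * Y \<rho>) = 0" by simp
  qed simp
  also have "\<dots> = (\<Sum>\<nu>\<in>permutations_of_set (UNIV - set \<mu>). fact r * Y \<mu>)"
    using inner by (rule sum.cong[OF refl])
  finally show ?thesis using card' by simp
qed

text \<open>Shifting the matrix from T to the symbol puts one factor of M on each of its d indices,
  which yields det M. With M the metric this lowers all indices of the symbol; with M a Jacobian it
  is the density law.\<close>

lemma contract_all_levi_civita:
  fixes T :: "'d::{finite,linorder} tensor"
  assumes card: "CARD('d) = r + s" and \<mu>: "length \<mu> = r"
  shows "contract_all M r (\<lambda>\<mu>'. \<Sum>\<rho> | length \<rho> = s. levi_civita (\<mu>' @ \<rho>) * contract_all (transpose M) s T \<rho>) \<mu>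
    = det M * (\<Sum>\<rho> | length \<rho> = s. levi_civita (\<mu> @ \<rho>) * T \<rho>)"
proof -
  have "contract_all M r (\<lambda>\<mu>'. \<Sum>\<rho> | length \<rho> = s. levi_civita (\<mu>' @ \<rho>) * contract_all (transpose M) s T \<rho>) \<mu>
    = (\<Sum>\<mu>' | length \<mu>' = r. \<Sum>\<rho> | length \<rho> = s. \<Sum>\<tau> | length \<tau> = s.
        index_prod M \<mu> \<mu>' * (levi_civita (\<mu>' @ \<rho>) * (index_prod M \<tau> \<rho> * T \<tau>)))"
    using \<mu> by (simp add: contract_all_eq sum_distrib_left index_prod_transpose)
  also have "\<dots> = (\<Sum>\<mu>' | length \<mu>' = r. \<Sum>\<tau> | length \<tau> = s. \<Sum>\<rho> | length \<rho> = s.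
        index_prod M \<mu> \<mu>' * (levi_civita (\<mu>' @ \<rho>) * (index_prod M \<tau> \<rho> * T \<tau>)))"
    by (rule sum.cong[OF refl], rule sum.swap)
  also have "\<dots> = (\<Sum>\<tau> | length \<tau> = s. \<Sum>\<mu>' | length \<mu>' = r. \<Sum>\<rho> | length \<rho> = s.
        index_prod M \<mu> \<mu>' * (levi_civita (\<mu>' @ \<rho>) * (index_prod M \<tau> \<rho> * T \<tau>)))"
    by (rule sum.swap)
  also have "\<dots> = (\<Sum>\<tau> | length \<tau> = s. (\<Sum>\<mu>' | length \<mu>' = r. \<Sum>\<rho> | length \<rho> = s.
        index_prod M (\<mu> @ \<tau>) (\<mu>' @ \<rho>) * levi_civita (\<mu>' @ \<rho>)) * T \<tau>)"
    using \<mu> by (simp add: index_prod_append sum_distrib_left sum_distrib_right mult_ac)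
  also have "\<dots> = (\<Sum>\<tau> | length \<tau> = s. det M * levi_civita (\<mu> @ \<tau>) * T \<tau>)"
  proof (rule sum.cong[OF refl])
    fix \<tau> :: "'d list" assume "\<tau> \<in> {\<tau>. length \<tau> = s}"
    hence "length (\<mu> @ \<tau>) = CARD('d)" using \<mu> card by simp
    from sum_index_prod_levi_civita[OF this, of M]
    show "(\<Sum>\<mu>' | length \<mu>' = r. \<Sum>\<rho> | length \<rho> = s.
        index_prod M (\<mu> @ \<tau>) (\<mu>' @ \<rho>) * levi_civita (\<mu>' @ \<rho>)) * T \<tau> = det M * levi_civita (\<mu> @ \<tau>) * T \<tau>"
      unfolding card sum_lists_append by simp
  qed
  finally show ?thesis by (simp add: sum_distrib_left mult_ac)
qed

text \<open>Two signs cancel: lowering the indices of the symbol contributes the negative det g, and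
  exchanging its two blocks of odd length r contributes another minus. The factor r! r! of the
  double contraction cancels the two normalizations.\<close>

lemma hodge_hodge:
  fixes F :: "'d::{finite,linorder} tensor"
  assumes card: "CARD('d) = 2 * r" and "odd r" and g: "lorentzian g"
    and F: "antisymmetric r F" "tensor_of_rank r F"
  shows "hodge g r (hodge g r F) = F"
proof -
  note inv = lorentzian_inverse[OF g] and sym = lorentzian_symmetric[OF g]
  \<comment> \<open>With F written as the lowered \<open>F'\<close>, every index of the symbol meets
    one copy of the metric, as \<open>contract_all_levi_civita\<close> requires.\<close>
  define F' where "F' = contract_all (matrix_inv g) r F"
  have F': "contract_all g r F' = F"
    unfolding F'_def contract_all_contract_all inv by (rule contract_all_mat_1[OF F(2)])
  have F'_anti: "antisymmetric r F'" unfolding F'_def using F(1) by (rule antisymmetric_contract_all)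
  let ?s = "sqrt_minus_det g"
  have upper: "hodge_upper g r T \<mu> = 1 / (?s * fact r) * (\<Sum>\<rho> | length \<rho> = r. levi_civita (\<mu> @ \<rho>) * T \<rho>)"
    if "length \<mu> = r" for T and \<mu> :: "'d list"
    using that by (simp add: hodge_upper_def sum_distrib_left sum_divide_distrib)
  have lower: "hodge g r F \<mu> = det g / (?s * fact r) * (\<Sum>\<rho> | length \<rho> = r. levi_civita (\<mu> @ \<rho>) * F' \<rho>)"
    if "length \<mu> = r" for \<mu> :: "'d list"
  proof -
    have "hodge g r F = contract_all g r (\<lambda>\<mu>. 1 / (?s * fact r) *
        (\<Sum>\<rho> | length \<rho> = r. levi_civita (\<mu> @ \<rho>) * contract_all (transpose g) r F' \<rho>))"
      unfolding hodge_def by (rule contract_all_cong) (simp only: upper sym F')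
    hence "hodge g r F \<mu> = 1 / (?s * fact r) * contract_all g r (\<lambda>\<mu>.
        \<Sum>\<rho> | length \<rho> = r. levi_civita (\<mu> @ \<rho>) * contract_all (transpose g) r F' \<rho>) \<mu>"
      by (simp only: contract_all_scale)
    thus ?thesis using contract_all_levi_civita[of r r \<mu> g F'] card that by simp
  qed
  have "hodge_upper g r (hodge g r F) \<mu> = F' \<mu>" if \<mu>: "length \<mu> = r" for \<mu>
  proof -
    have flip_sum: "(\<Sum>\<rho> | length \<rho> = r. levi_civita (\<nu> @ \<rho>) * F' \<rho>) = (\<Sum>\<rho> | length \<rho> = r. - levi_civita (\<rho> @ \<nu>) * F' \<rho>)"
      if "length \<nu> = r" for \<nu>
    proof (rule sum.cong[OF refl])
      fix \<rho> :: "'d list" assume "\<rho> \<in> {\<rho>. length \<rho> = r}"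
      thus "levi_civita (\<nu> @ \<rho>) * F' \<rho> = - levi_civita (\<rho> @ \<nu>) * F' \<rho>"
        using antisymmetric_move_block[OF antisymmetric_levi_civita, of "[]" \<nu> \<rho> "[]"] that card \<open>odd r\<close> by simp
    qed
    have "hodge_upper g r (hodge g r F) \<mu>
        = 1 / (?s * fact r) * (\<Sum>\<nu> | length \<nu> = r. levi_civita (\<mu> @ \<nu>) *
            (det g / (?s * fact r) * (\<Sum>\<rho> | length \<rho> = r. - levi_civita (\<rho> @ \<nu>) * F' \<rho>)))"
      unfolding upper[OF \<mu>]
      by (intro arg_cong[of _ _ "(*) _"] sum.cong refl) (simp only: lower flip_sum mem_Collect_eq)
    also have "\<dots> = - det g / (?s * ?s * fact r * fact r) *
        (\<Sum>\<nu> | length \<nu> = r. \<Sum>\<rho> | length \<rho> = r. levi_civita (\<mu> @ \<nu>) * levi_civita (\<rho> @ \<nu>) * F' \<rho>)"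
      by (simp add: sum_distrib_left sum_negf mult_ac)
    also have "\<dots> = - det g / (?s * ?s) * F' \<mu>"
      using sum_levi_civita_levi_civita[OF _ F'_anti \<mu>, of r] card by simp
    finally show ?thesis using lorentzian_det_neg[OF g] by (simp add: sqrt_minus_det_square[OF g])
  qed
  hence "hodge g r (hodge g r F) = contract_all g r F'"
    unfolding hodge_def[of g r "hodge g r F"] by (rule contract_all_cong)
  thus ?thesis using F' by simp
qed


section \<open>The variation of the Lagrangian at a point\<close>

text \<open>Up to combinatorial factors these are the coefficients of the top forms \<open>X \<and> Y\<close>,
  \<open>X \<and> u \<and> Y\<close> and \<open>X \<and> w \<and> Y \<and> u\<close>; they do not involve the metric.\<close>

definition eps_pair :: "nat \<Rightarrow> 'd::{finite,linorder} tensor \<Rightarrow> 'd tensor \<Rightarrow> real" where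
  "eps_pair p X Y = (\<Sum>\<mu> | length \<mu> = Suc p. \<Sum>\<nu> | length \<nu> = Suc p. levi_civita (\<mu> @ \<nu>) * X \<mu> * Y \<nu>)"

definition eps_cov :: "nat \<Rightarrow> 'd::{finite,linorder} tensor \<Rightarrow> 'd coords \<Rightarrow> 'd tensor \<Rightarrow> real" where
  "eps_cov p X u Y = (\<Sum>\<mu> | length \<mu> = p. \<Sum>\<rho>\<in>UNIV. \<Sum>\<nu> | length \<nu> = Suc p.
     levi_civita (\<mu> @ \<rho> # \<nu>) * X \<mu> * u $ \<rho> * Y \<nu>)"

definition eps_cov2 ::
    "nat \<Rightarrow> 'd coords \<Rightarrow> 'd coords \<Rightarrow> 'd::{finite,linorder} tensor \<Rightarrow> 'd tensor \<Rightarrow> real" where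
  "eps_cov2 p w u X Y = (\<Sum>\<mu> | length \<mu> = p. \<Sum>\<sigma>\<in>UNIV. \<Sum>\<nu> | length \<nu> = p. \<Sum>\<rho>\<in>UNIV.
     levi_civita (\<mu> @ \<sigma> # \<nu> @ [\<rho>]) * X \<mu> * w $ \<sigma> * Y \<nu> * u $ \<rho>)"

lemma eps_cov_add_left:
  "eps_cov p (\<lambda>\<mu>. X \<mu> + X' \<mu>) u Y = eps_cov p X u Y + eps_cov p X' u Y"
  by (simp add: eps_cov_def sum.distrib distrib_left distrib_right)

lemma eps_cov_scale_left: "eps_cov p (\<lambda>\<mu>. c * X \<mu>) u Y = c * eps_cov p X u Y"
  by (simp add: eps_cov_def sum_distrib_left mult_ac)

lemma eps_cov2_add:
  "eps_cov2 p w u (\<lambda>\<mu>. X \<mu> + X' \<mu>) Y = eps_cov2 p w u X Y + eps_cov2 p w u X' Y"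
  "eps_cov2 p w u X (\<lambda>\<mu>. Y \<mu> + Y' \<mu>) = eps_cov2 p w u X Y + eps_cov2 p w u X Y'"
  by (simp_all add: eps_cov2_def sum.distrib distrib_left distrib_right)

lemma eps_cov2_scale:
  "eps_cov2 p w u (\<lambda>\<mu>. c * X \<mu>) Y = c * eps_cov2 p w u X Y"
  "eps_cov2 p w u X (\<lambda>\<mu>. c * Y \<mu>) = c * eps_cov2 p w u X Y"
  by (simp_all add: eps_cov2_def sum_distrib_left mult_ac)

text \<open>X and Y have even degree p, so they may pass each other and the covector w without a
  sign.\<close>

lemma eps_cov2_commute:
  fixes X Y :: "'d::{finite,linorder} tensor"
  assumes "CARD('d) = 2 * Suc p" "even p"
  shows "eps_cov2 p w u X Y = eps_cov2 p w u Y X"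
proof -
  have flip: "levi_civita (\<mu> @ \<sigma> # \<nu> @ [\<rho>]) = levi_civita (\<nu> @ \<sigma> # \<mu> @ [\<rho>])"
    if "length \<mu> = p" "length \<nu> = p" for \<mu> \<nu> and \<sigma> \<rho> :: 'd
    using antisymmetric_move_block[OF antisymmetric_levi_civita, of "[]" "\<mu> @ [\<sigma>]" \<nu> "[\<rho>]"]
      antisymmetric_move_block[OF antisymmetric_levi_civita, of \<nu> \<mu> "[\<sigma>]" "[\<rho>]"] that assms by simp
  have "eps_cov2 p w u X Y = (\<Sum>\<mu> | length \<mu> = p. \<Sum>\<nu> | length \<nu> = p. \<Sum>\<sigma>\<in>UNIV. \<Sum>\<rho>\<in>UNIV.
     levi_civita (\<mu> @ \<sigma> # \<nu> @ [\<rho>]) * X \<mu> * w $ \<sigma> * Y \<nu> * u $ \<rho>)" for X Y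
    unfolding eps_cov2_def by (rule sum.cong[OF refl], rule sum.swap)
  note expand = this
  have "eps_cov2 p w u X Y = (\<Sum>\<nu> | length \<nu> = p. \<Sum>\<mu> | length \<mu> = p. \<Sum>\<sigma>\<in>UNIV. \<Sum>\<rho>\<in>UNIV.
     levi_civita (\<mu> @ \<sigma> # \<nu> @ [\<rho>]) * X \<mu> * w $ \<sigma> * Y \<nu> * u $ \<rho>)"
    unfolding expand by (rule sum.swap)
  also have "\<dots> = eps_cov2 p w u Y X"
    unfolding expand by (intro sum.cong refl) (simp add: flip mult_ac)
  finally show ?thesis .
qed

text \<open>The lowering inside \<open>hodge\<close> and the raising inside
  \<open>full_contraction\<close> undo each other, and the contracted vector is u raised. Of the
  metric only sqrt(-g) survives.\<close>

lemma full_contraction_contract_last_hodge: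
  assumes g: "lorentzian g"
  shows "full_contraction g p X (contract_last p (hodge g (Suc p) Y) (matrix_inv g *v u))
    = eps_cov p X u Y / (fact (Suc p) * sqrt_minus_det g)"
proof -
  note inv = lorentzian_inverse[OF g] and sym = lorentzian_symmetric[OF g]
  have "contract_last p (hodge g (Suc p) Y) (matrix_inv g *v u)
      = contract_all g p (contract_last p (hodge_upper g (Suc p) Y) u)"
    by (simp add: hodge_def contract_last_contract_all sym inv matrix_vector_mul_assoc)
  hence "contract_all (matrix_inv g) p (contract_last p (hodge g (Suc p) Y) (matrix_inv g *v u))
      = contract_last p (hodge_upper g (Suc p) Y) u"
    by (simp add: contract_all_contract_all inv contract_all_mat_1)
  thus ?thesis
    by (simp add: full_contraction_def eps_cov_def contract_last_def hodge_upper_def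
        sum_distrib_left sum_distrib_right sum_divide_distrib mult_ac)
qed

text \<open>The factor along u in the top form X \<and> Y comes either from X or from Y, and the
  derivation separates the two cases. Applied to \<delta>F and F, this trades \<delta>F contracted
  with v for E, at the price of the term \<delta>F \<and> F.\<close>

lemma eps_pair_decompose:
  fixes X Y :: "'d::{finite,linorder} tensor"
  assumes card: "CARD('d) = 2 * Suc p" and "even p"
    and XY: "antisymmetric (Suc p) X" "antisymmetric (Suc p) Y"
    and uv: "u \<bullet> v = -1"
  shows "- eps_pair p X Y = Suc p * (eps_cov p (contract_last p X v) u Y - eps_cov p (contract_last p Y v) u X)"
proof -
  have card': "CARD('d) = Suc p + Suc p" using card by simp
  define Z where "Z \<mu> = X (take (Suc p) \<mu>) * Y (drop (Suc p) \<mu>)" for \<mu>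
  have "- eps_pair p X Y = (u \<bullet> v) * (\<Sum>\<mu> | length \<mu> = CARD('d). levi_civita \<mu> * Z \<mu>)"
    unfolding eps_pair_def Z_def uv card' sum_lists_append by (simp add: mult_ac)
  also have "\<dots> = slot_sum (Suc p + Suc p) u v levi_civita Z"
    using schouten_sum[of u v Z] unfolding card' .
  also have "\<dots> = (\<Sum>\<nu> | length \<nu> = Suc p. Y \<nu> * slot_sum (Suc p) u v (\<lambda>\<mu>. levi_civita (\<mu> @ \<nu>)) X)
      + (\<Sum>\<mu> | length \<mu> = Suc p. X \<mu> * slot_sum (Suc p) u v (\<lambda>\<nu>. levi_civita (\<mu> @ \<nu>)) Y)"
    unfolding Z_def by (rule slot_sum_append)
  also have "(\<Sum>\<nu> | length \<nu> = Suc p. Y \<nu> * slot_sum (Suc p) u v (\<lambda>\<mu>. levi_civita (\<mu> @ \<nu>)) X)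
     = (\<Sum>\<nu> | length \<nu> = Suc p. \<Sum>\<mu> | length \<mu> = p. \<Sum>\<sigma>\<in>UNIV.
         Suc p * (levi_civita (\<mu> @ \<sigma> # \<nu>) * contract_last p X v \<mu> * u $ \<sigma> * Y \<nu>))"
  proof (rule sum.cong[OF refl])
    fix \<nu> :: "'d list" assume \<nu>: "\<nu> \<in> {\<nu>. length \<nu> = Suc p}"
    have "antisymmetric (Suc p) (\<lambda>\<mu>. levi_civita (\<mu> @ \<nu>))"
      using antisymmetric_levi_civita_block[of "[]" "Suc p" \<nu>] \<nu> card by simp
    from slot_sum_antisymmetric[OF this XY(1)]
    show "Y \<nu> * slot_sum (Suc p) u v (\<lambda>\<mu>. levi_civita (\<mu> @ \<nu>)) X = (\<Sum>\<mu> | length \<mu> = p. \<Sum>\<sigma>\<in>UNIV.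
         Suc p * (levi_civita (\<mu> @ \<sigma> # \<nu>) * contract_last p X v \<mu> * u $ \<sigma> * Y \<nu>))"
      by (simp add: sum_distrib_left mult_ac del: of_nat_Suc)
  qed
  also have "\<dots> = Suc p * eps_cov p (contract_last p X v) u Y"
    unfolding eps_cov_def sum_distrib_left
    by (subst sum.swap, rule sum.cong[OF refl], rule sum.swap)
  also have "(\<Sum>\<mu> | length \<mu> = Suc p. X \<mu> * slot_sum (Suc p) u v (\<lambda>\<nu>. levi_civita (\<mu> @ \<nu>)) Y)
     = (\<Sum>\<mu> | length \<mu> = Suc p. \<Sum>\<nu> | length \<nu> = p. \<Sum>\<sigma>\<in>UNIV.
         - (Suc p * (levi_civita (\<nu> @ \<sigma> # \<mu>) * contract_last p Y v \<nu> * u $ \<sigma> * X \<mu>)))"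
  proof (rule sum.cong[OF refl])
    fix \<mu> :: "'d list" assume \<mu>: "\<mu> \<in> {\<mu>. length \<mu> = Suc p}"
    \<comment> \<open>Both blocks have the odd length p + 1, which is the origin of the minus sign
      between the two terms.\<close>
    have flip: "levi_civita (\<mu> @ \<nu> @ [\<sigma>]) = - levi_civita (\<nu> @ \<sigma> # \<mu>)" if "length \<nu> = p" for \<nu> \<sigma>
      using antisymmetric_move_block[OF antisymmetric_levi_civita, of "[]" \<mu> "\<nu> @ [\<sigma>]" "[]"]
        that \<mu> card \<open>even p\<close> by simp
    have "antisymmetric (Suc p) (\<lambda>\<nu>. levi_civita (\<mu> @ \<nu>))"
      using antisymmetric_levi_civita_block[of \<mu> "Suc p" "[]"] \<mu> card by simp
    from slot_sum_antisymmetric[OF this XY(2)]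
    show "X \<mu> * slot_sum (Suc p) u v (\<lambda>\<nu>. levi_civita (\<mu> @ \<nu>)) Y = (\<Sum>\<nu> | length \<nu> = p. \<Sum>\<sigma>\<in>UNIV.
         - (Suc p * (levi_civita (\<nu> @ \<sigma> # \<mu>) * contract_last p Y v \<nu> * u $ \<sigma> * X \<mu>)))"
      by (simp add: sum_distrib_left flip mult_ac del: of_nat_Suc)
  qed
  also have "\<dots> = - (Suc p * eps_cov p (contract_last p Y v) u X)"
    unfolding eps_cov_def sum_distrib_left sum_negf[symmetric]
    by (subst sum.swap, rule sum.cong[OF refl], rule sum.swap)
  finally show ?thesis by (simp add: right_diff_distrib)
qed

text \<open>Two arguments of an antisymmetric tensor are set equal to v. Applied to F, its dual and
  \<Lambda>, it makes E, B and \<lambda> purely spatial.\<close>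

lemma contract_last_slot_eq_0:
  fixes F :: "'d::finite tensor"
  assumes F: "antisymmetric (Suc p) F" and "length \<mu> = p" "i < p"
  shows "(\<Sum>\<rho>\<in>UNIV. v $ \<rho> * contract_last p F v (\<mu>[i := \<rho>])) = 0"
proof -
  have flip: "F (\<mu>[i := \<tau>] @ [\<rho>]) = - F (\<mu>[i := \<rho>] @ [\<tau>])" for \<rho> \<tau>
  proof -
    have perm: "Transposition.transpose i p permutes {..<length (\<mu>[i := \<rho>] @ [\<tau>])}"
      by (rule permutes_transpose) (use assms in auto)
    have "permute_list (Transposition.transpose i p) (\<mu>[i := \<rho>] @ [\<tau>]) = \<mu>[i := \<tau>] @ [\<rho>]"
      by (rule nth_equalityI)
         (use assms in \<open>auto simp: permute_list_nth[OF perm] nth_append nth_list_update Transposition.transpose_def\<close>)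
    thus ?thesis using antisymmetric_transposeD[OF F, of "\<mu>[i := \<rho>] @ [\<tau>]" i p] assms by simp
  qed
  let ?S = "\<Sum>\<rho>\<in>UNIV. \<Sum>\<tau>\<in>UNIV. v $ \<rho> * v $ \<tau> * F (\<mu>[i := \<rho>] @ [\<tau>])"
  have "?S = (\<Sum>\<tau>\<in>UNIV. \<Sum>\<rho>\<in>UNIV. v $ \<rho> * v $ \<tau> * F (\<mu>[i := \<rho>] @ [\<tau>]))" by (rule sum.swap)
  also have "\<dots> = - ?S"
    by (subst flip) (simp add: sum_negf mult_ac)
  finally have "?S = 0" by simp
  thus ?thesis using assms by (simp add: contract_last_def sum_distrib_left mult_ac)
qed

text \<open>Both X and w are annihilated by v, so in the Leibniz rule only the slots of F
  contribute: the direction u of the top form must be supplied by F.\<close>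

lemma eps_cov_spatial:
  fixes X F :: "'d::{finite,linorder} tensor"
  assumes card: "CARD('d) = 2 * Suc p"
    and X: "\<And>\<mu> i. length \<mu> = p \<Longrightarrow> i < p \<Longrightarrow> (\<Sum>\<rho>\<in>UNIV. v $ \<rho> * X (\<mu>[i := \<rho>])) = 0"
    and F: "antisymmetric (Suc p) F" and uv: "u \<bullet> v = -1" and wv: "w \<bullet> v = 0"
  shows "eps_cov p X w F = - Suc p * eps_cov2 p w u X (contract_last p F v)"
proof -
  have card': "CARD('d) = (p + 1) + Suc p" using card by simp
  \<comment> \<open>The covector becomes a rank-one tensor, so that the integrand is a product of
    three tensors and \<open>slot_sum_append\<close> applies twice.\<close>
  define W where "W \<mu> = w $ hd \<mu>" for \<mu>
  define XW where "XW \<mu> = X (take p \<mu>) * W (drop p \<mu>)" for \<mu>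
  define Z where "Z \<mu> = XW (take (p + 1) \<mu>) * F (drop (p + 1) \<mu>)" for \<mu>
  have "- eps_cov p X w F = (u \<bullet> v) * (\<Sum>\<mu> | length \<mu> = CARD('d). levi_civita \<mu> * Z \<mu>)"
    unfolding eps_cov_def Z_def XW_def W_def uv card' sum_lists_append
    by (simp add: sum_lists_Suc mult_ac)
  also have "\<dots> = slot_sum ((p + 1) + Suc p) u v levi_civita Z"
    using schouten_sum[of u v Z] unfolding card' .
  also have "\<dots> = (\<Sum>\<nu> | length \<nu> = Suc p. F \<nu> * slot_sum (p + 1) u v (\<lambda>\<mu>. levi_civita (\<mu> @ \<nu>)) XW)
      + (\<Sum>\<mu> | length \<mu> = p + 1. XW \<mu> * slot_sum (Suc p) u v (\<lambda>\<nu>. levi_civita (\<mu> @ \<nu>)) F)"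
    unfolding Z_def by (rule slot_sum_append)
  also have "(\<Sum>\<nu> | length \<nu> = Suc p. F \<nu> * slot_sum (p + 1) u v (\<lambda>\<mu>. levi_civita (\<mu> @ \<nu>)) XW) = 0"
  proof -
    have "slot_sum p u v S' X = 0" for S'
      by (simp add: slot_sum_def X)
    moreover have "slot_sum 1 u v S' W = 0" for S'
      using wv by (simp add: slot_sum_def W_def sum_lists_Suc inner_vec_def mult.commute)
    ultimately show ?thesis unfolding XW_def slot_sum_append by (simp del: One_nat_def)
  qed
  also have "(\<Sum>\<mu> | length \<mu> = p + 1. XW \<mu> * slot_sum (Suc p) u v (\<lambda>\<nu>. levi_civita (\<mu> @ \<nu>)) F)
     = (\<Sum>\<mu> | length \<mu> = p + 1. XW \<mu> * (Suc p *
         (\<Sum>\<nu> | length \<nu> = p. \<Sum>\<rho>\<in>UNIV. levi_civita (\<mu> @ \<nu> @ [\<rho>]) * u $ \<rho> * contract_last p F v \<nu>)))"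
  proof (rule sum.cong[OF refl])
    fix \<mu> :: "'d list" assume \<mu>: "\<mu> \<in> {\<mu>. length \<mu> = p + 1}"
    have "antisymmetric (Suc p) (\<lambda>\<nu>. levi_civita (\<mu> @ \<nu>))"
      using antisymmetric_levi_civita_block[of \<mu> "Suc p" "[]"] \<mu> card by simp
    from slot_sum_antisymmetric[OF this F]
    show "XW \<mu> * slot_sum (Suc p) u v (\<lambda>\<nu>. levi_civita (\<mu> @ \<nu>)) F = XW \<mu> * (Suc p *
         (\<Sum>\<nu> | length \<nu> = p. \<Sum>\<rho>\<in>UNIV. levi_civita (\<mu> @ \<nu> @ [\<rho>]) * u $ \<rho> * contract_last p F v \<nu>))"
      by simp
  qed
  also have "\<dots> = Suc p * eps_cov2 p w u X (contract_last p F v)"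
    unfolding sum_lists_append eps_cov2_def XW_def W_def
    by (simp add: sum_lists_Suc sum_distrib_left mult_ac del: of_nat_Suc)
  finally show ?thesis by (simp add: algebra_simps)
qed

text \<open>\<open>E1\<close>, \<open>B1\<close> and \<open>l1\<close> are the linear changes of E,
  B and \<lambda> when F changes by dF and the unit covector u by w. Each scalar product with a dual
  becomes a metric-free top form. The terms containing w are brought to the common shape
  \<open>eps_cov2\<close>, in which they can be collected into a quadratic form.\<close>

lemma kinetic_variation:
  fixes F dF \<Lambda> :: "'d::{finite,linorder} tensor" and g :: "'d matrix"
  assumes card: "CARD('d) = 2 * Suc p" and "even p" and g: "lorentzian g"
    and F: "antisymmetric (Suc p) F" "tensor_of_rank (Suc p) F" and dF: "antisymmetric (Suc p) dF"
    and \<Lambda>: "antisymmetric (Suc p) \<Lambda>" "self_dual g (Suc p) \<Lambda>"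
    and v: "v = matrix_inv g *v u" and x: "x = matrix_inv g *v w"
    and uv: "u \<bullet> v = -1" and wv: "w \<bullet> v = 0"
  defines "E \<equiv> contract_last p F v" and "B \<equiv> contract_last p (hodge g (Suc p) F) v"
    and "l \<equiv> contract_last p \<Lambda> v"
  defines "E1 \<equiv> (\<lambda>\<mu>. contract_last p dF v \<mu> + contract_last p F x \<mu>)"
    and "B1 \<equiv> (\<lambda>\<mu>. contract_last p (hodge g (Suc p) dF) v \<mu> + contract_last p (hodge g (Suc p) F) x \<mu>)"
    and "l1 \<equiv> contract_last p \<Lambda> x"
  defines "G \<equiv> (\<lambda>\<mu>. E \<mu> + B \<mu> + 2 * l \<mu>)"
    and "\<kappa> \<equiv> 1 / (fact (Suc p) * sqrt_minus_det g)"
  shows "1/2 * (full_contraction g p E1 B + full_contraction g p E B1)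
      - 1/2 * (full_contraction g p B1 B + full_contraction g p B B1)
      + (full_contraction g p (\<lambda>\<mu>. B1 \<mu> + l1 \<mu>) (\<lambda>\<mu>. B \<mu> + l \<mu>)
        + full_contraction g p (\<lambda>\<mu>. B \<mu> + l \<mu>) (\<lambda>\<mu>. B1 \<mu> + l1 \<mu>))
    = - \<kappa> / (2 * Suc p) * eps_pair p dF F + \<kappa> * eps_cov p G u dF
      - \<kappa> * Suc p / 2 * eps_cov2 p w u G G"
proof -
  let ?fc = "full_contraction g p" and ?Q = "eps_cov2 p w u"
  have odd: "odd (Suc p)" using \<open>even p\<close> by simp
  \<comment> \<open>Products with a contraction of F itself also fit the formula for duals, because
    F is the dual of H.\<close>
  define H where "H = hodge g (Suc p) F"
  have H: "antisymmetric (Suc p) H" "hodge g (Suc p) H = F"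
    unfolding H_def using card F by (simp_all add: antisymmetric_hodge hodge_hodge[OF card odd g F])
  have sd: "hodge g (Suc p) \<Lambda> = \<Lambda>" using \<Lambda>(2) by (simp add: self_dual_def)
  have fc_v: "?fc X (contract_last p (hodge g (Suc p) Y) v) = \<kappa> * eps_cov p X u Y"
    and fc_x: "?fc X (contract_last p (hodge g (Suc p) Y) x) = \<kappa> * eps_cov p X w Y" for X Y
    unfolding v x \<kappa>_def by (simp_all add: full_contraction_contract_last_hodge[OF g])
  have B: "B = contract_last p H v" by (simp add: B_def H_def)
  have comm: "?fc X Y = ?fc Y X" for X Y by (rule full_contraction_commute[OF g])
  have spat: "eps_cov p E w Y = - Suc p * ?Q E (contract_last p Y v)"
    "eps_cov p B w Y = - Suc p * ?Q B (contract_last p Y v)"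
    "eps_cov p l w Y = - Suc p * ?Q l (contract_last p Y v)" if "antisymmetric (Suc p) Y" for Y
    unfolding E_def B l_def
    by (intro eps_cov_spatial[OF card _ that uv wv] contract_last_slot_eq_0 F H \<Lambda>; assumption)+
  have sym: "?Q X Y = ?Q Y X" for X Y by (rule eps_cov2_commute[OF card \<open>even p\<close>])
  define a where "a = eps_cov p (contract_last p dF v) u F"
  have a: "a = eps_cov p E u dF - eps_pair p dF F / Suc p"
    \<comment> \<open>Here \<delta>E.B is converted into the shape of E.\<delta>B; together the two
      halves give the E part of the term with G, and the difference is the pairing with F.\<close>
    using eps_pair_decompose[OF card \<open>even p\<close> dF F(1) uv] by (simp add: a_def E_def field_simps)
  have 1: "?fc E1 B = \<kappa> * a - \<kappa> * Suc p * ?Q B B"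
  proof -
    have "?fc E1 B = ?fc (contract_last p dF v) B + ?fc B (contract_last p F x)"
      by (simp add: E1_def full_contraction_add_left comm[of _ B])
    also have "?fc (contract_last p dF v) B = \<kappa> * a" by (simp add: B_def fc_v a_def)
    also have "?fc B (contract_last p F x) = \<kappa> * eps_cov p B w H"
      using fc_x[of B H] by (simp add: H(2))
    finally show ?thesis by (simp add: spat(2)[OF H(1)] B[symmetric] algebra_simps)
  qed
  have 2: "?fc X B1 = \<kappa> * eps_cov p X u dF + \<kappa> * eps_cov p X w F" for X
    by (simp add: B1_def full_contraction_add_right fc_v fc_x)
  have 3: "?fc X l1 = \<kappa> * eps_cov p X w \<Lambda>" for X
    using fc_x[of X \<Lambda>] by (simp add: l1_def sd)
  \<comment> \<open>These six coefficients agree with those that the w terms of the variation have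
    in the next chain of equations.\<close>
  have G_sq: "?Q G G = ?Q E E + ?Q B B + 4 * ?Q l l + 2 * ?Q B E + 4 * ?Q l E + 4 * ?Q B l"
    unfolding G_def by (simp add: eps_cov2_add eps_cov2_scale sym[of E B] sym[of E l] sym[of l B])
  have "1/2 * (?fc E1 B + ?fc E B1) - 1/2 * (?fc B1 B + ?fc B B1)
      + (?fc (\<lambda>\<mu>. B1 \<mu> + l1 \<mu>) (\<lambda>\<mu>. B \<mu> + l \<mu>) + ?fc (\<lambda>\<mu>. B \<mu> + l \<mu>) (\<lambda>\<mu>. B1 \<mu> + l1 \<mu>))
    = 1/2 * ?fc E1 B + 1/2 * ?fc E B1 + ?fc B B1 + 2 * ?fc l B1 + 2 * ?fc B l1 + 2 * ?fc l l1"
    by (simp add: full_contraction_add_left full_contraction_add_right comm[of B1 B]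
        comm[of "B1" l] comm[of l1 B] comm[of l1 l])
  also have "\<dots> = - \<kappa> / (2 * Suc p) * eps_pair p dF F
      + \<kappa> * (eps_cov p E u dF + eps_cov p B u dF + 2 * eps_cov p l u dF)
      - \<kappa> * Suc p / 2 * (?Q E E + ?Q B B + 4 * ?Q l l + 2 * ?Q B E + 4 * ?Q l E + 4 * ?Q B l)"
    unfolding 1 2 3 a by (simp add: spat F \<Lambda> E_def[symmetric] l_def[symmetric] field_simps)
  finally show ?thesis
    unfolding G_sq by (simp add: G_def eps_cov_add_left eps_cov_scale_left)
qed


section \<open>Behaviour under a change of basis\<close>

lemma pull_metric_inverse:
  fixes J g :: "'d::finite matrix"
  assumes J: "det J \<noteq> 0" and g: "lorentzian g"
  shows "matrix_inv (pull_metric J g) = matrix_inv J ** matrix_inv g ** transpose (matrix_inv J)"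
proof (rule matrix_inv_unique)
  have "invertible J" using J by (simp add: invertible_det_nz)
  note i = matrix_inv_right_left[OF this]
  have i': "transpose J ** transpose (matrix_inv J) = mat 1"
    using arg_cong[OF i(2), of transpose] by (simp add: matrix_transpose_mul)
  have "pull_metric J g ** (matrix_inv J ** matrix_inv g ** transpose (matrix_inv J))
      = transpose J ** (g ** ((J ** matrix_inv J) ** matrix_inv g)) ** transpose (matrix_inv J)"
    by (simp add: pull_metric_def matrix_mul_assoc)
  thus "pull_metric J g ** (matrix_inv J ** matrix_inv g ** transpose (matrix_inv J)) = mat 1"
    by (simp add: i lorentzian_inverse[OF g] i')
qed

lemma
  fixes J g :: "'d::finite matrix"
  assumes J: "det J \<noteq> 0" and g: "lorentzian g"
  shows covector_norm2_pull: "covector_norm2 (pull_metric J g) (transpose J *v w) = covector_norm2 g w"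
    and unit_covector_pull: "unit_covector (pull_metric J g) (transpose J *v w) = transpose J *v unit_covector g w"
    and unit_vector_pull: "J *v unit_vector (pull_metric J g) (transpose J *v w) = unit_vector g w"
proof -
  have "invertible J" using J by (simp add: invertible_det_nz)
  note i = matrix_inv_right_left[OF this]
  have i': "transpose (matrix_inv J) ** transpose J = mat 1"
    using arg_cong[OF i(1), of transpose] by (simp add: matrix_transpose_mul)
  have "matrix_inv (pull_metric J g) *v (transpose J *v w)
      = (matrix_inv J ** matrix_inv g ** (transpose (matrix_inv J) ** transpose J)) *v w" for w
    by (simp only: pull_metric_inverse[OF J g] matrix_vector_mul_assoc matrix_mul_assoc)
  hence raise: "matrix_inv (pull_metric J g) *v (transpose J *v w) = matrix_inv J *v (matrix_inv g *v w)" for w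
    by (simp add: i' matrix_vector_mul_assoc del: transpose_matrix_vector)
  have "(transpose J *v w) \<bullet> (matrix_inv J *v y) = w \<bullet> y" for w y
    by (metis dot_lmul_matrix i(1) matrix_vector_mul_assoc matrix_vector_mul_lid transpose_matrix_vector)
  thus norm: "covector_norm2 (pull_metric J g) (transpose J *v w) = covector_norm2 g w" for w
    by (simp add: covector_norm2_def raise del: transpose_matrix_vector)
  thus unit: "unit_covector (pull_metric J g) (transpose J *v w) = transpose J *v unit_covector g w"
    by (simp add: unit_covector_def matrix_vector_mult_scaleR del: transpose_matrix_vector)
  show "J *v unit_vector (pull_metric J g) (transpose J *v w) = unit_vector g w"
    unfolding unit_vector_def unit raise by (simp add: matrix_vector_mul_assoc matrix_mul_assoc i)
qed

lemma contract_last_pull: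
  "contract_last k (pull (Suc k) J F) v = pull k J (contract_last k F (J *v v))"
  by (simp add: pull_def contract_last_contract_all)

text \<open>The determinant of the metric acquires (det J)^2, and preservation of orientation
  removes the absolute value from its root.\<close>

lemma sqrt_minus_det_pull:
  "det J > 0 \<Longrightarrow> sqrt_minus_det (pull_metric J g) = det J * sqrt_minus_det g"
proof -
  assume "det J > 0"
  moreover have "- det (pull_metric J g) = (det J)\<^sup>2 * - det g"
    by (simp add: pull_metric_def det_mul power2_eq_square)
  ultimately show ?thesis by (simp only: sqrt_minus_det_def real_sqrt_mult real_sqrt_abs abs_of_pos)
qed

text \<open>The determinant acquired by the Levi-Civita symbol cancels the one acquired by sqrt(-g).
  For J reversing the orientation a sign would remain.\<close>

lemma hodge_pull:
  fixes F :: "'d::{finite,linorder} tensor"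
  assumes card: "CARD('d) = 2 * r" and J: "det J > 0" and g: "lorentzian g"
  shows "hodge (pull_metric J g) r (pull r J F) = pull r J (hodge g r F)"
proof -
  let ?s = "sqrt_minus_det g"
  have upper: "hodge_upper h r T \<mu> = 1 / (sqrt_minus_det h * fact r) * (\<Sum>\<rho> | length \<rho> = r. levi_civita (\<mu> @ \<rho>) * T \<rho>)"
    if "length \<mu> = r" for T h and \<mu> :: "'d list"
    using that by (simp add: hodge_upper_def sum_distrib_left sum_divide_distrib)
  have "contract_all J r (hodge_upper (pull_metric J g) r (pull r J F)) = contract_all J r (\<lambda>\<mu>. 1 / (det J * ?s * fact r) *
        (\<Sum>\<rho> | length \<rho> = r. levi_civita (\<mu> @ \<rho>) * contract_all (transpose J) r F \<rho>))"
    by (rule contract_all_cong) (simp only: upper sqrt_minus_det_pull[OF J] pull_def)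
  hence "contract_all J r (hodge_upper (pull_metric J g) r (pull r J F)) \<mu> = hodge_upper g r F \<mu>" if "length \<mu> = r" for \<mu>
    using contract_all_levi_civita[of r r \<mu> J F] card J that by (simp only: contract_all_scale upper) simp
  hence "contract_all g r (contract_all J r (hodge_upper (pull_metric J g) r (pull r J F)))
      = contract_all g r (hodge_upper g r F)"
    by (rule contract_all_cong)
  hence "contract_all (transpose J) r (contract_all g r (contract_all J r (hodge_upper (pull_metric J g) r (pull r J F))))
      = pull r J (hodge g r F)"
    by (simp only: pull_def hodge_def)
  thus ?thesis
    by (simp only: hodge_def[of _ _ "pull r J F"] contract_all_contract_all pull_metric_def matrix_mul_assoc)
qed

lemma full_contraction_pull:
  fixes S T :: "'d::finite tensor"
  assumes J: "det J \<noteq> 0" and g: "lorentzian g" and T: "tensor_of_rank r T"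
  shows "full_contraction (pull_metric J g) r (pull r J S) (pull r J T) = full_contraction g r S T"
proof -
  have "invertible J" using J by (simp add: invertible_det_nz)
  note i = matrix_inv_right_left[OF this]
  have i': "transpose (matrix_inv J) ** transpose J = mat 1"
    using arg_cong[OF i(1), of transpose] by (simp add: matrix_transpose_mul)
  have "matrix_inv (pull_metric J g) ** transpose J
      = matrix_inv J ** matrix_inv g ** (transpose (matrix_inv J) ** transpose J)"
    by (simp add: pull_metric_inverse[OF J g] matrix_mul_assoc)
  hence "contract_all (matrix_inv (pull_metric J g)) r (pull r J T) = contract_all (matrix_inv J ** matrix_inv g) r T"
    by (simp add: pull_def contract_all_contract_all i')
  hence "full_contraction (pull_metric J g) r (pull r J S) (pull r J T)
      = (\<Sum>\<mu> | length \<mu> = r. S \<mu> * contract_all (J ** (matrix_inv J ** matrix_inv g)) r T \<mu>)"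
    by (simp add: full_contraction_def pull_def contract_all_contract_all
        sum_contract_all_transpose[where S = S and M = J, symmetric])
  thus ?thesis by (simp add: full_contraction_def matrix_mul_assoc i)
qed

lemma pull_add: "pull r J (\<lambda>\<mu>. S \<mu> + T \<mu>) = (\<lambda>\<mu>. pull r J S \<mu> + pull r J T \<mu>)"
  by (simp add: pull_def contract_all_add)

text \<open>The kinetic terms are full contractions of tensors that transform properly, and
  \<open>V\<close> is invariant by \<open>scalar_function\<close>. The value of the Lagrangian thus
  does not depend on the chart picked by \<open>chart_at\<close>.\<close>

lemma lagrangian_pull:
  fixes F \<Lambda> :: "'d::{finite,linorder} tensor"
  assumes card: "CARD('d) = 2 * Suc p" and J: "det J > 0" and g: "lorentzian g"
    and V: "scalar_function (p + 1) V"
    and \<Lambda>: "tensor_of_rank (p + 1) \<Lambda>" "antisymmetric (p + 1) \<Lambda>" "self_dual g (p + 1) \<Lambda>"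
  shows "lagrangian p V (pull_metric J g) (transpose J *v da) (pull (p + 1) J F) (pull (p + 1) J \<Lambda>)
    = lagrangian p V g da F \<Lambda>"
proof -
  have J0: "det J \<noteq> 0" using J by simp
  note v = unit_vector_pull[OF J0 g, of da]
  have V': "V (pull (Suc p) J \<Lambda>) (pull_metric J g) = V \<Lambda> g"
    using V J g \<Lambda> by (auto simp: scalar_function_def)
  define v where "v = unit_vector g da"
  define E B l where "E = contract_last p F v" "B = contract_last p (hodge g (Suc p) F) v" "l = contract_last p \<Lambda> v"
  let ?v = "unit_vector (pull_metric J g) (transpose J *v da)"
  have rank: "tensor_of_rank p E" "tensor_of_rank p B" "tensor_of_rank p (\<lambda>\<mu>. B \<mu> + l \<mu>)"
    by (simp_all add: E_B_l_def tensor_of_rank_def contract_last_def)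
  have *: "contract_last p (pull (Suc p) J F) ?v = pull p J E"
    "contract_last p (hodge (pull_metric J g) (Suc p) (pull (Suc p) J F)) ?v = pull p J B"
    "contract_last p (pull (Suc p) J \<Lambda>) ?v = pull p J l"
    by (simp_all only: E_B_l_def v_def v contract_last_pull hodge_pull[OF card J g])
  show ?thesis
    unfolding lagrangian_def Let_def Suc_eq_plus1[symmetric] * V' pull_add[symmetric]
      full_contraction_pull[OF J0 g rank(1)] full_contraction_pull[OF J0 g rank(2)]
      full_contraction_pull[OF J0 g rank(3)]
    by (simp only: E_B_l_def v_def)
qed


section \<open>Calculus in a chart\<close>

lemma
  assumes "is_chart c"
  shows coord_in_range: "q \<in> dom_ch c \<Longrightarrow> coord c q \<in> coord_range c"
    and coord_inv_coord: "q \<in> dom_ch c \<Longrightarrow> coord_inv c (coord c q) = q"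
    and coord_inv_in_dom: "x \<in> coord_range c \<Longrightarrow> coord_inv c x \<in> dom_ch c"
proof -
  have hom: "homeomorphism (dom_ch c) (coord_range c) (coord c) (coord_inv c)"
    using assms by (simp add: is_chart_def)
  show "q \<in> dom_ch c \<Longrightarrow> coord c q \<in> coord_range c" by (simp add: coord_range_def)
  show "q \<in> dom_ch c \<Longrightarrow> coord_inv c (coord c q) = q" by (rule homeomorphism_apply1[OF hom])
  show "x \<in> coord_range c \<Longrightarrow> coord_inv c x \<in> dom_ch c" using homeomorphism_image2[OF hom] by blast
qed

lemma open_coord_image:
  assumes "is_chart c" "open W" "W \<subseteq> dom_ch c"
  shows "open (coord c ` W)"
proof -
  have hom: "homeomorphism (dom_ch c) (coord_range c) (coord c) (coord_inv c)"
    and op: "open (dom_ch c)" "open (coord_range c)"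
    using assms(1) by (auto simp: is_chart_def)
  have "openin (top_of_set (coord_range c)) (coord c ` W)"
    using homeomorphism_imp_open_map[OF hom] assms(2,3) op by (simp add: openin_open_eq)
  thus ?thesis using op openin_open_eq by blast
qed

definition chart_diff :: "('m, 'd::finite) chart \<Rightarrow> ('m \<Rightarrow> real) \<Rightarrow> 'm \<Rightarrow> bool" where
  "chart_diff c f q \<longleftrightarrow> (\<lambda>x. f (coord_inv c x)) differentiable (at (coord c q))"

text \<open>Smoothness on a part W of the chart domain, since transition maps and Jacobians are
  defined only on overlaps.\<close>

definition chart_smooth :: "('m, 'd::finite) chart \<Rightarrow> 'm set \<Rightarrow> ('m \<Rightarrow> real) \<Rightarrow> bool" where
  "chart_smooth c W f \<longleftrightarrow> smooth_on (coord c ` W) (\<lambda>x. f (coord_inv c x))"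

lemma smooth_in_chart_iff: "smooth_in_chart c f \<longleftrightarrow> chart_smooth c (dom_ch c) f"
  by (simp add: smooth_in_chart_def chart_smooth_def coord_range_def)

definition open_in_chart :: "('m::topological_space, 'd::finite) chart \<Rightarrow> 'm set \<Rightarrow> bool" where
  "open_in_chart c W \<longleftrightarrow> is_chart c \<and> open W \<and> W \<subseteq> dom_ch c"

lemma open_in_chart_dom: "is_chart c \<Longrightarrow> open_in_chart c (dom_ch c)"
  by (simp add: open_in_chart_def is_chart_def)

lemma open_in_chart_image: "open_in_chart c W \<Longrightarrow> open (coord c ` W)"
  unfolding open_in_chart_def by (elim conjE) (rule open_coord_image)

lemma open_in_chart_inv:
  "open_in_chart c W \<Longrightarrow> x \<in> coord c ` W \<Longrightarrow> coord_inv c x \<in> W"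
  "open_in_chart c W \<Longrightarrow> q \<in> W \<Longrightarrow> coord_inv c (coord c q) = q"
  "open_in_chart c W \<Longrightarrow> x \<in> coord c ` W \<Longrightarrow> coord c (coord_inv c x) = x"
proof -
  assume W: "open_in_chart c W"
  have inv: "coord_inv c (coord c q) = q" if "q \<in> W" for q
    using W that coord_inv_coord[of c q] by (simp add: open_in_chart_def subset_iff)
  show "q \<in> W \<Longrightarrow> coord_inv c (coord c q) = q" by (rule inv)
  show "x \<in> coord c ` W \<Longrightarrow> coord_inv c x \<in> W" "x \<in> coord c ` W \<Longrightarrow> coord c (coord_inv c x) = x"
    using inv by force+
qed

lemma chart_smooth_diff: "chart_smooth c W f \<Longrightarrow> q \<in> W \<Longrightarrow> chart_diff c f q"
  unfolding chart_smooth_def chart_diff_def by (rule smooth_on_differentiable) auto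

lemma chart_smooth_cong:
  assumes "open_in_chart c W" "\<And>q. q \<in> W \<Longrightarrow> f q = g q" "chart_smooth c W f"
  shows "chart_smooth c W g"
  using assms(3) unfolding chart_smooth_def
  by (rule smooth_on_cong[OF open_in_chart_image[OF assms(1)], rotated])
     (use open_in_chart_inv(1)[OF assms(1)] assms(2) in blast)

lemma chart_partial_cong:
  assumes "open_in_chart c W" "q \<in> W" "\<And>q. q \<in> W \<Longrightarrow> f q = g q"
  shows "chart_partial c \<mu> f q = chart_partial c \<mu> g q"
  unfolding chart_partial_def
  by (rule partial_cong[OF open_in_chart_image[OF assms(1)]])
     (use assms open_in_chart_inv(1)[OF assms(1)] in blast)+

lemma chart_diff_const [simp]: "chart_diff c (\<lambda>q. k) q"
  by (simp add: chart_diff_def)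

lemma chart_diff_add: "chart_diff c f q \<Longrightarrow> chart_diff c g q \<Longrightarrow> chart_diff c (\<lambda>q. f q + g q) q"
  unfolding chart_diff_def by (rule differentiable_add)

lemma chart_diff_mult: "chart_diff c f q \<Longrightarrow> chart_diff c g q \<Longrightarrow> chart_diff c (\<lambda>q. f q * g q) q"
  unfolding chart_diff_def by (rule differentiable_mult)

lemma chart_diff_sum: "(\<And>i. i \<in> I \<Longrightarrow> chart_diff c (f i) q) \<Longrightarrow> chart_diff c (\<lambda>q. \<Sum>i\<in>I. f i q) q"
  by (induction I rule: infinite_finite_induct) (auto intro: chart_diff_add)

lemma chart_diff_prod: "(\<And>i. i \<in> I \<Longrightarrow> chart_diff c (f i) q) \<Longrightarrow> chart_diff c (\<lambda>q. \<Prod>i\<in>I. f i q) q"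
  by (induction I rule: infinite_finite_induct) (auto intro: chart_diff_mult)

lemma chart_partial_const [simp]: "chart_partial c \<mu> (\<lambda>q. k) q = 0"
  by (simp add: chart_partial_def)

lemma chart_partial_add:
  "chart_diff c f q \<Longrightarrow> chart_diff c g q \<Longrightarrow>
    chart_partial c \<mu> (\<lambda>q. f q + g q) q = chart_partial c \<mu> f q + chart_partial c \<mu> g q"
  unfolding chart_diff_def chart_partial_def by (rule partial_add)

lemma chart_partial_mult:
  assumes "is_chart c" "q \<in> dom_ch c" "chart_diff c f q" "chart_diff c g q"
  shows "chart_partial c \<mu> (\<lambda>q. f q * g q) q = chart_partial c \<mu> f q * g q + f q * chart_partial c \<mu> g q"
  using partial_mult[OF assms(3,4)[unfolded chart_diff_def], of \<mu>] coord_inv_coord[OF assms(1,2)]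
  by (simp add: chart_partial_def)

lemma chart_partial_cmult:
  assumes "chart_diff c f q"
  shows "chart_partial c \<mu> (\<lambda>q. k * f q) q = k * chart_partial c \<mu> f q"
  using partial_mult[OF _ assms[unfolded chart_diff_def], of "\<lambda>x. k" \<mu>]
  by (simp add: chart_partial_def)

lemma chart_partial_sum:
  "(\<And>i. i \<in> I \<Longrightarrow> chart_diff c (f i) q) \<Longrightarrow>
    chart_partial c \<mu> (\<lambda>q. \<Sum>i\<in>I. f i q) q = (\<Sum>i\<in>I. chart_partial c \<mu> (f i) q)"
  by (induction I rule: infinite_finite_induct) (auto simp: chart_partial_add chart_diff_sum)

lemma chart_partial_prod:
  assumes c: "is_chart c" "q \<in> dom_ch c" and "finite I" "\<And>i. i \<in> I \<Longrightarrow> chart_diff c (f i) q"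
  shows "chart_partial c \<mu> (\<lambda>q. \<Prod>i\<in>I. f i q) q = (\<Sum>i\<in>I. chart_partial c \<mu> (f i) q * (\<Prod>j\<in>I - {i}. f j q))"
  using assms(3,4)
proof (induction I rule: finite_induct)
  case (insert a I)
  have "(\<Prod>j\<in>insert a I - {i}. f j q) = f a q * (\<Prod>j\<in>I - {i}. f j q)" if "i \<in> I" for i
  proof -
    have "insert a I - {i} = insert a (I - {i})" using insert.hyps that by auto
    thus ?thesis using insert.hyps by simp
  qed
  moreover have "insert a I - {a} = I" using insert.hyps by auto
  ultimately show ?case using insert
    by (simp add: chart_partial_mult[OF c] chart_diff_prod sum_distrib_left mult_ac)
qed simp

lemma chart_partial_commute:
  assumes "open_in_chart c W" "q \<in> W" "chart_smooth c W f"
  shows "chart_partial c \<mu> (chart_partial c \<nu> f) q = chart_partial c \<nu> (chart_partial c \<mu> f) q"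
proof -
  let ?f = "\<lambda>x. f (coord_inv c x)" and ?U = "coord c ` W"
  have U: "open ?U" "coord c q \<in> ?U" using open_in_chart_image[OF assms(1)] assms(2) by auto
  have "partial \<mu> (\<lambda>x. partial \<nu> ?f (coord c (coord_inv c x))) (coord c q) = partial \<mu> (partial \<nu> ?f) (coord c q)" for \<mu> \<nu>
    by (rule partial_cong[OF U]) (simp add: open_in_chart_inv[OF assms(1)])
  thus ?thesis
    using partial_commute[OF U assms(3)[unfolded chart_smooth_def], of \<mu> \<nu>] by (simp add: chart_partial_def[abs_def])
qed

lemma chart_smooth_partial:
  assumes "open_in_chart c W" "chart_smooth c W f"
  shows "chart_smooth c W (chart_partial c \<mu> f)"
  unfolding chart_smooth_def
  by (rule smooth_on_cong[OF open_in_chart_image[OF assms(1)] _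
        smooth_on_partial[OF assms(2)[unfolded chart_smooth_def], of \<mu>]])
     (simp add: chart_partial_def open_in_chart_inv[OF assms(1)])

lemma chart_smooth_continuous:
  assumes "open_in_chart c W" "chart_smooth c W f"
  shows "continuous_on W f"
proof -
  have "continuous_on (coord c ` W) (\<lambda>x. f (coord_inv c x))"
    using smooth_on_differentiable[OF assms(2)[unfolded chart_smooth_def]]
    by (auto intro!: differentiable_imp_continuous_within continuous_at_imp_continuous_on)
  moreover have "continuous_on W (coord c)"
    using assms(1) continuous_on_subset
    unfolding open_in_chart_def is_chart_def homeomorphism_def by blast
  ultimately have "continuous_on W (\<lambda>q. f (coord_inv c (coord c q)))"
    using continuous_on_compose[of W "coord c" "\<lambda>x. f (coord_inv c x)"] by (simp add: o_def)
  thus ?thesis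
    by (rule continuous_on_eq) (simp add: open_in_chart_inv[OF assms(1)])
qed

context
  fixes c :: "('m::topological_space, 'd::finite) chart" and W :: "'m set"
  assumes W: "open_in_chart c W"
begin

lemma chart_smooth_const: "chart_smooth c W (\<lambda>q. k)"
  unfolding chart_smooth_def by (rule smooth_on_const[OF open_in_chart_image[OF W]])

lemma chart_smooth_add: "chart_smooth c W f \<Longrightarrow> chart_smooth c W g \<Longrightarrow> chart_smooth c W (\<lambda>q. f q + g q)"
  unfolding chart_smooth_def by (rule smooth_on_add[OF open_in_chart_image[OF W]])

lemma chart_smooth_mult: "chart_smooth c W f \<Longrightarrow> chart_smooth c W g \<Longrightarrow> chart_smooth c W (\<lambda>q. f q * g q)"
  unfolding chart_smooth_def by (rule smooth_on_mult[OF open_in_chart_image[OF W]])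

lemma chart_smooth_minus: "chart_smooth c W f \<Longrightarrow> chart_smooth c W (\<lambda>q. - f q)"
  using chart_smooth_mult[OF chart_smooth_const[of "-1"]] by simp

lemma chart_smooth_divide:
  assumes "chart_smooth c W f" "chart_smooth c W g" "\<And>q. q \<in> W \<Longrightarrow> g q \<noteq> 0"
  shows "chart_smooth c W (\<lambda>q. f q / g q)"
proof -
  have "chart_smooth c W (\<lambda>q. inverse (g q))"
    using assms(2) unfolding chart_smooth_def
    by (rule smooth_on_inverse[OF open_in_chart_image[OF W]])
       (use assms(3) open_in_chart_inv(1)[OF W] in blast)
  from chart_smooth_mult[OF assms(1) this] show ?thesis by (simp add: field_class.field_divide_inverse)
qed

lemma chart_smooth_sqrt:
  assumes "chart_smooth c W f" "\<And>q. q \<in> W \<Longrightarrow> f q > 0"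
  shows "chart_smooth c W (\<lambda>q. sqrt (f q))"
  using assms(1) unfolding chart_smooth_def
  by (rule smooth_on_sqrt[OF open_in_chart_image[OF W]])
     (use assms(2) open_in_chart_inv(1)[OF W] in blast)

lemma chart_smooth_sum:
  "(\<And>i. i \<in> I \<Longrightarrow> chart_smooth c W (f i)) \<Longrightarrow> chart_smooth c W (\<lambda>q. \<Sum>i\<in>I. f i q)"
  by (induction I rule: infinite_finite_induct) (auto intro: chart_smooth_const chart_smooth_add)

lemma chart_smooth_prod:
  "(\<And>i. i \<in> I \<Longrightarrow> chart_smooth c W (f i)) \<Longrightarrow> chart_smooth c W (\<lambda>q. \<Prod>i\<in>I. f i q)"
  by (induction I rule: infinite_finite_induct) (auto intro: chart_smooth_const chart_smooth_mult)

lemma chart_smooth_det: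
  fixes M :: "'m \<Rightarrow> real^'n^'n::finite"
  assumes "\<And>i j. chart_smooth c W (\<lambda>q. M q $ i $ j)"
  shows "chart_smooth c W (\<lambda>q. det (M q))"
  unfolding det_def by (intro chart_smooth_sum chart_smooth_mult chart_smooth_const chart_smooth_prod assms)

text \<open>By Cramer's rule an entry of the inverse is a quotient of determinants, hence of
  polynomials in the entries of M. The matrix \<open>?C\<close> is M with column i replaced by the
  j-th basis vector.\<close>

lemma chart_smooth_matrix_inv:
  fixes M :: "'m \<Rightarrow> real^'n^'n::finite"
  assumes M: "\<And>i j. chart_smooth c W (\<lambda>q. M q $ i $ j)" and nz: "\<And>q. q \<in> W \<Longrightarrow> det (M q) \<noteq> 0"
  shows "chart_smooth c W (\<lambda>q. matrix_inv (M q) $ i $ j)"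
proof -
  let ?C = "\<lambda>q. (\<chi> k l. if l = i then axis j 1 $ k else M q $ k $ l) :: real^'n^'n"
  have "chart_smooth c W (\<lambda>q. det (?C q) / det (M q))"
  proof (intro chart_smooth_divide chart_smooth_det M nz)
    fix k l show "chart_smooth c W (\<lambda>q. ?C q $ k $ l)"
      by (cases "l = i") (simp_all add: chart_smooth_const M)
  qed
  moreover have "det (?C q) / det (M q) = matrix_inv (M q) $ i $ j" if q: "q \<in> W" for q
  proof -
    have inv: "invertible (M q)" using nz[OF q] by (simp add: invertible_det_nz)
    have "M q *v (matrix_inv (M q) *v axis j 1) = axis j 1"
      by (simp add: matrix_vector_mul_assoc matrix_inv_right_left[OF inv])
    hence "matrix_inv (M q) *v axis j 1 = (\<chi> k. det (\<chi> i' j'. if j' = k then axis j 1 $ i' else M q $ i' $ j') / det (M q))"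
      using cramer[OF nz[OF q], of "matrix_inv (M q) *v axis j 1" "axis j 1"] by simp
    hence "(matrix_inv (M q) *v axis j 1) $ i = det (?C q) / det (M q)" by simp
    thus ?thesis by (simp add: matrix_vector_mult_basis column_def)
  qed
  ultimately show ?thesis by (rule chart_smooth_cong[OF W, rotated])
qed

end

text \<open>The chain rule for the transition map, which near the point expresses f in the
  coordinates of c through f in those of c'.\<close>

lemma chart_change:
  fixes c c' :: "('m::topological_space, 'd::finite) chart"
  assumes "oriented_atlas \<A>" "c \<in> \<A>" "c' \<in> \<A>" "q \<in> dom_ch c" "q \<in> dom_ch c'" "chart_diff c' f q"
  shows "chart_partial c \<mu> f q = (\<Sum>\<nu>\<in>UNIV. jacobian c c' q $ \<nu> $ \<mu> * chart_partial c' \<nu> f q)"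
    and "chart_diff c f q"
proof -
  define W where "W = dom_ch c \<inter> dom_ch c'"
  have ch: "is_chart c" "is_chart c'" using assms by (auto simp: oriented_atlas_def)
  hence W: "open_in_chart c W" by (auto simp: open_in_chart_def W_def is_chart_def)
  have qW: "q \<in> W" using assms by (simp add: W_def)
  have U: "open (coord c ` W)" "coord c q \<in> coord c ` W" using open_in_chart_image[OF W] qW by auto
  let ?\<Phi> = "\<lambda>x. coord c' (coord_inv c x)" and ?f = "\<lambda>x. f (coord_inv c' x)"
  have "smooth_on (coord c ` W) (\<lambda>x. ?\<Phi> x $ \<nu>)" for \<nu>
    using assms(1-3) unfolding oriented_atlas_def W_def by blast
  hence d1: "(\<lambda>x. ?\<Phi> x $ \<nu>) differentiable (at (coord c q))" for \<nu>
    using smooth_on_differentiable U(2) by blast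
  have \<Phi>q: "?\<Phi> (coord c q) = coord c' q" using open_in_chart_inv(2)[OF W qW] by simp
  have d2: "?f differentiable (at (?\<Phi> (coord c q)))"
    using assms(6) unfolding chart_diff_def \<Phi>q .
  have eq: "?f (?\<Phi> x) = f (coord_inv c x)" if "x \<in> coord c ` W" for x
    using open_in_chart_inv(1)[OF W that] coord_inv_coord[OF ch(2)] by (simp add: W_def)
  show "chart_diff c f q" unfolding chart_diff_def
    by (rule differentiable_cong_open[OF U eq partial_compose(2)[OF d1 d2]])
  have "chart_partial c \<mu> f q = partial \<mu> (\<lambda>x. ?f (?\<Phi> x)) (coord c q)"
    unfolding chart_partial_def by (rule partial_cong[OF U, symmetric]) (rule eq)
  also have "\<dots> = (\<Sum>\<nu>\<in>UNIV. jacobian c c' q $ \<nu> $ \<mu> * chart_partial c' \<nu> f q)"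
    unfolding partial_compose(1)[OF d1 d2] by (simp add: jacobian_def chart_partial_def \<Phi>q)
  finally show "chart_partial c \<mu> f q = (\<Sum>\<nu>\<in>UNIV. jacobian c c' q $ \<nu> $ \<mu> * chart_partial c' \<nu> f q)" .
qed


section \<open>Tensor fields\<close>

lemma antisymmetrize_add:
  "antisymmetrize r (\<lambda>\<mu>. S \<mu> + T \<mu>) \<mu> = antisymmetrize r S \<mu> + antisymmetrize r T \<mu>"
  by (simp add: antisymmetrize_def sum.distrib distrib_left add_divide_distrib)

lemma antisymmetrize_scale: "antisymmetrize r (\<lambda>\<mu>. k * T \<mu>) \<mu> = k * antisymmetrize r T \<mu>"
  by (simp add: antisymmetrize_def sum_distrib_left mult_ac)

lemma antisymmetrize_sum:
  "antisymmetrize r (\<lambda>\<mu>. \<Sum>i\<in>I. T i \<mu>) \<mu> = (\<Sum>i\<in>I. antisymmetrize r (T i) \<mu>)"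
proof (induction I rule: infinite_finite_induct)
  case (insert i I)
  thus ?case by (simp add: antisymmetrize_add)
qed (simp_all add: antisymmetrize_def)

lemma antisymmetrize_cong:
  "(\<And>\<mu>. length \<mu> = r \<Longrightarrow> S \<mu> = T \<mu>) \<Longrightarrow> antisymmetrize r S \<mu> = antisymmetrize r T \<mu>"
  by (simp add: antisymmetrize_def)

lemma tensor_of_rank_antisymmetrize [simp]: "tensor_of_rank r (antisymmetrize r T)"
  by (simp add: antisymmetrize_def tensor_of_rank_def)

lemma tensor_of_rank_scale: "tensor_of_rank r T \<Longrightarrow> tensor_of_rank r (\<lambda>\<mu>. k * T \<mu>)"
  by (simp add: tensor_of_rank_def)

lemma pull_outer:
  "pull (k + l) J (\<lambda>\<mu>. S (take k \<mu>) * T (drop k \<mu>)) = (\<lambda>\<mu>. pull k J S (take k \<mu>) * pull l J T (drop k \<mu>))"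
proof
  fix \<mu> :: "'a list"
  show "pull (k + l) J (\<lambda>\<mu>. S (take k \<mu>) * T (drop k \<mu>)) \<mu> = pull k J S (take k \<mu>) * pull l J T (drop k \<mu>)"
  proof (cases "length \<mu> = k + l")
    case True
    then obtain \<mu>1 \<mu>2 where \<mu>: "\<mu> = \<mu>1 @ \<mu>2" "length \<mu>1 = k" "length \<mu>2 = l"
      by (metis append_take_drop_id length_drop length_take add_diff_cancel_left' min.absorb2 le_add1)
    show ?thesis
      by (simp add: pull_def contract_all_eq \<mu> sum_lists_append index_prod_append sum_product mult_ac)
  qed (auto simp: pull_def contract_all_eq)
qed

text \<open>Unlike \<open>smooth_scalar\<close>, this admits functions that are computed from
  components and therefore formally depend on the chart, such as the norm of the gradient of
  a.\<close>

definition scalar_field :: "('m::topological_space, 'd::finite) chart set \<Rightarrow> (('m, 'd) chart \<Rightarrow> 'm \<Rightarrow> real) \<Rightarrow> bool" where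
  "scalar_field \<A> f \<longleftrightarrow> (\<forall>c\<in>\<A>. smooth_in_chart c (f c)) \<and>
     (\<forall>c\<in>\<A>. \<forall>c'\<in>\<A>. \<forall>q\<in>dom_ch c \<inter> dom_ch c'. f c q = f c' q)"

definition covector_field :: "('m::topological_space, 'd::finite) chart set \<Rightarrow> ('m, 'd) vector_field \<Rightarrow> bool" where
  "covector_field \<A> u \<longleftrightarrow> (\<forall>c\<in>\<A>. \<forall>\<mu>. smooth_in_chart c (\<lambda>q. u c q $ \<mu>)) \<and>
     (\<forall>c\<in>\<A>. \<forall>c'\<in>\<A>. \<forall>q\<in>dom_ch c \<inter> dom_ch c'. u c q = transpose (jacobian c c' q) *v u c' q)"

text \<open>Embeds covectors into tensors, so that v can be a factor of an outer product of
  covariant fields.\<close>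

definition covector_tensor :: "'d coords \<Rightarrow> 'd::finite tensor" where
  "covector_tensor u \<mu> = (if length \<mu> = 1 then u $ hd \<mu> else 0)"

locale oriented_manifold =
  fixes \<A> :: "('m::topological_space, 'd::{finite,linorder}) chart set"
  assumes atlas: "oriented_atlas \<A>"
begin

lemma chart: "c \<in> \<A> \<Longrightarrow> is_chart c"
  using atlas by (simp add: oriented_atlas_def)

lemma chart_dom: "c \<in> \<A> \<Longrightarrow> open_in_chart c (dom_ch c)"
  using open_in_chart_dom chart by blast

lemma chart_overlap: "c \<in> \<A> \<Longrightarrow> c' \<in> \<A> \<Longrightarrow> open_in_chart c (dom_ch c \<inter> dom_ch c')"
  using chart[of c] chart[of c'] by (auto simp: open_in_chart_def is_chart_def)

lemma det_jacobian_pos: "c \<in> \<A> \<Longrightarrow> c' \<in> \<A> \<Longrightarrow> q \<in> dom_ch c \<Longrightarrow> q \<in> dom_ch c' \<Longrightarrow> det (jacobian c c' q) > 0"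
  using atlas unfolding oriented_atlas_def by blast

lemma smooth_transition:
  "c \<in> \<A> \<Longrightarrow> c' \<in> \<A> \<Longrightarrow> chart_smooth c (dom_ch c \<inter> dom_ch c') (\<lambda>q. coord c' q $ \<nu>)"
  using atlas unfolding oriented_atlas_def chart_smooth_def by blast

lemma smooth_jacobian:
  "c \<in> \<A> \<Longrightarrow> c' \<in> \<A> \<Longrightarrow> chart_smooth c (dom_ch c \<inter> dom_ch c') (\<lambda>q. jacobian c c' q $ \<nu> $ \<mu>)"
  using chart_smooth_partial[OF chart_overlap smooth_transition, of c c' \<mu>]
  by (simp add: jacobian_def)

lemma covariant_fieldI:
  assumes "\<And>c q. c \<in> \<A> \<Longrightarrow> q \<in> dom_ch c \<Longrightarrow> tensor_of_rank r (T c q)"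
    and "\<And>c \<mu>. c \<in> \<A> \<Longrightarrow> chart_smooth c (dom_ch c) (\<lambda>q. T c q \<mu>)"
    and "\<And>c c' q. c \<in> \<A> \<Longrightarrow> c' \<in> \<A> \<Longrightarrow> q \<in> dom_ch c \<Longrightarrow> q \<in> dom_ch c' \<Longrightarrow>
      T c q = pull r (jacobian c c' q) (T c' q)"
  shows "covariant_field \<A> r T"
  unfolding covariant_field_def smooth_in_chart_iff using assms by blast

lemma covariant_fieldD:
  assumes "covariant_field \<A> r T" "c \<in> \<A>"
  shows "q \<in> dom_ch c \<Longrightarrow> tensor_of_rank r (T c q)"
    and "chart_smooth c (dom_ch c) (\<lambda>q. T c q \<mu>)"
    and "c' \<in> \<A> \<Longrightarrow> q \<in> dom_ch c \<Longrightarrow> q \<in> dom_ch c' \<Longrightarrow> T c q = pull r (jacobian c c' q) (T c' q)"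
  using assms unfolding covariant_field_def smooth_in_chart_iff by blast+

lemma scalar_fieldD:
  assumes "scalar_field \<A> f" "c \<in> \<A>"
  shows "chart_smooth c (dom_ch c) (f c)"
    and "c' \<in> \<A> \<Longrightarrow> q \<in> dom_ch c \<Longrightarrow> q \<in> dom_ch c' \<Longrightarrow> f c q = f c' q"
  using assms unfolding scalar_field_def smooth_in_chart_iff by blast+

lemma covector_fieldD:
  assumes "covector_field \<A> u" "c \<in> \<A>"
  shows "chart_smooth c (dom_ch c) (\<lambda>q. u c q $ \<mu>)"
    and "c' \<in> \<A> \<Longrightarrow> q \<in> dom_ch c \<Longrightarrow> q \<in> dom_ch c' \<Longrightarrow> u c q = transpose (jacobian c c' q) *v u c' q"
  using assms unfolding covector_field_def smooth_in_chart_iff by blast+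

lemma contravariant_vector_fieldD:
  assumes "contravariant_vector_field \<A> v" "c \<in> \<A>"
  shows "chart_smooth c (dom_ch c) (\<lambda>q. v c q $ \<mu>)"
    and "c' \<in> \<A> \<Longrightarrow> q \<in> dom_ch c \<Longrightarrow> q \<in> dom_ch c' \<Longrightarrow> v c' q = jacobian c c' q *v v c q"
  using assms unfolding contravariant_vector_field_def smooth_in_chart_iff by blast+

lemma smooth_scalarD: "smooth_scalar \<A> f \<Longrightarrow> c \<in> \<A> \<Longrightarrow> chart_smooth c (dom_ch c) f"
  by (simp add: smooth_scalar_def smooth_in_chart_iff)

lemma scalar_field_smooth_scalar: "smooth_scalar \<A> f \<Longrightarrow> scalar_field \<A> (\<lambda>c. f)"
  by (simp add: smooth_scalar_def scalar_field_def)

lemma covariant_field_add: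
  assumes "covariant_field \<A> r S" "covariant_field \<A> r T"
  shows "covariant_field \<A> r (\<lambda>c q \<mu>. S c q \<mu> + T c q \<mu>)"
proof (rule covariant_fieldI)
  fix c q assume c: "c \<in> \<A>"
  note S = covariant_fieldD[OF assms(1) c] and T = covariant_fieldD[OF assms(2) c]
  show "tensor_of_rank r (\<lambda>\<mu>. S c q \<mu> + T c q \<mu>)" if "q \<in> dom_ch c"
    using S(1)[OF that] T(1)[OF that] by (simp add: tensor_of_rank_def)
  show "chart_smooth c (dom_ch c) (\<lambda>q. S c q \<mu> + T c q \<mu>)" for \<mu>
    by (intro chart_smooth_add chart_dom c S T)
  show "(\<lambda>\<mu>. S c q \<mu> + T c q \<mu>) = pull r (jacobian c c' q) (\<lambda>\<mu>. S c' q \<mu> + T c' q \<mu>)"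
    if "c' \<in> \<A>" "q \<in> dom_ch c" "q \<in> dom_ch c'" for c'
    unfolding pull_add S(3)[OF that, symmetric] T(3)[OF that, symmetric] ..
qed

lemma covariant_field_scale:
  assumes "scalar_field \<A> f" "covariant_field \<A> r T"
  shows "covariant_field \<A> r (\<lambda>c q \<mu>. f c q * T c q \<mu>)"
proof (rule covariant_fieldI)
  fix c q assume c: "c \<in> \<A>"
  note f = scalar_fieldD[OF assms(1) c] and T = covariant_fieldD[OF assms(2) c]
  show "tensor_of_rank r (\<lambda>\<mu>. f c q * T c q \<mu>)" if "q \<in> dom_ch c"
    using T(1)[OF that] by (simp add: tensor_of_rank_def)
  show "chart_smooth c (dom_ch c) (\<lambda>q. f c q * T c q \<mu>)" for \<mu>
    by (intro chart_smooth_mult chart_dom c f T)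
  show "(\<lambda>\<mu>. f c q * T c q \<mu>) = pull r (jacobian c c' q) (\<lambda>\<mu>. f c' q * T c' q \<mu>)"
    if "c' \<in> \<A>" "q \<in> dom_ch c" "q \<in> dom_ch c'" for c'
    using T(3)[OF that] f(2)[OF that] by (simp add: pull_def contract_all_scale)
qed

lemma scalar_field_const: "scalar_field \<A> (\<lambda>c q. k)"
  unfolding scalar_field_def smooth_in_chart_iff by (auto intro: chart_smooth_const chart_dom)

lemma covariant_field_cscale:
  "covariant_field \<A> r T \<Longrightarrow> covariant_field \<A> r (\<lambda>c q \<mu>. k * T c q \<mu>)"
  using covariant_field_scale[OF scalar_field_const] .

lemma covariant_field_outer:
  assumes "covariant_field \<A> k S" "covariant_field \<A> l T"
  shows "covariant_field \<A> (k + l) (\<lambda>c q \<mu>. S c q (take k \<mu>) * T c q (drop k \<mu>))"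
proof (rule covariant_fieldI)
  fix c q assume c: "c \<in> \<A>"
  note S = covariant_fieldD[OF assms(1) c] and T = covariant_fieldD[OF assms(2) c]
  show "tensor_of_rank (k + l) (\<lambda>\<mu>. S c q (take k \<mu>) * T c q (drop k \<mu>))" if "q \<in> dom_ch c"
    unfolding tensor_of_rank_def
  proof (intro allI impI)
    fix \<mu> :: "'d list" assume "length \<mu> \<noteq> k + l"
    hence "length (take k \<mu>) \<noteq> k \<or> length (drop k \<mu>) \<noteq> l" by auto
    thus "S c q (take k \<mu>) * T c q (drop k \<mu>) = 0"
      using S(1)[OF that] T(1)[OF that] unfolding tensor_of_rank_def by auto
  qed
  show "chart_smooth c (dom_ch c) (\<lambda>q. S c q (take k \<mu>) * T c q (drop k \<mu>))" for \<mu>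
    by (intro chart_smooth_mult chart_dom c S T)
  show "(\<lambda>\<mu>. S c q (take k \<mu>) * T c q (drop k \<mu>))
      = pull (k + l) (jacobian c c' q) (\<lambda>\<mu>. S c' q (take k \<mu>) * T c' q (drop k \<mu>))"
    if "c' \<in> \<A>" "q \<in> dom_ch c" "q \<in> dom_ch c'" for c'
    unfolding pull_outer S(3)[OF that, symmetric] T(3)[OF that, symmetric] ..
qed

lemma covariant_field_antisymmetrize:
  assumes "covariant_field \<A> r T"
  shows "covariant_field \<A> r (\<lambda>c q. antisymmetrize r (T c q))"
proof (rule covariant_fieldI)
  fix c q assume c: "c \<in> \<A>"
  note T = covariant_fieldD[OF assms c]
  show "tensor_of_rank r (antisymmetrize r (T c q))" by simp
  show "chart_smooth c (dom_ch c) (\<lambda>q. antisymmetrize r (T c q) \<mu>)" for \<mu>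
  proof (cases "length \<mu> = r")
    case True
    have "chart_smooth c (dom_ch c) (\<lambda>q. 1 / fact r *
      (\<Sum>\<pi> | \<pi> permutes {..<r}. of_int (sign \<pi>) * T c q (permute_list \<pi> \<mu>)))"
      by (intro chart_smooth_mult chart_smooth_sum chart_smooth_const chart_dom c T)
    with True show ?thesis by (simp add: antisymmetrize_def)
  qed (simp add: antisymmetrize_def chart_smooth_const chart_dom c)
  show "antisymmetrize r (T c q) = pull r (jacobian c c' q) (antisymmetrize r (T c' q))"
    if "c' \<in> \<A>" "q \<in> dom_ch c" "q \<in> dom_ch c'" for c'
    unfolding pull_def antisymmetrize_contract_all[symmetric] unfolding pull_def[symmetric] T(3)[OF that, symmetric] ..
qed

lemma covariant_field_contract_last:
  assumes "covariant_field \<A> (Suc r) T" "contravariant_vector_field \<A> v"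
  shows "covariant_field \<A> r (\<lambda>c q. contract_last r (T c q) (v c q))"
proof (rule covariant_fieldI)
  fix c q assume c: "c \<in> \<A>"
  note T = covariant_fieldD[OF assms(1) c] and v = contravariant_vector_fieldD[OF assms(2) c]
  show "tensor_of_rank r (contract_last r (T c q) (v c q))" by simp
  show "chart_smooth c (dom_ch c) (\<lambda>q. contract_last r (T c q) (v c q) \<mu>)" for \<mu>
    by (cases "length \<mu> = r")
       (simp_all add: contract_last_def chart_smooth_sum chart_smooth_mult chart_smooth_const chart_dom c T v)
  show "contract_last r (T c q) (v c q) = pull r (jacobian c c' q) (contract_last r (T c' q) (v c' q))"
    if "c' \<in> \<A>" "q \<in> dom_ch c" "q \<in> dom_ch c'" for c'
    unfolding T(3)[OF that] v(2)[OF that] contract_last_pull ..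
qed

lemma covariant_field_covector:
  assumes "covector_field \<A> u"
  shows "covariant_field \<A> 1 (\<lambda>c q. covector_tensor (u c q))"
proof (rule covariant_fieldI)
  fix c q assume c: "c \<in> \<A>"
  note u = covector_fieldD[OF assms c]
  show "tensor_of_rank 1 (covector_tensor (u c q))" by (simp add: covector_tensor_def tensor_of_rank_def)
  show "chart_smooth c (dom_ch c) (\<lambda>q. covector_tensor (u c q) \<mu>)" for \<mu>
    by (cases "length \<mu> = 1") (simp_all add: covector_tensor_def chart_smooth_const chart_dom c u)
  show "covector_tensor (u c q) = pull 1 (jacobian c c' q) (covector_tensor (u c' q))"
    if that: "c' \<in> \<A>" "q \<in> dom_ch c" "q \<in> dom_ch c'" for c'
  proof
    fix \<mu> :: "'d list"
    show "covector_tensor (u c q) \<mu> = pull 1 (jacobian c c' q) (covector_tensor (u c' q)) \<mu>"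
    proof (cases "length \<mu> = 1")
      case True
      then obtain a where "\<mu> = [a]" by (auto simp: length_Suc_conv)
      thus ?thesis
        by (simp add: covector_tensor_def pull_def contract_all_eq sum_lists_Suc u(2)[OF that]
            matrix_vector_mult_def del: transpose_matrix_vector)
    qed (simp add: covector_tensor_def pull_def contract_all_eq)
  qed
qed

text \<open>The derivative of the components is no tensor, because it also hits the Jacobians. The
  extra terms contain second derivatives of the transition map, which are symmetric in the
  derivative index and one slot of A, and antisymmetrization removes them.\<close>

lemma antisymmetrize_gradient_pull:
  assumes A: "covariant_field \<A> p A" and c: "c \<in> \<A>" "c' \<in> \<A>" and q: "q \<in> dom_ch c" "q \<in> dom_ch c'"
  shows "antisymmetrize (Suc p) (\<lambda>\<mu>. chart_partial c (hd \<mu>) (\<lambda>q. A c q (tl \<mu>)) q)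
    = pull (Suc p) (jacobian c c' q) (antisymmetrize (Suc p) (\<lambda>\<mu>. chart_partial c' (hd \<mu>) (\<lambda>q. A c' q (tl \<mu>)) q))"
proof
  fix \<mu> :: "'d list"
  define J where "J = jacobian c c'"
  define W where "W = dom_ch c \<inter> dom_ch c'"
  have W: "open_in_chart c W" "q \<in> W" using chart_overlap c q by (auto simp: W_def)
  note J_smooth = smooth_jacobian[OF c, folded J_def W_def]
  have J_diff: "chart_diff c (\<lambda>q. J q $ \<nu> $ \<mu>) q" for \<nu> \<mu>
    using chart_smooth_diff[OF J_smooth W(2)] .
  have J_sym: "chart_partial c \<sigma> (\<lambda>q. J q $ \<nu> $ \<tau>) q = chart_partial c \<tau> (\<lambda>q. J q $ \<nu> $ \<sigma>) q" for \<sigma> \<nu> \<tau>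
    using chart_partial_commute[OF W smooth_transition[OF c, folded W_def], of \<sigma> \<tau> \<nu>]
    by (simp add: J_def jacobian_def)
  have A'_diff: "chart_diff c' (\<lambda>q. A c' q \<nu>) q" for \<nu>
    using chart_smooth_diff[OF covariant_fieldD(2)[OF A c(2)] q(2)] .
  note A'_change = chart_change[OF atlas c q A'_diff]
  \<comment> \<open>The term in which the derivative hits the Jacobian factor of slot i. The offset
    \<open>Suc i\<close> arises because position 0 of the list holds the derivative index.\<close>
  define X where "X i \<mu>s = (\<Sum>\<nu> | length \<nu> = p. chart_partial c (\<mu>s ! 0) (\<lambda>q. J q $ (\<nu> ! i) $ (\<mu>s ! Suc i)) q *
      (\<Prod>j\<in>{..<p} - {i}. J q $ (\<nu> ! j) $ (\<mu>s ! Suc j)) * A c' q \<nu>)" for i \<mu>s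
  define dA' where "dA' \<mu>s = chart_partial c' (hd \<mu>s) (\<lambda>q. A c' q (tl \<mu>s)) q" for \<mu>s
  have split: "chart_partial c (hd \<mu>s) (\<lambda>q. A c q (tl \<mu>s)) q = (\<Sum>i<p. X i \<mu>s) + pull (Suc p) (J q) dA' \<mu>s"
    if \<mu>s: "length \<mu>s = Suc p" for \<mu>s
  proof -
    obtain \<sigma> \<mu> where \<mu>: "\<mu>s = \<sigma> # \<mu>" "length \<mu> = p" using \<mu>s by (metis length_Suc_conv)
    let ?P = "\<lambda>\<nu> q. \<Prod>i<p. J q $ (\<nu> ! i) $ (\<mu> ! i)"
    have "A c q \<mu> = (\<Sum>\<nu> | length \<nu> = p. ?P \<nu> q * A c' q \<nu>)" if "q \<in> W" for q
      using covariant_fieldD(3)[OF A c, of q] that \<mu>(2)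
      by (simp add: W_def pull_def contract_all_def transpose_def J_def)
    hence "chart_partial c \<sigma> (\<lambda>q. A c q \<mu>) q = chart_partial c \<sigma> (\<lambda>q. \<Sum>\<nu> | length \<nu> = p. ?P \<nu> q * A c' q \<nu>) q"
      by (rule chart_partial_cong[OF W])
    also have "\<dots> = (\<Sum>\<nu> | length \<nu> = p. (\<Sum>i<p. chart_partial c \<sigma> (\<lambda>q. J q $ (\<nu> ! i) $ (\<mu> ! i)) q *
        (\<Prod>j\<in>{..<p} - {i}. J q $ (\<nu> ! j) $ (\<mu> ! j))) * A c' q \<nu>
        + ?P \<nu> q * (\<Sum>\<tau>\<in>UNIV. J q $ \<tau> $ \<sigma> * dA' (\<tau> # \<nu>)))"
      by (simp add: chart_partial_sum chart_partial_mult chart_partial_prod chart_diff_mult chart_diff_prod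
          chart c q J_diff A'_change J_def[symmetric] dA'_def)
    also have "\<dots> = (\<Sum>i<p. X i \<mu>s) + (\<Sum>\<nu> | length \<nu> = p. \<Sum>\<tau>\<in>UNIV. J q $ \<tau> $ \<sigma> * ?P \<nu> q * dA' (\<tau> # \<nu>))"
      unfolding sum.distrib X_def sum.swap[of _ "{..<p}"]
      by (simp add: sum_distrib_left sum_distrib_right \<mu>(1) mult_ac) (rule sum.swap)
    also have "(\<Sum>\<nu> | length \<nu> = p. \<Sum>\<tau>\<in>UNIV. J q $ \<tau> $ \<sigma> * ?P \<nu> q * dA' (\<tau> # \<nu>))
        = (\<Sum>\<tau>\<in>UNIV. \<Sum>\<nu> | length \<nu> = p. J q $ \<tau> $ \<sigma> * ?P \<nu> q * dA' (\<tau> # \<nu>))"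
      by (rule sum.swap)
    also have "\<dots> = pull (Suc p) (J q) dA' \<mu>s"
    proof -
      have "index_prod (transpose (J q)) \<mu> \<nu> = ?P \<nu> q" if "length \<nu> = p" for \<nu>
        using that \<mu>(2) by (simp add: index_prod_eq_prod transpose_def)
      moreover have "transpose (J q) $ \<sigma> $ \<tau> = J q $ \<tau> $ \<sigma>" for \<tau> by (simp add: transpose_def)
      ultimately show ?thesis by (simp add: pull_def contract_all_eq \<mu> sum_lists_Suc)
    qed
    finally show ?thesis by (simp add: \<mu>(1))
  qed
  have X0: "antisymmetrize (Suc p) (X i) \<mu> = 0" if i: "i < p" for i
  proof (rule antisymmetrize_symmetric_eq_0[of 0 "Suc p" "Suc i"])
    fix \<mu>s :: "'d list" assume \<mu>s: "length \<mu>s = Suc p"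
    have perm: "Transposition.transpose 0 (Suc i) permutes {..<length \<mu>s}"
      by (rule permutes_transpose) (use i \<mu>s in auto)
    have nth: "permute_list (Transposition.transpose 0 (Suc i)) \<mu>s ! k = \<mu>s ! Transposition.transpose 0 (Suc i) k"
      if "k < Suc p" for k
      using permute_list_nth[OF perm] that \<mu>s by simp
    have "(\<Prod>j\<in>{..<p} - {i}. J q $ (\<nu> ! j) $ (permute_list (Transposition.transpose 0 (Suc i)) \<mu>s ! Suc j))
        = (\<Prod>j\<in>{..<p} - {i}. J q $ (\<nu> ! j) $ (\<mu>s ! Suc j))" for \<nu>
      by (rule prod.cong) (auto simp: nth)
    thus "X i (permute_list (Transposition.transpose 0 (Suc i)) \<mu>s) = X i \<mu>s"
      unfolding X_def using i by (simp add: nth J_sym[of "\<mu>s ! Suc i" _ "\<mu>s ! 0"])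
  qed (use i in auto)
  have "antisymmetrize (Suc p) (\<lambda>\<mu>. chart_partial c (hd \<mu>) (\<lambda>q. A c q (tl \<mu>)) q) \<mu>
      = antisymmetrize (Suc p) (\<lambda>\<mu>s. (\<Sum>i<p. X i \<mu>s) + pull (Suc p) (J q) dA' \<mu>s) \<mu>"
    by (rule antisymmetrize_cong) (rule split)
  also have "\<dots> = antisymmetrize (Suc p) (pull (Suc p) (J q) dA') \<mu>"
    by (simp add: antisymmetrize_add antisymmetrize_sum X0)
  finally show "antisymmetrize (Suc p) (\<lambda>\<mu>. chart_partial c (hd \<mu>) (\<lambda>q. A c q (tl \<mu>)) q) \<mu>
    = pull (Suc p) (jacobian c c' q) (antisymmetrize (Suc p) (\<lambda>\<mu>. chart_partial c' (hd \<mu>) (\<lambda>q. A c' q (tl \<mu>)) q)) \<mu>"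
    by (simp add: pull_def antisymmetrize_contract_all J_def dA'_def[abs_def])
qed

lemma field_strength_eq:
  "field_strength p A c q = (\<lambda>\<mu>. real (Suc p) *
     antisymmetrize (Suc p) (\<lambda>\<nu>. chart_partial c (hd \<nu>) (\<lambda>q. A c q (tl \<nu>)) q) \<mu>)"
  by (simp add: field_strength_def)

lemma covariant_field_field_strength:
  assumes A: "covariant_field \<A> p A"
  shows "covariant_field \<A> (Suc p) (field_strength p A)"
proof (rule covariant_fieldI)
  fix c q assume c: "c \<in> \<A>"
  show "tensor_of_rank (Suc p) (field_strength p A c q)"
    unfolding field_strength_eq by (intro tensor_of_rank_scale tensor_of_rank_antisymmetrize)
  show "chart_smooth c (dom_ch c) (\<lambda>q. field_strength p A c q \<mu>)" for \<mu>
  proof (cases "length \<mu> = Suc p")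
    case True
    have "chart_smooth c (dom_ch c) (\<lambda>q. real (Suc p) / fact (Suc p) * (\<Sum>\<pi> | \<pi> permutes {..<Suc p}.
      of_int (sign \<pi>) * chart_partial c (hd (permute_list \<pi> \<mu>)) (\<lambda>q. A c q (tl (permute_list \<pi> \<mu>))) q))"
      by (intro chart_smooth_mult chart_smooth_sum chart_smooth_const chart_smooth_partial chart_dom c
          covariant_fieldD[OF A])
    with True show ?thesis by (simp add: field_strength_eq antisymmetrize_def)
  qed (simp add: field_strength_eq antisymmetrize_def chart_smooth_const chart_dom c)
  show "field_strength p A c q = pull (Suc p) (jacobian c c' q) (field_strength p A c' q)"
    if "c' \<in> \<A>" "q \<in> dom_ch c" "q \<in> dom_ch c'" for c'
    unfolding field_strength_eq antisymmetrize_gradient_pull[OF A c that] by (simp add: pull_def contract_all_scale)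
qed

lemma antisymmetric_field_strength: "antisymmetric (Suc p) (field_strength p A c q)"
  using antisymmetric_antisymmetrize[of "Suc p"] by (simp add: field_strength_eq antisymmetric_def)

lemma covector_field_gradient:
  assumes "smooth_scalar \<A> f"
  shows "covector_field \<A> (\<lambda>c. gradient c f)"
  unfolding covector_field_def smooth_in_chart_iff
proof (intro conjI ballI allI)
  fix c \<mu> assume c: "c \<in> \<A>"
  show "chart_smooth c (dom_ch c) (\<lambda>q. gradient c f q $ \<mu>)"
    by (simp add: gradient_def chart_smooth_partial chart_dom c smooth_scalarD assms)
next
  fix c c' q assume c: "c \<in> \<A>" "c' \<in> \<A>" and q: "q \<in> dom_ch c \<inter> dom_ch c'"
  have "chart_diff c' f q" using chart_smooth_diff[OF smooth_scalarD[OF assms c(2)], of q] q by simp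
  from chart_change(1)[OF atlas c _ _ this] q
  show "gradient c f q = transpose (jacobian c c' q) *v gradient c' f q"
    by (simp add: gradient_def matrix_vector_mult_def transpose_def vec_eq_iff del: transpose_matrix_vector)
qed

end

section \<open>Fields derived from the metric: inverse, density, dual, and currents of forms of
  degree d - 1\<close>

locale spacetime = oriented_manifold \<A>
  for \<A> :: "('m::topological_space, 'd::{finite,linorder}) chart set" +
  fixes g :: "('m, 'd) metric_field"
  assumes metric: "lorentzian_metric \<A> g"
begin

lemma metricD:
  assumes "c \<in> \<A>"
  shows "q \<in> dom_ch c \<Longrightarrow> lorentzian (g c q)"
    and "chart_smooth c (dom_ch c) (\<lambda>q. g c q $ \<mu> $ \<nu>)"
    and "c' \<in> \<A> \<Longrightarrow> q \<in> dom_ch c \<Longrightarrow> q \<in> dom_ch c' \<Longrightarrow> g c q = pull_metric (jacobian c c' q) (g c' q)"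
  using metric assms unfolding lorentzian_metric_def smooth_in_chart_iff by blast+

lemma det_metric_neg: "c \<in> \<A> \<Longrightarrow> q \<in> dom_ch c \<Longrightarrow> det (g c q) < 0"
  using lorentzian_det_neg[OF metricD(1)] .

lemma sqrt_minus_det_metric_nz: "c \<in> \<A> \<Longrightarrow> q \<in> dom_ch c \<Longrightarrow> sqrt_minus_det (g c q) \<noteq> 0"
  using sqrt_minus_det_pos[OF metricD(1), of c q] by simp

lemma smooth_inverse_metric: "c \<in> \<A> \<Longrightarrow> chart_smooth c (dom_ch c) (\<lambda>q. matrix_inv (g c q) $ \<mu> $ \<nu>)"
  by (rule chart_smooth_matrix_inv[OF chart_dom metricD(2)]) (auto dest: det_metric_neg)

lemma smooth_sqrt_minus_det: "c \<in> \<A> \<Longrightarrow> chart_smooth c (dom_ch c) (\<lambda>q. sqrt_minus_det (g c q))"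
  unfolding sqrt_minus_det_def
  by (rule chart_smooth_sqrt[OF chart_dom chart_smooth_minus[OF chart_dom chart_smooth_det[OF chart_dom metricD(2)]]])
     (auto dest: det_metric_neg)

lemma covariant_field_hodge:
  assumes card: "CARD('d) = 2 * r" and F: "covariant_field \<A> r F"
  shows "covariant_field \<A> r (\<lambda>c q. hodge (g c q) r (F c q))"
proof (rule covariant_fieldI)
  fix c q assume c: "c \<in> \<A>"
  note F = covariant_fieldD[OF F c]
  show "tensor_of_rank r (hodge (g c q) r (F c q))" by simp
  have "chart_smooth c (dom_ch c) (\<lambda>q. hodge_upper (g c q) r (F c q) \<mu>)" for \<mu>
  proof (cases "length \<mu> = r")
    case True
    have "chart_smooth c (dom_ch c) (\<lambda>q. 1 / fact r *
        (\<Sum>\<nu> | length \<nu> = r. levi_civita (\<mu> @ \<nu>) / sqrt_minus_det (g c q) * F c q \<nu>))"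
      by (intro chart_smooth_mult chart_smooth_sum chart_smooth_divide chart_smooth_const smooth_sqrt_minus_det chart_dom c F)
         (rule sqrt_minus_det_metric_nz[OF c])
    with True show ?thesis by (simp add: hodge_upper_def)
  qed (simp add: hodge_upper_def chart_smooth_const chart_dom c)
  thus "chart_smooth c (dom_ch c) (\<lambda>q. hodge (g c q) r (F c q) \<mu>)" for \<mu>
    by (cases "length \<mu> = r")
       (simp_all add: hodge_def contract_all_def chart_smooth_sum chart_smooth_mult chart_smooth_prod chart_smooth_const
         chart_dom c metricD)
  show "hodge (g c q) r (F c q) = pull r (jacobian c c' q) (hodge (g c' q) r (F c' q))"
    if that: "c' \<in> \<A>" "q \<in> dom_ch c" "q \<in> dom_ch c'" for c'
    unfolding F(3)[OF that] metricD(3)[OF c that]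
    by (rule hodge_pull[OF card det_jacobian_pos[OF c that] metricD(1)[OF that(1,3)]])
qed

text \<open>The vector field dual to a form of degree d - 1. Its covariant divergence times sqrt(-g)
  is the exterior derivative of X paired with the symbol, so the metric drops out of the divergence
  computations.\<close>

definition current :: "('m, 'd) tensor_field \<Rightarrow> ('m, 'd) vector_field" where
  "current X c q = (\<chi> \<sigma>. (\<Sum>\<mu> | length \<mu> = CARD('d) - 1. levi_civita (\<sigma> # \<mu>) * X c q \<mu>) / sqrt_minus_det (g c q))"

text \<open>The one index pushed forward and the d - 1 indices pulled back put J on all indices of
  the symbol. The resulting det J is the factor by which sqrt(-g) changes.\<close>

lemma contravariant_vector_field_current:
  assumes X: "covariant_field \<A> (CARD('d) - 1) X"
  shows "contravariant_vector_field \<A> (current X)"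
  unfolding contravariant_vector_field_def smooth_in_chart_iff
proof (intro conjI ballI allI)
  fix c \<mu> assume c: "c \<in> \<A>"
  show "chart_smooth c (dom_ch c) (\<lambda>q. current X c q $ \<mu>)"
    unfolding current_def vec_lambda_beta
    by (intro chart_smooth_divide chart_smooth_sum chart_smooth_mult chart_smooth_const smooth_sqrt_minus_det chart_dom c
        covariant_fieldD[OF X])
       (rule sqrt_minus_det_metric_nz[OF c])
next
  fix c c' q assume c: "c \<in> \<A>" "c' \<in> \<A>" and "q \<in> dom_ch c \<inter> dom_ch c'"
  hence q: "q \<in> dom_ch c" "q \<in> dom_ch c'" by auto
  define J where "J = jacobian c c' q"
  have J: "det J > 0" using det_jacobian_pos[OF c q] by (simp add: J_def)
  have X': "X c q = contract_all (transpose J) (CARD('d) - 1) (X c' q)"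
    using covariant_fieldD(3)[OF X c q] by (simp add: J_def pull_def)
  have s: "sqrt_minus_det (g c q) = det J * sqrt_minus_det (g c' q)"
    using metricD(3)[OF c q] sqrt_minus_det_pull[OF J] by (simp add: J_def)
  have "(J *v current X c q) $ \<tau> = current X c' q $ \<tau>" for \<tau>
  proof -
    have "(J *v current X c q) $ \<tau> = contract_all J 1 (\<lambda>\<mu>'. \<Sum>\<rho> | length \<rho> = CARD('d) - 1.
        levi_civita (\<mu>' @ \<rho>) * contract_all (transpose J) (CARD('d) - 1) (X c' q) \<rho>) [\<tau>] / sqrt_minus_det (g c q)"
      by (simp add: current_def matrix_vector_mult_def contract_all_eq[of J] sum_lists_Suc X'
          sum_divide_distrib sum_distrib_left mult_ac)
    also have "\<dots> = det J * (\<Sum>\<rho> | length \<rho> = CARD('d) - 1. levi_civita ([\<tau>] @ \<rho>) * X c' q \<rho>) / sqrt_minus_det (g c q)"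
      by (subst contract_all_levi_civita) auto
    also have "\<dots> = current X c' q $ \<tau>"
      using J by (simp add: s current_def)
    finally show ?thesis .
  qed
  thus "current X c' q = jacobian c c' q *v current X c q" by (simp add: vec_eq_iff J_def)
qed

end


section \<open>Uniform first-order expansions\<close>

text \<open>The uniform quadratic remainder allows differentiation under the integral sign, and the
  continuity of \<open>f \<epsilon>\<close> makes the perturbed integrand integrable on compact sets.\<close>

definition first_order :: "'m::topological_space set \<Rightarrow> (real \<Rightarrow> 'm \<Rightarrow> real) \<Rightarrow> ('m \<Rightarrow> real) \<Rightarrow> bool" where
  "first_order K f f' \<longleftrightarrow> continuous_on K f' \<and> (\<exists>e>0. \<exists>M. \<forall>\<epsilon>. \<bar>\<epsilon>\<bar> < e \<longrightarrow>
     continuous_on K (f \<epsilon>) \<and> (\<forall>q\<in>K. \<bar>f \<epsilon> q - f 0 q - \<epsilon> * f' q\<bar> \<le> M * \<epsilon>\<^sup>2))"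

lemma first_orderE:
  assumes "first_order K f f'"
  obtains e M where "continuous_on K f'" "continuous_on K (f 0)" "e > 0" "M \<ge> 0"
    "\<And>\<epsilon>. \<bar>\<epsilon>\<bar> < e \<Longrightarrow> continuous_on K (f \<epsilon>)"
    "\<And>\<epsilon> q. \<bar>\<epsilon>\<bar> < e \<Longrightarrow> q \<in> K \<Longrightarrow> \<bar>f \<epsilon> q - f 0 q - \<epsilon> * f' q\<bar> \<le> M * \<epsilon>\<^sup>2"
proof -
  obtain e M where e: "e > 0" "continuous_on K f'" "\<And>\<epsilon>. \<bar>\<epsilon>\<bar> < e \<Longrightarrow> continuous_on K (f \<epsilon>)"
    and M: "\<And>\<epsilon> q. \<bar>\<epsilon>\<bar> < e \<Longrightarrow> q \<in> K \<Longrightarrow> \<bar>f \<epsilon> q - f 0 q - \<epsilon> * f' q\<bar> \<le> M * \<epsilon>\<^sup>2"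
    using assms unfolding first_order_def by blast
  have "\<bar>f \<epsilon> q - f 0 q - \<epsilon> * f' q\<bar> \<le> max M 0 * \<epsilon>\<^sup>2" if "\<bar>\<epsilon>\<bar> < e" "q \<in> K" for \<epsilon> q
    using M[OF that] mult_right_mono[of M "max M 0" "\<epsilon>\<^sup>2"] by simp
  with e e(3)[of 0] show ?thesis by (intro that[of e "max M 0"]) auto
qed

lemma first_order_const: "continuous_on K h \<Longrightarrow> first_order K (\<lambda>\<epsilon>. h) (\<lambda>q. 0)"
  unfolding first_order_def by (auto intro!: exI[of _ 1])

lemma first_order_affine:
  "continuous_on K a \<Longrightarrow> continuous_on K b \<Longrightarrow> first_order K (\<lambda>\<epsilon> q. a q + \<epsilon> * b q) b"
  unfolding first_order_def by (auto intro!: exI[of _ 1] continuous_intros)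

lemma first_order_cong:
  assumes "first_order K f f'" "\<And>\<epsilon> q. q \<in> K \<Longrightarrow> f \<epsilon> q = g \<epsilon> q" "\<And>q. q \<in> K \<Longrightarrow> f' q = g' q"
  shows "first_order K g g'"
proof -
  have "continuous_on K (g \<epsilon>) = continuous_on K (f \<epsilon>)" "continuous_on K g' = continuous_on K f'" for \<epsilon>
    by (intro continuous_on_cong refl; simp add: assms)+
  thus ?thesis using assms unfolding first_order_def by simp
qed

lemma first_order_add:
  assumes "first_order K f f'" "first_order K g g'"
  shows "first_order K (\<lambda>\<epsilon> q. f \<epsilon> q + g \<epsilon> q) (\<lambda>q. f' q + g' q)"
proof -
  obtain e1 M1 where 1: "continuous_on K f'" "e1 > 0" "\<And>\<epsilon>. \<bar>\<epsilon>\<bar> < e1 \<Longrightarrow> continuous_on K (f \<epsilon>)"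
    "\<And>\<epsilon> q. \<bar>\<epsilon>\<bar> < e1 \<Longrightarrow> q \<in> K \<Longrightarrow> \<bar>f \<epsilon> q - f 0 q - \<epsilon> * f' q\<bar> \<le> M1 * \<epsilon>\<^sup>2"
    using assms(1) by (rule first_orderE) blast
  obtain e2 M2 where 2: "continuous_on K g'" "e2 > 0" "\<And>\<epsilon>. \<bar>\<epsilon>\<bar> < e2 \<Longrightarrow> continuous_on K (g \<epsilon>)"
    "\<And>\<epsilon> q. \<bar>\<epsilon>\<bar> < e2 \<Longrightarrow> q \<in> K \<Longrightarrow> \<bar>g \<epsilon> q - g 0 q - \<epsilon> * g' q\<bar> \<le> M2 * \<epsilon>\<^sup>2"
    using assms(2) by (rule first_orderE) blast
  show ?thesis unfolding first_order_def
  proof (intro conjI exI allI impI ballI)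
    show "min e1 e2 > 0" using 1 2 by simp
    fix \<epsilon> assume e: "\<bar>\<epsilon>\<bar> < min e1 e2"
    show "continuous_on K (\<lambda>q. f \<epsilon> q + g \<epsilon> q)" using 1(3) 2(3) e by (intro continuous_on_add) auto
    fix q assume "q \<in> K"
    thus "\<bar>f \<epsilon> q + g \<epsilon> q - (f 0 q + g 0 q) - \<epsilon> * (f' q + g' q)\<bar> \<le> (M1 + M2) * \<epsilon>\<^sup>2"
      using 1(4)[of \<epsilon> q] 2(4)[of \<epsilon> q] e by (simp add: algebra_simps)
  qed (intro continuous_on_add 1 2)
qed

lemma continuous_on_compact_bounded:
  fixes f :: "'m::topological_space \<Rightarrow> real"
  assumes "compact K" "continuous_on K f"
  obtains B where "B \<ge> 0" "\<And>q. q \<in> K \<Longrightarrow> \<bar>f q\<bar> \<le> B"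
proof -
  have "bounded (f ` K)" using assms by (intro compact_imp_bounded compact_continuous_image)
  then obtain B where "B > 0" "\<And>q. q \<in> K \<Longrightarrow> \<bar>f q\<bar> \<le> B" unfolding bounded_pos by auto
  thus ?thesis using that[of B] by simp
qed

text \<open>On a compact set the zeroth and first order coefficients are bounded, so all mixed
  remainders are multiples of \<epsilon>^2.\<close>

lemma first_order_mult:
  assumes K: "compact K" and "first_order K f f'" "first_order K g g'"
  shows "first_order K (\<lambda>\<epsilon> q. f \<epsilon> q * g \<epsilon> q) (\<lambda>q. f' q * g 0 q + f 0 q * g' q)"
proof -
  obtain e1 M1 where 1: "continuous_on K f'" "continuous_on K (f 0)" "e1 > 0" "M1 \<ge> 0"
    "\<And>\<epsilon>. \<bar>\<epsilon>\<bar> < e1 \<Longrightarrow> continuous_on K (f \<epsilon>)"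
    "\<And>\<epsilon> q. \<bar>\<epsilon>\<bar> < e1 \<Longrightarrow> q \<in> K \<Longrightarrow> \<bar>f \<epsilon> q - f 0 q - \<epsilon> * f' q\<bar> \<le> M1 * \<epsilon>\<^sup>2"
    using assms(2) by (rule first_orderE) blast
  obtain e2 M2 where 2: "continuous_on K g'" "continuous_on K (g 0)" "e2 > 0" "M2 \<ge> 0"
    "\<And>\<epsilon>. \<bar>\<epsilon>\<bar> < e2 \<Longrightarrow> continuous_on K (g \<epsilon>)"
    "\<And>\<epsilon> q. \<bar>\<epsilon>\<bar> < e2 \<Longrightarrow> q \<in> K \<Longrightarrow> \<bar>g \<epsilon> q - g 0 q - \<epsilon> * g' q\<bar> \<le> M2 * \<epsilon>\<^sup>2"
    using assms(3) by (rule first_orderE) blast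
  obtain A where A: "A \<ge> 0" "\<And>q. q \<in> K \<Longrightarrow> \<bar>f 0 q\<bar> \<le> A" using continuous_on_compact_bounded[OF K 1(2)] by blast
  obtain A' where A': "A' \<ge> 0" "\<And>q. q \<in> K \<Longrightarrow> \<bar>f' q\<bar> \<le> A'" using continuous_on_compact_bounded[OF K 1(1)] by blast
  obtain B where B: "B \<ge> 0" "\<And>q. q \<in> K \<Longrightarrow> \<bar>g 0 q\<bar> \<le> B" using continuous_on_compact_bounded[OF K 2(2)] by blast
  obtain B' where B': "B' \<ge> 0" "\<And>q. q \<in> K \<Longrightarrow> \<bar>g' q\<bar> \<le> B'" using continuous_on_compact_bounded[OF K 2(1)] by blast
  show ?thesis unfolding first_order_def
  proof (intro conjI exI allI impI ballI)
    \<comment> \<open>With \<epsilon> at most 1 in absolute value, \<open>g \<epsilon>\<close> has a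
      bound that is independent of \<epsilon>.\<close>
    show "min 1 (min e1 e2) > 0" using 1 2 by simp
    fix \<epsilon> assume e: "\<bar>\<epsilon>\<bar> < min 1 (min e1 e2)"
    show "continuous_on K (\<lambda>q. f \<epsilon> q * g \<epsilon> q)" using 1(5) 2(5) e by (intro continuous_on_mult) auto
    fix q assume q: "q \<in> K"
    define r s where "r = f \<epsilon> q - f 0 q - \<epsilon> * f' q" and "s = g \<epsilon> q - g 0 q - \<epsilon> * g' q"
    have r: "\<bar>r\<bar> \<le> M1 * \<epsilon>\<^sup>2" and s: "\<bar>s\<bar> \<le> M2 * \<epsilon>\<^sup>2" using 1(6)[of \<epsilon> q] 2(6)[of \<epsilon> q] e q by (auto simp: r_def s_def)
    have e2: "\<epsilon>\<^sup>2 \<le> 1" using e abs_square_le_1[of \<epsilon>] by simp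
    have eA: "\<bar>\<epsilon> * f' q\<bar> \<le> A'" "\<bar>\<epsilon> * g' q\<bar> \<le> B'"
      using mult_mono[of "\<bar>\<epsilon>\<bar>" 1 "\<bar>f' q\<bar>" A'] mult_mono[of "\<bar>\<epsilon>\<bar>" 1 "\<bar>g' q\<bar>" B'] e A'(2)[OF q] B'(2)[OF q]
      by (auto simp: abs_mult)
    have "\<bar>s\<bar> \<le> M2" using s mult_left_mono[OF e2 2(4)] by simp
    hence G: "\<bar>g \<epsilon> q\<bar> \<le> B + B' + M2" using B(2)[OF q] eA by (simp add: s_def)
    have F: "\<bar>f 0 q + \<epsilon> * f' q\<bar> \<le> A + A'" using A(2)[OF q] eA by simp
    have "f \<epsilon> q * g \<epsilon> q - f 0 q * g 0 q - \<epsilon> * (f' q * g 0 q + f 0 q * g' q)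
        = r * g \<epsilon> q + (f 0 q + \<epsilon> * f' q) * s + (f' q * g' q) * \<epsilon>\<^sup>2"
      by (simp add: r_def s_def algebra_simps power2_eq_square)
    also have "\<bar>\<dots>\<bar> \<le> \<bar>r * g \<epsilon> q\<bar> + \<bar>(f 0 q + \<epsilon> * f' q) * s\<bar> + \<bar>(f' q * g' q) * \<epsilon>\<^sup>2\<bar>" by linarith
    also have "\<bar>r * g \<epsilon> q\<bar> \<le> (M1 * \<epsilon>\<^sup>2) * (B + B' + M2)"
      unfolding abs_mult using r G by (intro mult_mono) auto
    also have "\<bar>(f 0 q + \<epsilon> * f' q) * s\<bar> \<le> (A + A') * (M2 * \<epsilon>\<^sup>2)"
      unfolding abs_mult using s F by (intro mult_mono) auto
    also have "\<bar>(f' q * g' q) * \<epsilon>\<^sup>2\<bar> \<le> (A' * B') * \<epsilon>\<^sup>2"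
      unfolding abs_mult using A'(2)[OF q] B'(2)[OF q] A'(1) by (intro mult_mono) auto
    finally show "\<bar>f \<epsilon> q * g \<epsilon> q - f 0 q * g 0 q - \<epsilon> * (f' q * g 0 q + f 0 q * g' q)\<bar>
        \<le> (M1 * (B + B' + M2) + (A + A') * M2 + A' * B') * \<epsilon>\<^sup>2"
      by (simp add: algebra_simps)
  qed (intro continuous_on_add continuous_on_mult 1 2)
qed

lemma first_order_cmult:
  assumes "first_order K f f'"
  shows "first_order K (\<lambda>\<epsilon> q. k * f \<epsilon> q) (\<lambda>q. k * f' q)"
proof -
  obtain e M where 1: "continuous_on K f'" "e > 0" "\<And>\<epsilon>. \<bar>\<epsilon>\<bar> < e \<Longrightarrow> continuous_on K (f \<epsilon>)"
    "\<And>\<epsilon> q. \<bar>\<epsilon>\<bar> < e \<Longrightarrow> q \<in> K \<Longrightarrow> \<bar>f \<epsilon> q - f 0 q - \<epsilon> * f' q\<bar> \<le> M * \<epsilon>\<^sup>2"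
    using assms by (rule first_orderE) blast
  show ?thesis unfolding first_order_def
  proof (intro conjI exI allI impI ballI)
    fix \<epsilon> q assume "\<bar>\<epsilon>\<bar> < e" "q \<in> K"
    hence "\<bar>k\<bar> * \<bar>f \<epsilon> q - f 0 q - \<epsilon> * f' q\<bar> \<le> \<bar>k\<bar> * (M * \<epsilon>\<^sup>2)" using 1(4) by (intro mult_left_mono) auto
    thus "\<bar>k * f \<epsilon> q - k * f 0 q - \<epsilon> * (k * f' q)\<bar> \<le> (\<bar>k\<bar> * M) * \<epsilon>\<^sup>2"
      by (simp add: abs_mult[symmetric] algebra_simps)
  qed (auto intro!: continuous_on_mult continuous_on_const 1)
qed

lemma first_order_sum:
  "(\<And>i. i \<in> I \<Longrightarrow> first_order K (f i) (f' i)) \<Longrightarrow> first_order K (\<lambda>\<epsilon> q. \<Sum>i\<in>I. f i \<epsilon> q) (\<lambda>q. \<Sum>i\<in>I. f' i q)"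
  by (induction I rule: infinite_finite_induct) (auto intro: first_order_add first_order_const)

text \<open>The first-order Taylor formula with explicit remainder. In the roots s and s0 the
  remainder is (y - y0)^2 times a rational function, which y \<ge> m/2 and y0 \<ge> m bound.\<close>

lemma inverse_sqrt_expansion:
  fixes y y0 :: real
  assumes "m > 0" "y0 \<ge> m" "y \<ge> m / 2"
  shows "\<bar>1 / sqrt y - 1 / sqrt y0 + (y - y0) / (2 * y0 * sqrt y0)\<bar> \<le> (y - y0)\<^sup>2 / (sqrt (m/2) * m\<^sup>2)"
proof -
  define s s0 where "s = sqrt y" and "s0 = sqrt y0"
  have pos: "s > 0" "s0 > 0" and y: "y = s\<^sup>2" "y0 = s0\<^sup>2" using assms by (auto simp: s_def s0_def)
  have "1 / s - 1 / s0 + (s\<^sup>2 - s0\<^sup>2) / (2 * s0\<^sup>2 * s0) = (s - s0)\<^sup>2 * (s + 2 * s0) / (2 * s * s0 ^ 3)"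
    using pos by (simp add: divide_simps) algebra
  also have "\<dots> = (s\<^sup>2 - s0\<^sup>2)\<^sup>2 * ((s + 2 * s0) / ((s + s0)\<^sup>2 * (2 * s * s0 ^ 3)))"
  proof -
    have "(s\<^sup>2 - s0\<^sup>2)\<^sup>2 = (s - s0)\<^sup>2 * (s + s0)\<^sup>2" by algebra
    thus ?thesis using pos by (simp add: divide_simps)
  qed
  finally have eq: "1 / s - 1 / s0 + (s\<^sup>2 - s0\<^sup>2) / (2 * s0\<^sup>2 * s0)
      = (s\<^sup>2 - s0\<^sup>2)\<^sup>2 * ((s + 2 * s0) / ((s + s0)\<^sup>2 * (2 * s * s0 ^ 3)))" .
  have "(s + 2 * s0) / ((s + s0)\<^sup>2 * (2 * s * s0 ^ 3)) \<le> 1 / (s * s0 ^ 4)"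
  proof -
    have "(s + 2 * s0) * (s * s0 ^ 4) \<le> (s + s0)\<^sup>2 * (2 * s * s0 ^ 3)"
    proof -
      have "(s + 2 * s0) * s0 \<le> 2 * (s + s0)\<^sup>2" using pos by (simp add: power2_eq_square algebra_simps)
      hence "((s + 2 * s0) * s0) * (s * s0 ^ 3) \<le> (2 * (s + s0)\<^sup>2) * (s * s0 ^ 3)"
        using pos by (intro mult_right_mono) auto
      thus ?thesis by (simp add: algebra_simps power_numeral_reduce)
    qed
    thus ?thesis using pos by (simp add: divide_simps)
  qed
  also have "\<dots> \<le> 1 / (sqrt (m/2) * m\<^sup>2)"
  proof -
    have "sqrt (m/2) \<le> s" using assms by (simp add: s_def)
    moreover have "m\<^sup>2 \<le> s0 ^ 4" using assms power_mono[of m y0 2] by (simp add: y flip: power_mult)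
    ultimately show ?thesis using assms(1) pos by (intro divide_left_mono mult_mono) auto
  qed
  finally have "(s\<^sup>2 - s0\<^sup>2)\<^sup>2 * ((s + 2 * s0) / ((s + s0)\<^sup>2 * (2 * s * s0 ^ 3)))
      \<le> (s\<^sup>2 - s0\<^sup>2)\<^sup>2 * (1 / (sqrt (m/2) * m\<^sup>2))" by (rule mult_left_mono) simp
  moreover have "0 \<le> (s\<^sup>2 - s0\<^sup>2)\<^sup>2 * ((s + 2 * s0) / ((s + s0)\<^sup>2 * (2 * s * s0 ^ 3)))" using pos by simp
  ultimately show ?thesis unfolding s_def[symmetric] s0_def[symmetric] unfolding y eq by simp
qed

text \<open>On a nonempty compact set \<open>f 0\<close> attains a positive minimum m, and for small
  \<epsilon> all values of \<open>f \<epsilon>\<close> stay above m/2, where the expansion of the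
  inverse root has a uniform remainder.\<close>

lemma first_order_inverse_sqrt:
  assumes K: "compact K" and f: "first_order K f f'" and pos: "\<And>q. q \<in> K \<Longrightarrow> f 0 q > 0"
  shows "first_order K (\<lambda>\<epsilon> q. 1 / sqrt (f \<epsilon> q)) (\<lambda>q. - f' q / (2 * f 0 q * sqrt (f 0 q)))"
proof (cases "K = {}")
  case False
  obtain e M where 1: "continuous_on K f'" "continuous_on K (f 0)" "e > 0" "M \<ge> 0"
    "\<And>\<epsilon>. \<bar>\<epsilon>\<bar> < e \<Longrightarrow> continuous_on K (f \<epsilon>)"
    "\<And>\<epsilon> q. \<bar>\<epsilon>\<bar> < e \<Longrightarrow> q \<in> K \<Longrightarrow> \<bar>f \<epsilon> q - f 0 q - \<epsilon> * f' q\<bar> \<le> M * \<epsilon>\<^sup>2"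
    using f by (rule first_orderE) blast
  obtain A' where A': "A' \<ge> 0" "\<And>q. q \<in> K \<Longrightarrow> \<bar>f' q\<bar> \<le> A'" using continuous_on_compact_bounded[OF K 1(1)] by blast
  obtain q0 where "q0 \<in> K" "\<And>q. q \<in> K \<Longrightarrow> f 0 q0 \<le> f 0 q" using continuous_attains_inf[OF K False 1(2)] by blast
  then obtain m where m: "m > 0" "\<And>q. q \<in> K \<Longrightarrow> m \<le> f 0 q" using pos by blast
  \<comment> \<open>A Lipschitz constant in \<epsilon>: \<open>A'\<close> bounds the linear term,
    and M \<epsilon>^2 is at most M times the absolute value of \<epsilon> once the latter is below
    1. The summand 1 makes division by C possible, and the radius m / (2 C) below then keeps the
    change under m/2.\<close>
  define C where "C = A' + M + 1"
  have C: "C > 0" using A' 1 by (simp add: C_def)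
  define e' where "e' = min (min 1 e) (m / (2 * C))"
  have near: "\<bar>f \<epsilon> q - f 0 q\<bar> \<le> C * \<bar>\<epsilon>\<bar>" "f \<epsilon> q \<ge> m / 2" if e: "\<bar>\<epsilon>\<bar> < e'" and q: "q \<in> K" for \<epsilon> q
  proof -
    have "\<bar>f \<epsilon> q - f 0 q - \<epsilon> * f' q\<bar> \<le> M * \<epsilon>\<^sup>2" using 1(6)[OF _ q, of \<epsilon>] e by (simp add: e'_def)
    also have "M * \<epsilon>\<^sup>2 \<le> M * \<bar>\<epsilon>\<bar>"
      using e 1(4) power_decreasing[of 1 2 "\<bar>\<epsilon>\<bar>"] by (intro mult_left_mono) (auto simp: e'_def)
    finally have "\<bar>f \<epsilon> q - f 0 q\<bar> \<le> M * \<bar>\<epsilon>\<bar> + \<bar>\<epsilon> * f' q\<bar>" by linarith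
    also have "\<bar>\<epsilon> * f' q\<bar> \<le> A' * \<bar>\<epsilon>\<bar>" using mult_right_mono[OF A'(2)[OF q], of "\<bar>\<epsilon>\<bar>"] by (simp add: abs_mult mult.commute)
    finally show *: "\<bar>f \<epsilon> q - f 0 q\<bar> \<le> C * \<bar>\<epsilon>\<bar>" by (simp add: C_def algebra_simps)
    have "C * \<bar>\<epsilon>\<bar> \<le> m / 2" using e C by (simp add: e'_def field_simps)
    thus "f \<epsilon> q \<ge> m / 2" using * m(2)[OF q] by linarith
  qed
  have e': "e' > 0" using 1 m C by (simp add: e'_def)
  show ?thesis unfolding first_order_def
  proof (intro conjI exI allI impI ballI)
    show "continuous_on K (\<lambda>q. - f' q / (2 * f 0 q * sqrt (f 0 q)))"
      using pos by (intro continuous_intros 1) (auto dest: pos)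
    show "e' > 0" by (fact e')
    fix \<epsilon> assume e: "\<bar>\<epsilon>\<bar> < e'"
    have "continuous_on K (f \<epsilon>)" using 1(5) e by (simp add: e'_def)
    thus "continuous_on K (\<lambda>q. 1 / sqrt (f \<epsilon> q))"
      using near(2)[OF e] m(1) by (intro continuous_intros) force+
    fix q assume q: "q \<in> K"
    let ?D = "1 / (sqrt (m/2) * m\<^sup>2)" and ?y = "f \<epsilon> q" and ?z = "f 0 q"
    have "\<bar>1 / sqrt ?y - 1 / sqrt ?z + (?y - ?z) / (2 * ?z * sqrt ?z)\<bar> \<le> (?y - ?z)\<^sup>2 / (sqrt (m/2) * m\<^sup>2)"
      by (rule inverse_sqrt_expansion[OF m(1) m(2)[OF q] near(2)[OF e q]])
    also have "\<dots> \<le> (C * \<bar>\<epsilon>\<bar>)\<^sup>2 / (sqrt (m/2) * m\<^sup>2)"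
      using power_mono[OF near(1)[OF e q], of 2] m(1) by (intro divide_right_mono) auto
    finally have I: "\<bar>1 / sqrt ?y - 1 / sqrt ?z + (?y - ?z) / (2 * ?z * sqrt ?z)\<bar> \<le> C\<^sup>2 * ?D * \<epsilon>\<^sup>2"
      by (simp add: power_mult_distrib)
    have "\<bar>(?y - ?z - \<epsilon> * f' q) / (2 * ?z * sqrt ?z)\<bar> \<le> (M * \<epsilon>\<^sup>2) / (2 * m * sqrt m)"
      unfolding abs_divide
      using 1(6)[OF _ q, of \<epsilon>] e m(1) m(2)[OF q] 1(4)
      by (intro frac_le) (auto simp: e'_def abs_mult intro!: mult_mono)
    hence II: "\<bar>(?y - ?z - \<epsilon> * f' q) / (2 * ?z * sqrt ?z)\<bar> \<le> M / (2 * m * sqrt m) * \<epsilon>\<^sup>2" by simp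
    have "1 / sqrt ?y - 1 / sqrt ?z - \<epsilon> * (- f' q / (2 * ?z * sqrt ?z))
        = (1 / sqrt ?y - 1 / sqrt ?z + (?y - ?z) / (2 * ?z * sqrt ?z)) - (?y - ?z - \<epsilon> * f' q) / (2 * ?z * sqrt ?z)"
      by (simp add: diff_divide_distrib)
    thus "\<bar>1 / sqrt ?y - 1 / sqrt ?z - \<epsilon> * (- f' q / (2 * ?z * sqrt ?z))\<bar>
        \<le> (C\<^sup>2 * ?D + M / (2 * m * sqrt m)) * \<epsilon>\<^sup>2"
      using I II unfolding distrib_right by linarith
  qed
qed (auto simp: first_order_def intro: exI[of _ 1])

lemma first_order_empty: "first_order {} f f'"
  by (auto simp: first_order_def intro: exI[of _ 1])

text \<open>Closedness of both pieces allows the two continuity statements to be glued. Compact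
  pieces in different charts are joined in this way.\<close>

lemma first_order_Un:
  assumes "closed K" "closed L" "first_order K f f'" "first_order L f f'"
  shows "first_order (K \<union> L) f f'"
proof -
  obtain e1 M1 where 1: "continuous_on K f'" "e1 > 0" "M1 \<ge> 0" "\<And>\<epsilon>. \<bar>\<epsilon>\<bar> < e1 \<Longrightarrow> continuous_on K (f \<epsilon>)"
    "\<And>\<epsilon> q. \<bar>\<epsilon>\<bar> < e1 \<Longrightarrow> q \<in> K \<Longrightarrow> \<bar>f \<epsilon> q - f 0 q - \<epsilon> * f' q\<bar> \<le> M1 * \<epsilon>\<^sup>2"
    using assms(3) by (rule first_orderE) blast
  obtain e2 M2 where 2: "continuous_on L f'" "e2 > 0" "M2 \<ge> 0" "\<And>\<epsilon>. \<bar>\<epsilon>\<bar> < e2 \<Longrightarrow> continuous_on L (f \<epsilon>)"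
    "\<And>\<epsilon> q. \<bar>\<epsilon>\<bar> < e2 \<Longrightarrow> q \<in> L \<Longrightarrow> \<bar>f \<epsilon> q - f 0 q - \<epsilon> * f' q\<bar> \<le> M2 * \<epsilon>\<^sup>2"
    using assms(4) by (rule first_orderE) blast
  show ?thesis unfolding first_order_def
  proof (intro conjI exI allI impI ballI)
    show "continuous_on (K \<union> L) f'" by (intro continuous_on_closed_Un assms 1 2)
    show "min e1 e2 > 0" using 1 2 by simp
    fix \<epsilon> assume e: "\<bar>\<epsilon>\<bar> < min e1 e2"
    show "continuous_on (K \<union> L) (f \<epsilon>)" using e by (intro continuous_on_closed_Un assms 1 2) auto
    fix q assume "q \<in> K \<union> L"
    hence "\<bar>f \<epsilon> q - f 0 q - \<epsilon> * f' q\<bar> \<le> M1 * \<epsilon>\<^sup>2 \<or> \<bar>f \<epsilon> q - f 0 q - \<epsilon> * f' q\<bar> \<le> M2 * \<epsilon>\<^sup>2"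
      using 1(5) 2(5) e by auto
    moreover have "0 \<le> M1 * \<epsilon>\<^sup>2" "0 \<le> M2 * \<epsilon>\<^sup>2" using 1(3) 2(3) by auto
    ultimately show "\<bar>f \<epsilon> q - f 0 q - \<epsilon> * f' q\<bar> \<le> (M1 + M2) * \<epsilon>\<^sup>2" by (auto simp: distrib_right)
  qed
qed

lemma first_order_Union:
  assumes "finite F" "\<And>K. K \<in> F \<Longrightarrow> closed K \<and> first_order K f f'"
  shows "first_order (\<Union>F) f f'"
  using assms
proof (induction F rule: finite_induct)
  case (insert K F)
  thus ?case using first_order_Un[of K "\<Union>F" f f'] by (simp add: closed_Union)
qed (simp add: first_order_empty)

lemma first_order_imp_DERIV:
  assumes "first_order K f f'" "q \<in> K"
  shows "((\<lambda>\<epsilon>. f \<epsilon> q) has_real_derivative f' q) (at 0)"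
proof -
  obtain e M where 1: "e > 0" "M \<ge> 0"
    "\<And>\<epsilon>. \<bar>\<epsilon>\<bar> < e \<Longrightarrow> \<bar>f \<epsilon> q - f 0 q - \<epsilon> * f' q\<bar> \<le> M * \<epsilon>\<^sup>2"
    using assms(1) by (rule first_orderE) (use assms(2) in blast)
  have "((\<lambda>h. (f (0 + h) q - f 0 q) / h - f' q) \<longlongrightarrow> 0) (at 0)"
  proof (rule Lim_null_comparison)
    show "\<forall>\<^sub>F h in at 0. norm ((f (0 + h) q - f 0 q) / h - f' q) \<le> M * \<bar>h\<bar>"
      unfolding eventually_at
    proof (intro exI[of _ e] conjI ballI impI, fact)
      fix h :: real assume h: "h \<noteq> 0 \<and> dist h 0 < e"
      have "norm ((f (0 + h) q - f 0 q) / h - f' q) = \<bar>f h q - f 0 q - h * f' q\<bar> / \<bar>h\<bar>"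
        using h by (simp add: diff_divide_distrib flip: abs_divide)
      also have "\<dots> \<le> M * h\<^sup>2 / \<bar>h\<bar>" using 1(3)[of h] h by (intro divide_right_mono) auto
      also have "\<dots> = M * \<bar>h\<bar>" using h by (simp add: power2_eq_square abs_if)
      finally show "norm ((f (0 + h) q - f 0 q) / h - f' q) \<le> M * \<bar>h\<bar>" .
    qed
    show "((\<lambda>h. M * \<bar>h\<bar>) \<longlongrightarrow> 0) (at 0)" by (auto intro!: tendsto_eq_intros)
  qed
  thus ?thesis unfolding DERIV_def by (simp add: LIM_zero_iff)
qed


section \<open>Differentiating the action\<close>

lemma set_integrable_continuous_on:
  fixes f :: "'m::t2_space \<Rightarrow> real"
  assumes "sets vol = sets borel" "compact C" "emeasure vol C < \<infinity>" "continuous_on C f"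
  shows "set_integrable vol C f"
proof -
  have C: "C \<in> sets borel" using compact_imp_closed[OF assms(2)] by simp
  obtain B where B: "\<And>q. q \<in> C \<Longrightarrow> \<bar>f q\<bar> \<le> B" using continuous_on_compact_bounded[OF assms(2,4)] by blast
  have "(\<lambda>q. indicator C q *\<^sub>R f q) \<in> borel_measurable vol"
  proof -
    have "borel_measurable vol = (borel_measurable borel :: ('m \<Rightarrow> real) set)"
      by (rule measurable_cong_sets) (simp_all add: assms(1))
    thus ?thesis using borel_measurable_continuous_on_indicator[OF C assms(4)] by simp
  qed
  hence "integrable vol (\<lambda>q. indicator C q *\<^sub>R (indicator C q *\<^sub>R f q))"
    using C assms(1,3) B by (intro integrableI_bounded_set_indicator[where B = B]) (auto simp: indicator_def)
  moreover have "(\<lambda>q. indicator C q *\<^sub>R (indicator C q *\<^sub>R f q)) = (\<lambda>q. indicator C q *\<^sub>R f q)"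
    by (auto simp: indicator_def)
  ultimately show ?thesis by (simp only: set_integrable_def)
qed

text \<open>The merely integrable \<open>L0\<close>, which carries the arbitrary function
  \<open>V\<close>, contributes a constant. The continuous part \<open>h\<close> is expanded under
  the integral, with error at most M vol(C) \<epsilon>^2.\<close>

lemma set_integral_first_order:
  fixes L0 :: "'m::t2_space \<Rightarrow> real"
  assumes vol: "sets vol = sets borel" "compact C" "emeasure vol C < \<infinity>"
    and L0: "set_integrable vol C L0" and h: "first_order C h h'" "\<And>q. q \<in> C \<Longrightarrow> h 0 q = 0"
    and L: "\<And>\<epsilon> q. q \<in> C \<Longrightarrow> L \<epsilon> q = L0 q + h \<epsilon> q"
  shows "((\<lambda>\<epsilon>. LINT q:C|vol. L \<epsilon> q) has_real_derivative (LINT q:C|vol. h' q)) (at 0)"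
proof -
  obtain e M where 1: "continuous_on C h'" "e > 0" "M \<ge> 0" "\<And>\<epsilon>. \<bar>\<epsilon>\<bar> < e \<Longrightarrow> continuous_on C (h \<epsilon>)"
    "\<And>\<epsilon> q. \<bar>\<epsilon>\<bar> < e \<Longrightarrow> q \<in> C \<Longrightarrow> \<bar>h \<epsilon> q - h 0 q - \<epsilon> * h' q\<bar> \<le> M * \<epsilon>\<^sup>2"
    using h(1) by (rule first_orderE) blast
  note int = set_integrable_continuous_on[OF vol]
  have C: "C \<in> sets vol" using compact_imp_closed[OF vol(2)] vol(1) by simp
  have split: "(LINT q:C|vol. L \<epsilon> q) = (LINT q:C|vol. L0 q) + (LINT q:C|vol. h \<epsilon> q)" if "\<bar>\<epsilon>\<bar> < e" for \<epsilon>
  proof -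
    have "(LINT q:C|vol. L \<epsilon> q) = (LINT q:C|vol. L0 q + h \<epsilon> q)"
      by (rule set_lebesgue_integral_cong[OF C]) (simp add: L)
    also have "\<dots> = (LINT q:C|vol. L0 q) + (LINT q:C|vol. h \<epsilon> q)"
      by (rule set_integral_add(2)[OF L0 int[OF 1(4)[OF that]]])
    finally show ?thesis .
  qed
  have bound: "\<bar>(LINT q:C|vol. h \<epsilon> q) - \<epsilon> * (LINT q:C|vol. h' q)\<bar> \<le> (M * measure vol C) * \<epsilon>\<^sup>2" if e: "\<bar>\<epsilon>\<bar> < e" for \<epsilon>
  proof -
    have i1: "set_integrable vol C (h \<epsilon>)" "set_integrable vol C (\<lambda>q. \<epsilon> * h' q)"
      using 1(1) 1(4)[OF e] by (auto intro!: int continuous_on_mult continuous_on_const)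
    have "(LINT q:C|vol. h \<epsilon> q) - \<epsilon> * (LINT q:C|vol. h' q) = (LINT q:C|vol. h \<epsilon> q - \<epsilon> * h' q)"
      using set_integral_diff(2)[OF i1] by simp
    also have "\<bar>\<dots>\<bar> \<le> (LINT q:C|vol. \<bar>h \<epsilon> q - \<epsilon> * h' q\<bar>)"
      using set_integral_norm_bound[OF set_integral_diff(1)[OF i1]] by simp
    also have "\<dots> \<le> (LINT q:C|vol. M * \<epsilon>\<^sup>2)"
    proof (rule set_integral_mono)
      show "set_integrable vol C (\<lambda>q. \<bar>h \<epsilon> q - \<epsilon> * h' q\<bar>)"
        using 1(1) 1(4)[OF e] by (auto intro!: int continuous_intros)
      show "set_integrable vol C (\<lambda>q. M * \<epsilon>\<^sup>2)" by (intro int continuous_on_const)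
      show "\<bar>h \<epsilon> q - \<epsilon> * h' q\<bar> \<le> M * \<epsilon>\<^sup>2" if "q \<in> C" for q
        using 1(5)[OF e that] h(2)[OF that] by simp
    qed
    also have "\<dots> = (M * measure vol C) * \<epsilon>\<^sup>2"
      using C vol(3) by (simp add: set_integral_const)
    finally show ?thesis .
  qed
  have at0: "(LINT q:C|vol. h 0 q) = 0"
    using bound[of 0] 1(2) by simp
  \<comment> \<open>Over a one-point space \<open>first_order\<close> is a statement about a
    function of \<epsilon> alone, so the passage from a quadratic remainder to a derivative can be
    reused.\<close>
  have "first_order {0::real} (\<lambda>\<epsilon> _. LINT q:C|vol. L \<epsilon> q) (\<lambda>_. LINT q:C|vol. h' q)"
    unfolding first_order_def
  proof (intro conjI exI allI impI ballI)
    show "e > 0" by (fact 1)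
    fix \<epsilon> assume e: "\<bar>\<epsilon>\<bar> < e"
    show "\<bar>(LINT q:C|vol. L \<epsilon> q) - (LINT q:C|vol. L 0 q) - \<epsilon> * (LINT q:C|vol. h' q)\<bar> \<le> (M * measure vol C) * \<epsilon>\<^sup>2"
      using bound[OF e] 1(2) by (simp add: split e at0)
  qed (auto intro: continuous_on_const)
  from first_order_imp_DERIV[OF this, of 0] show ?thesis by simp
qed

text \<open>Coordinate balls give every point a compact neighbourhood inside a chart; finitely many
  of these cover C. As the space is Hausdorff, they are closed and their intersections with C are
  compact.\<close>

lemma compact_chart_cover:
  fixes \<A> :: "('m::t2_space, 'd::finite) chart set"
  assumes \<A>: "oriented_atlas \<A>" and C: "compact C"
  obtains F where "finite F" "\<Union>F = C" "\<And>K. K \<in> F \<Longrightarrow> compact K \<and> (\<exists>c\<in>\<A>. K \<subseteq> dom_ch c)"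
proof -
  have "\<exists>N P. compact N \<and> open P \<and> q \<in> P \<and> P \<subseteq> N \<and> (\<exists>c\<in>\<A>. N \<subseteq> dom_ch c)" for q
  proof -
    obtain c where c: "c \<in> \<A>" "q \<in> dom_ch c" using \<A> unfolding oriented_atlas_def by blast
    have ch: "is_chart c" using \<A> c by (simp add: oriented_atlas_def)
    have hom: "homeomorphism (dom_ch c) (coord_range c) (coord c) (coord_inv c)"
      and op: "open (dom_ch c)" "open (coord_range c)" using ch by (auto simp: is_chart_def)
    obtain r where r: "r > 0" "cball (coord c q) r \<subseteq> coord_range c"
      using op(2) coord_in_range[OF ch c(2)] open_contains_cball by blast
    let ?N = "coord_inv c ` cball (coord c q) r" and ?P = "coord_inv c ` ball (coord c q) r"
    have cont: "continuous_on (coord_range c) (coord_inv c)" using hom by (simp add: homeomorphism_def)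
    have "compact ?N"
      by (rule compact_continuous_image[OF continuous_on_subset[OF cont r(2)] compact_cball])
    moreover have "open ?P"
    proof -
      have "ball (coord c q) r \<subseteq> coord_range c" using r(2) ball_subset_cball by blast
      hence "openin (top_of_set (dom_ch c)) ?P"
        using homeomorphism_imp_open_map[OF homeomorphism_symD[OF hom]] op(2)
        by (simp add: openin_open_eq)
      thus ?thesis using op(1) openin_open_eq by blast
    qed
    moreover have "q \<in> ?P" using coord_inv_coord[OF ch c(2)] r(1) by (intro image_eqI[of _ _ "coord c q"]) auto
    moreover have "?P \<subseteq> ?N" by (intro image_mono ball_subset_cball)
    moreover have "?N \<subseteq> dom_ch c" using r(2) coord_inv_in_dom[OF ch] by blast
    ultimately show ?thesis using c(1) by blast
  qed
  then obtain N P where NP: "\<And>q. compact (N q) \<and> open (P q) \<and> q \<in> P q \<and> P q \<subseteq> N q \<and> (\<exists>c\<in>\<A>. N q \<subseteq> dom_ch c)"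
    by metis
  obtain D where D: "D \<subseteq> C" "finite D" "C \<subseteq> (\<Union>q\<in>D. P q)"
    using compactE_image[OF C, of C P] NP by blast
  show ?thesis
  proof (rule that[of "(\<lambda>q. C \<inter> N q) ` D"])
    show "\<Union> ((\<lambda>q. C \<inter> N q) ` D) = C"
    proof (intro equalityI subsetI)
      fix x assume x: "x \<in> C"
      then obtain q where "q \<in> D" "x \<in> P q" using D(3) by blast
      thus "x \<in> \<Union> ((\<lambda>q. C \<inter> N q) ` D)" using NP[of q] x by blast
    qed blast
    fix K assume "K \<in> (\<lambda>q. C \<inter> N q) ` D"
    then obtain q where q: "K = C \<inter> N q" by blast
    have "compact K" unfolding q using NP C by (intro compact_Int_closed compact_imp_closed) auto
    thus "compact K \<and> (\<exists>c\<in>\<A>. K \<subseteq> dom_ch c)" using NP[of q] q by blast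
  qed (use D in simp)
qed

text \<open>In coordinates the volume is the Lebesgue integral of a density that is bounded on the
  compact image of K.\<close>

lemma (in spacetime) volume_chart_compact_finite:
  assumes vol: "volume_measure \<A> g vol" and c: "c \<in> \<A>" and K: "compact K" "K \<subseteq> dom_ch c" "K \<in> sets borel"
  shows "emeasure vol K < \<infinity>"
proof -
  have cont: "continuous_on (dom_ch c) (coord c)"
    using chart[OF c] by (simp add: is_chart_def homeomorphism_def)
  have cK: "compact (coord c ` K)"
    by (rule compact_continuous_image[OF continuous_on_subset[OF cont K(2)] K(1)])
  have "continuous_on K (\<lambda>q. sqrt_minus_det (g c q))"
    by (rule continuous_on_subset[OF chart_smooth_continuous[OF chart_dom smooth_sqrt_minus_det] K(2)]) (fact c)+
  then obtain B where B: "B \<ge> 0" "\<And>q. q \<in> K \<Longrightarrow> \<bar>sqrt_minus_det (g c q)\<bar> \<le> B"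
    using continuous_on_compact_bounded[OF K(1)] by blast
  have "emeasure vol K = (\<integral>\<^sup>+x\<in>coord c ` K. ennreal (sqrt_minus_det (g c (coord_inv c x))) \<partial>lborel)"
    using vol c K unfolding volume_measure_def by blast
  also have "\<dots> \<le> (\<integral>\<^sup>+x. ennreal B * indicator (coord c ` K) x \<partial>lborel)"
  proof (rule nn_integral_mono)
    fix x :: "'d coords"
    show "ennreal (sqrt_minus_det (g c (coord_inv c x))) * indicator (coord c ` K) x \<le> ennreal B * indicator (coord c ` K) x"
    proof (cases "x \<in> coord c ` K")
      case True
      then obtain q where q: "q \<in> K" "x = coord c q" by blast
      have "coord_inv c x = q" using coord_inv_coord[OF chart[OF c], of q] q K(2) by blast
      thus ?thesis using B(2)[OF q(1)] True by (auto intro: ennreal_leI)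
    qed simp
  qed
  also have "\<dots> = ennreal B * emeasure lborel (coord c ` K)"
    using compact_imp_closed[OF cK] by (subst nn_integral_cmult_indicator) auto
  also have "\<dots> < \<infinity>"
    using emeasure_compact_finite[OF cK] by (simp add: ennreal_mult_less_top)
  finally show ?thesis .
qed

lemma volume_compact_finite:
  fixes \<A> :: "('m::t2_space, 'd::{finite,linorder}) chart set"
  assumes \<A>: "oriented_atlas \<A>" "lorentzian_metric \<A> g" and vol: "volume_measure \<A> g vol" and C: "compact C"
  shows "emeasure vol C < \<infinity>"
proof -
  interpret spacetime \<A> g using \<A> by unfold_locales
  obtain F where F: "finite F" "\<Union>F = C" "\<And>K. K \<in> F \<Longrightarrow> compact K \<and> (\<exists>c\<in>\<A>. K \<subseteq> dom_ch c)"
    using compact_chart_cover[OF \<A>(1) C] by blast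
  have sets: "sets vol = sets borel" using vol by (simp add: volume_measure_def)
  have meas: "K \<in> sets borel" if "K \<in> F" for K
    using compact_imp_closed[of K] F(3)[OF that] borel_closed by blast
  have "emeasure vol C \<le> (\<Sum>K\<in>F. emeasure vol K)"
    using emeasure_subadditive_finite[OF F(1), of "\<lambda>K. K" vol] meas F(2) sets by auto
  also have "\<dots> < \<infinity>"
    using F(1,3) meas volume_chart_compact_finite[OF vol] by (force simp: less_top)
  finally show ?thesis .
qed


section \<open>Divergences of exterior products\<close>

lemma sum_sum_antisymmetric_eq_0:
  fixes f :: "'a \<Rightarrow> 'a \<Rightarrow> real"
  assumes "\<And>i j. f i j = - f j i"
  shows "(\<Sum>i\<in>I. \<Sum>j\<in>I. f i j) = 0"
proof -
  have "(\<Sum>i\<in>I. \<Sum>j\<in>I. f i j) = (\<Sum>j\<in>I. \<Sum>i\<in>I. f i j)" by (rule sum.swap)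
  also have "\<dots> = - (\<Sum>j\<in>I. \<Sum>i\<in>I. f j i)" unfolding sum_negf[symmetric] by (intro sum.cong refl assms)
  finally show ?thesis by simp
qed

text \<open>For \<open>f\<close> a product this is \<open>X \<and> u \<and> w \<and> Y\<close>; general \<open>f\<close> is needed because one of the
  factors may be a derivative carrying two of the indices.\<close>

definition wedge4 :: "nat \<Rightarrow> ('d::{finite,linorder} list \<Rightarrow> 'd \<Rightarrow> 'd \<Rightarrow> 'd list \<Rightarrow> real) \<Rightarrow> real" where
  "wedge4 p f = (\<Sum>\<mu> | length \<mu> = p. \<Sum>\<rho>\<in>UNIV. \<Sum>\<sigma>\<in>UNIV. \<Sum>\<nu> | length \<nu> = p.
     levi_civita (\<mu> @ \<rho> # \<sigma> # \<nu>) * f \<mu> \<rho> \<sigma> \<nu>)"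

lemma wedge4_add: "wedge4 p (\<lambda>\<mu> \<rho> \<sigma> \<nu>. f \<mu> \<rho> \<sigma> \<nu> + h \<mu> \<rho> \<sigma> \<nu>) = wedge4 p f + wedge4 p h"
  by (simp add: wedge4_def sum.distrib distrib_left)

lemma wedge4_scale: "wedge4 p (\<lambda>\<mu> \<rho> \<sigma> \<nu>. k * f \<mu> \<rho> \<sigma> \<nu>) = k * wedge4 p f"
  by (simp add: wedge4_def sum_distrib_left mult_ac)

lemma wedge4_cong:
  "(\<And>\<mu> \<rho> \<sigma> \<nu>. length \<mu> = p \<Longrightarrow> length \<nu> = p \<Longrightarrow> f \<mu> \<rho> \<sigma> \<nu> = h \<mu> \<rho> \<sigma> \<nu>) \<Longrightarrow> wedge4 p f = wedge4 p h"
  unfolding wedge4_def by (intro sum.cong refl) auto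

context
  fixes p :: nat
  assumes card: "CARD('d::{finite,linorder}) = 2 * Suc p"
begin

lemma levi_civita_swap:
  "length (xs @ a # b # ys) = CARD('d) \<Longrightarrow>
    levi_civita (xs @ a # b # ys) = - levi_civita (xs @ b # a # ys :: 'd list)"
  by (rule antisymmetric_swap[OF antisymmetric_levi_civita])

lemma wedge4_symmetric:
  fixes f :: "'d list \<Rightarrow> 'd \<Rightarrow> 'd \<Rightarrow> 'd list \<Rightarrow> real"
  assumes "\<And>\<mu> \<rho> \<sigma> \<nu>. f \<mu> \<rho> \<sigma> \<nu> = f \<mu> \<sigma> \<rho> \<nu>"
  shows "wedge4 p f = 0"
  unfolding wedge4_def
proof (rule sum.neutral, rule ballI, rule sum_sum_antisymmetric_eq_0)
  fix \<mu> :: "'d list" and \<rho> \<sigma> :: 'd assume "\<mu> \<in> {\<mu>. length \<mu> = p}"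
  thus "(\<Sum>\<nu> | length \<nu> = p. levi_civita (\<mu> @ \<rho> # \<sigma> # \<nu>) * f \<mu> \<rho> \<sigma> \<nu>)
      = - (\<Sum>\<nu> | length \<nu> = p. levi_civita (\<mu> @ \<sigma> # \<rho> # \<nu>) * f \<mu> \<sigma> \<rho> \<nu>)"
    unfolding sum_negf[symmetric]
    by (intro sum.cong refl) (simp add: levi_civita_swap[of \<mu> \<rho> \<sigma>] assms[of \<mu> \<rho> \<sigma>] card)
qed

text \<open>The first index of the last factor is adjacent to the two covector slots, and the symbol
  alternates in all three. The alternatives cover symmetry in the last two of them and in the outer
  two, the cases that arise for \<delta>A = v \<and> \<psi>.\<close>

lemma wedge4_symmetric_hd:
  fixes f :: "'d list \<Rightarrow> 'd \<Rightarrow> 'd \<Rightarrow> 'd \<Rightarrow> 'd list \<Rightarrow> real"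
  assumes p: "p = Suc k" and f: "(\<forall>\<mu> \<rho> \<sigma> \<tau> \<nu>. f \<mu> \<rho> \<sigma> \<tau> \<nu> = f \<mu> \<rho> \<tau> \<sigma> \<nu>) \<or> (\<forall>\<mu> \<rho> \<sigma> \<tau> \<nu>. f \<mu> \<rho> \<sigma> \<tau> \<nu> = f \<mu> \<tau> \<sigma> \<rho> \<nu>)"
  shows "wedge4 p (\<lambda>\<mu> \<rho> \<sigma> \<nu>. f \<mu> \<rho> \<sigma> (hd \<nu>) (tl \<nu>)) = 0"
proof -
  define F where "F \<mu> \<rho> \<sigma> \<tau> = (\<Sum>\<nu> | length \<nu> = k. levi_civita (\<mu> @ \<rho> # \<sigma> # \<tau> # \<nu>) * f \<mu> \<rho> \<sigma> \<tau> \<nu>)" for \<mu> \<rho> \<sigma> \<tau>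
  have eq: "wedge4 p (\<lambda>\<mu> \<rho> \<sigma> \<nu>. f \<mu> \<rho> \<sigma> (hd \<nu>) (tl \<nu>))
      = (\<Sum>\<mu> | length \<mu> = p. \<Sum>\<rho>\<in>UNIV. \<Sum>\<sigma>\<in>UNIV. \<Sum>\<tau>\<in>UNIV. F \<mu> \<rho> \<sigma> \<tau>)"
    unfolding wedge4_def F_def by (intro sum.cong refl) (simp add: p sum_lists_Suc)
  have flip1: "levi_civita (\<mu> @ \<rho> # \<sigma> # \<tau> # \<nu>) = - levi_civita (\<mu> @ \<rho> # \<tau> # \<sigma> # \<nu>)"
    and flip2: "levi_civita (\<mu> @ \<rho> # \<sigma> # \<tau> # \<nu>) = - levi_civita (\<mu> @ \<tau> # \<sigma> # \<rho> # \<nu>)"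
    if "length \<mu> = p" "length \<nu> = k" for \<mu> \<nu> and \<rho> \<sigma> \<tau> :: 'd
  proof -
    have a: "levi_civita (\<mu> @ x # y # z # \<nu>) = - levi_civita (\<mu> @ y # x # z # \<nu>)" for x y z :: 'd
      by (rule levi_civita_swap) (use that p card in simp)
    have b: "levi_civita (\<mu> @ x # y # z # \<nu>) = - levi_civita (\<mu> @ x # z # y # \<nu>)" for x y z :: 'd
      using levi_civita_swap[of "\<mu> @ [x]" y z \<nu>] that p card by simp
    show "levi_civita (\<mu> @ \<rho> # \<sigma> # \<tau> # \<nu>) = - levi_civita (\<mu> @ \<rho> # \<tau> # \<sigma> # \<nu>)" by (rule b)
    show "levi_civita (\<mu> @ \<rho> # \<sigma> # \<tau> # \<nu>) = - levi_civita (\<mu> @ \<tau> # \<sigma> # \<rho> # \<nu>)"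
      \<comment> \<open>The exchange of the outer two indices is a product of three neighbouring
        swaps, hence odd.\<close>
      using a[of \<rho> \<sigma> \<tau>] b[of \<sigma> \<rho> \<tau>] a[of \<sigma> \<tau> \<rho>] by linarith
  qed
  from f show ?thesis
  proof
    assume f: "\<forall>\<mu> \<rho> \<sigma> \<tau> \<nu>. f \<mu> \<rho> \<sigma> \<tau> \<nu> = f \<mu> \<rho> \<tau> \<sigma> \<nu>"
    have F: "F \<mu> \<rho> \<sigma> \<tau> = - F \<mu> \<rho> \<tau> \<sigma>" if "length \<mu> = p" for \<mu> \<rho> \<sigma> \<tau>
      unfolding F_def sum_negf[symmetric]
      by (intro sum.cong refl) (simp add: flip1[OF that, of _ \<rho> \<sigma> \<tau>] f[rule_format, of \<mu> \<rho> \<sigma> \<tau>])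
    show ?thesis unfolding eq
      by (rule sum.neutral, rule ballI, rule sum.neutral, rule ballI, rule sum_sum_antisymmetric_eq_0, rule F) simp
  next
    assume f: "\<forall>\<mu> \<rho> \<sigma> \<tau> \<nu>. f \<mu> \<rho> \<sigma> \<tau> \<nu> = f \<mu> \<tau> \<sigma> \<rho> \<nu>"
    have F: "F \<mu> \<rho> \<sigma> \<tau> = - F \<mu> \<tau> \<sigma> \<rho>" if "length \<mu> = p" for \<mu> \<rho> \<sigma> \<tau>
      unfolding F_def sum_negf[symmetric]
      by (intro sum.cong refl) (simp add: flip2[OF that, of _ \<rho> \<sigma> \<tau>] f[rule_format, of \<mu> \<rho> \<sigma> \<tau>])
    have "(\<Sum>\<sigma>\<in>UNIV. \<Sum>\<rho>\<in>UNIV. \<Sum>\<tau>\<in>UNIV. F \<mu> \<rho> \<sigma> \<tau>) = 0" if "length \<mu> = p" for \<mu>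
      by (rule sum.neutral, rule ballI, rule sum_sum_antisymmetric_eq_0, rule F, rule that)
    moreover have "(\<Sum>\<rho>\<in>UNIV. \<Sum>\<sigma>\<in>UNIV. \<Sum>\<tau>\<in>UNIV. F \<mu> \<rho> \<sigma> \<tau>) = (\<Sum>\<sigma>\<in>UNIV. \<Sum>\<rho>\<in>UNIV. \<Sum>\<tau>\<in>UNIV. F \<mu> \<rho> \<sigma> \<tau>)" for \<mu>
      by (rule sum.swap)
    ultimately show ?thesis unfolding eq by simp
  qed
qed

text \<open>Moving u across the even block \<nu> costs no sign; moving it across w costs the one
  that appears.\<close>

lemma eps_cov2_eq_wedge4:
  fixes X Y :: "'d tensor"
  assumes "even p"
  shows "eps_cov2 p w u X Y = - wedge4 p (\<lambda>\<mu> \<rho> \<sigma> \<nu>. X \<mu> * u $ \<rho> * w $ \<sigma> * Y \<nu>)"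
proof -
  have flip: "levi_civita (\<mu> @ \<sigma> # \<nu> @ [\<rho>]) = - levi_civita (\<mu> @ \<rho> # \<sigma> # \<nu>)"
    if "length \<mu> = p" "length \<nu> = p" for \<mu> \<nu> and \<sigma> \<rho> :: 'd
    using antisymmetric_move_block[OF antisymmetric_levi_civita, of "\<mu> @ [\<sigma>]" \<nu> "[\<rho>]" "[]"]
      levi_civita_swap[of \<mu> \<sigma> \<rho> \<nu>] that assms card by simp
  have "eps_cov2 p w u X Y = (\<Sum>\<mu> | length \<mu> = p. \<Sum>\<sigma>\<in>UNIV. \<Sum>\<nu> | length \<nu> = p. \<Sum>\<rho>\<in>UNIV.
      - (levi_civita (\<mu> @ \<rho> # \<sigma> # \<nu>) * (X \<mu> * u $ \<rho> * w $ \<sigma> * Y \<nu>)))"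
    unfolding eps_cov2_def by (intro sum.cong refl) (simp add: flip)
  also have "\<dots> = (\<Sum>\<mu> | length \<mu> = p. \<Sum>\<sigma>\<in>UNIV. \<Sum>\<rho>\<in>UNIV. \<Sum>\<nu> | length \<nu> = p.
      - (levi_civita (\<mu> @ \<rho> # \<sigma> # \<nu>) * (X \<mu> * u $ \<rho> * w $ \<sigma> * Y \<nu>)))"
    by (rule sum.cong[OF refl], rule sum.cong[OF refl], rule sum.swap)
  also have "\<dots> = (\<Sum>\<mu> | length \<mu> = p. \<Sum>\<rho>\<in>UNIV. \<Sum>\<sigma>\<in>UNIV. \<Sum>\<nu> | length \<nu> = p.
      - (levi_civita (\<mu> @ \<rho> # \<sigma> # \<nu>) * (X \<mu> * u $ \<rho> * w $ \<sigma> * Y \<nu>)))"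
    by (rule sum.cong[OF refl], rule sum.swap)
  finally show ?thesis by (simp add: wedge4_def sum_negf)
qed

text \<open>The derivative index and the first index of the form move together across the even block
  \<mu> without a sign, and their exchange gives the minus. The form is read as one covector
  followed by two blocks of length p, as in v \<and> G \<and> G.\<close>

lemma sum_levi_civita_eq_wedge4:
  fixes f :: "'d \<Rightarrow> 'd list \<Rightarrow> real"
  assumes "even p"
  shows "(\<Sum>\<sigma>\<in>UNIV. \<Sum>\<mu> | length \<mu> = CARD('d) - 1. levi_civita (\<sigma> # \<mu>) * f \<sigma> \<mu>)
    = - wedge4 p (\<lambda>\<mu> \<rho> \<sigma> \<nu>. f \<sigma> (\<rho> # \<mu> @ \<nu>))"
proof -
  have card': "CARD('d) - 1 = Suc (p + p)" using card by simp
  have flip: "levi_civita (\<sigma> # \<rho> # \<mu> @ \<nu>) = - levi_civita (\<mu> @ \<rho> # \<sigma> # \<nu>)"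
    if "length \<mu> = p" "length \<nu> = p" for \<mu> \<nu> and \<sigma> \<rho> :: 'd
    using antisymmetric_move_block[OF antisymmetric_levi_civita, of "[]" "[\<sigma>, \<rho>]" \<mu> \<nu>]
      levi_civita_swap[of \<mu> \<sigma> \<rho> \<nu>] that assms card by simp
  have "(\<Sum>\<sigma>\<in>UNIV. \<Sum>\<mu> | length \<mu> = CARD('d) - 1. levi_civita (\<sigma> # \<mu>) * f \<sigma> \<mu>)
      = (\<Sum>\<sigma>\<in>UNIV. \<Sum>\<rho>\<in>UNIV. \<Sum>\<mu> | length \<mu> = p. \<Sum>\<nu> | length \<nu> = p.
          - (levi_civita (\<mu> @ \<rho> # \<sigma> # \<nu>) * f \<sigma> (\<rho> # \<mu> @ \<nu>)))"
    unfolding card' sum_lists_Suc sum_lists_append by (intro sum.cong refl) (simp add: flip)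
  also have "\<dots> = (\<Sum>\<rho>\<in>UNIV. \<Sum>\<sigma>\<in>UNIV. \<Sum>\<mu> | length \<mu> = p. \<Sum>\<nu> | length \<nu> = p.
          - (levi_civita (\<mu> @ \<rho> # \<sigma> # \<nu>) * f \<sigma> (\<rho> # \<mu> @ \<nu>)))"
    by (rule sum.swap)
  also have "\<dots> = (\<Sum>\<rho>\<in>UNIV. \<Sum>\<mu> | length \<mu> = p. \<Sum>\<sigma>\<in>UNIV. \<Sum>\<nu> | length \<nu> = p.
          - (levi_civita (\<mu> @ \<rho> # \<sigma> # \<nu>) * f \<sigma> (\<rho> # \<mu> @ \<nu>)))"
    by (rule sum.cong[OF refl], rule sum.swap)
  also have "\<dots> = (\<Sum>\<mu> | length \<mu> = p. \<Sum>\<rho>\<in>UNIV. \<Sum>\<sigma>\<in>UNIV. \<Sum>\<nu> | length \<nu> = p.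
          - (levi_civita (\<mu> @ \<rho> # \<sigma> # \<nu>) * f \<sigma> (\<rho> # \<mu> @ \<nu>)))"
    by (rule sum.swap)
  finally show ?thesis by (simp add: wedge4_def sum_negf)
qed

text \<open>Forms of even degree commute with each other and with covectors. This identifies the two
  terms in which the derivative of G \<and> G hits one factor.\<close>

lemma wedge4_commute:
  fixes f :: "'d list \<Rightarrow> 'd \<Rightarrow> 'd \<Rightarrow> 'd list \<Rightarrow> real"
  assumes "even p"
  shows "wedge4 p (\<lambda>\<mu> \<rho> \<sigma> \<nu>. f \<nu> \<rho> \<sigma> \<mu>) = wedge4 p f"
proof -
  have flip: "levi_civita (\<mu> @ \<rho> # \<sigma> # \<nu>) = levi_civita (\<nu> @ \<rho> # \<sigma> # \<mu>)"
    if "length \<mu> = p" "length \<nu> = p" for \<mu> \<nu> and \<sigma> \<rho> :: 'd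
    using antisymmetric_move_block[OF antisymmetric_levi_civita, of "[]" "\<mu> @ [\<rho>, \<sigma>]" \<nu> "[]"]
      antisymmetric_move_block[OF antisymmetric_levi_civita, of \<nu> \<mu> "[\<rho>, \<sigma>]" "[]"] that assms card by simp
  have expand: "wedge4 p h = (\<Sum>\<mu> | length \<mu> = p. \<Sum>\<nu> | length \<nu> = p. \<Sum>\<rho>\<in>UNIV. \<Sum>\<sigma>\<in>UNIV.
     levi_civita (\<mu> @ \<rho> # \<sigma> # \<nu>) * h \<mu> \<rho> \<sigma> \<nu>)" for h :: "'d list \<Rightarrow> 'd \<Rightarrow> 'd \<Rightarrow> 'd list \<Rightarrow> real"
  proof -
    have "wedge4 p h = (\<Sum>\<mu> | length \<mu> = p. \<Sum>\<rho>\<in>UNIV. \<Sum>\<nu> | length \<nu> = p. \<Sum>\<sigma>\<in>UNIV.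
        levi_civita (\<mu> @ \<rho> # \<sigma> # \<nu>) * h \<mu> \<rho> \<sigma> \<nu>)"
      unfolding wedge4_def by (rule sum.cong[OF refl], rule sum.cong[OF refl], rule sum.swap)
    also have "\<dots> = (\<Sum>\<mu> | length \<mu> = p. \<Sum>\<nu> | length \<nu> = p. \<Sum>\<rho>\<in>UNIV. \<Sum>\<sigma>\<in>UNIV.
        levi_civita (\<mu> @ \<rho> # \<sigma> # \<nu>) * h \<mu> \<rho> \<sigma> \<nu>)"
      by (rule sum.cong[OF refl], rule sum.swap)
    finally show ?thesis .
  qed
  have "wedge4 p (\<lambda>\<mu> \<rho> \<sigma> \<nu>. f \<nu> \<rho> \<sigma> \<mu>) = (\<Sum>\<nu> | length \<nu> = p. \<Sum>\<mu> | length \<mu> = p. \<Sum>\<rho>\<in>UNIV. \<Sum>\<sigma>\<in>UNIV.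
     levi_civita (\<mu> @ \<rho> # \<sigma> # \<nu>) * f \<nu> \<rho> \<sigma> \<mu>)"
    unfolding expand by (rule sum.swap)
  also have "\<dots> = wedge4 p f"
    unfolding expand by (rule sum.cong[OF refl], rule sum.cong[OF refl]) (simp add: flip)
  finally show ?thesis .
qed

end

section \<open>Exterior derivatives of potentials, paired with the Levi-Civita symbol\<close>

context oriented_manifold
begin

text \<open>S absorbs the antisymmetrization in the field strength, leaving bare partial derivatives
  of A and the normalization factor p + 1.\<close>

lemma sum_antisymmetric_field_strength:
  fixes A :: "('m, 'd) tensor_field"
  assumes "antisymmetric (Suc p) S"
  shows "(\<Sum>\<mu> | length \<mu> = Suc p. S \<mu> * field_strength p A c q \<mu>)
    = Suc p * (\<Sum>\<sigma>\<in>UNIV. \<Sum>\<mu> | length \<mu> = p. S (\<sigma> # \<mu>) * chart_partial c \<sigma> (\<lambda>q. A c q \<mu>) q)"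
proof -
  have "(\<Sum>\<mu> | length \<mu> = Suc p. S \<mu> * field_strength p A c q \<mu>)
      = Suc p * (\<Sum>\<mu> | length \<mu> = Suc p. S \<mu> * antisymmetrize (Suc p) (\<lambda>\<nu>. chart_partial c (hd \<nu>) (\<lambda>q. A c q (tl \<nu>)) q) \<mu>)"
    by (simp add: field_strength_eq sum_distrib_left mult_ac del: of_nat_Suc)
  thus ?thesis
    unfolding sum_antisymmetric_antisymmetrize[OF assms] sum_lists_Suc by simp
qed

lemma eps_cov_field_strength:
  fixes A :: "('m, 'd) tensor_field"
  assumes card: "CARD('d) = 2 * Suc p"
  shows "eps_cov p X u (field_strength p A c q)
    = Suc p * wedge4 p (\<lambda>\<mu> \<rho> \<sigma> \<nu>. X \<mu> * u $ \<rho> * chart_partial c \<sigma> (\<lambda>q. A c q \<nu>) q)"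
proof -
  have anti: "antisymmetric (Suc p) (\<lambda>\<nu>. levi_civita (\<mu> @ \<rho> # \<nu>))" if "length \<mu> = p" for \<mu> and \<rho> :: 'd
    using antisymmetric_levi_civita_block[of "\<mu> @ [\<rho>]" "Suc p" "[]"] that card by simp
  have "eps_cov p X u (field_strength p A c q) = (\<Sum>\<mu> | length \<mu> = p. \<Sum>\<rho>\<in>UNIV. X \<mu> * u $ \<rho> *
      (\<Sum>\<nu> | length \<nu> = Suc p. levi_civita (\<mu> @ \<rho> # \<nu>) * field_strength p A c q \<nu>))"
    by (simp add: eps_cov_def sum_distrib_left mult_ac)
  also have "\<dots> = (\<Sum>\<mu> | length \<mu> = p. \<Sum>\<rho>\<in>UNIV. X \<mu> * u $ \<rho> *
      (Suc p * (\<Sum>\<sigma>\<in>UNIV. \<Sum>\<nu> | length \<nu> = p. levi_civita (\<mu> @ \<rho> # \<sigma> # \<nu>) * chart_partial c \<sigma> (\<lambda>q. A c q \<nu>) q)))"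
  proof (rule sum.cong[OF refl], rule sum.cong[OF refl], rule arg_cong[of _ _ "(*) _"])
    fix \<mu> :: "'d list" and \<rho> :: 'd assume "\<mu> \<in> {\<mu>. length \<mu> = p}"
    thus "(\<Sum>\<nu> | length \<nu> = Suc p. levi_civita (\<mu> @ \<rho> # \<nu>) * field_strength p A c q \<nu>)
      = Suc p * (\<Sum>\<sigma>\<in>UNIV. \<Sum>\<nu> | length \<nu> = p. levi_civita (\<mu> @ \<rho> # \<sigma> # \<nu>) * chart_partial c \<sigma> (\<lambda>q. A c q \<nu>) q)"
      using sum_antisymmetric_field_strength[OF anti[of \<mu> \<rho>]] by simp
  qed
  also have "\<dots> = Suc p * wedge4 p (\<lambda>\<mu> \<rho> \<sigma> \<nu>. X \<mu> * u $ \<rho> * chart_partial c \<sigma> (\<lambda>q. A c q \<nu>) q)"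
    by (simp add: wedge4_def sum_distrib_left mult_ac del: of_nat_Suc)
  finally show ?thesis .
qed

text \<open>In forms: d(\<delta>A \<and> F) = d\<delta>A \<and> F. The term with dF vanishes by the
  Bianchi identity, and 1/(p + 1) undoes the normalization of the field strength of
  \<delta>A.\<close>

lemma divergence_potential_field_strength:
  assumes card: "CARD('d) = 2 * Suc p" and A: "covariant_field \<A> p A" and dA: "covariant_field \<A> p dA"
    and c: "c \<in> \<A>" and q: "q \<in> dom_ch c"
  shows "(\<Sum>\<sigma>\<in>UNIV. \<Sum>\<mu> | length \<mu> = CARD('d) - 1. levi_civita (\<sigma> # \<mu>) *
      chart_partial c \<sigma> (\<lambda>q. dA c q (take p \<mu>) * field_strength p A c q (drop p \<mu>)) q)
    = eps_pair p (field_strength p dA c q) (field_strength p A c q) / Suc p"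
proof -
  let ?F = "field_strength p A c" and ?D = "chart_partial c"
  note ch = chart[OF c] and W = chart_dom[OF c]
  note sF = covariant_fieldD(2)[OF covariant_field_field_strength[OF A] c]
    and sA = covariant_fieldD(2)[OF A c] and sdA = covariant_fieldD(2)[OF dA c]
  note dF = chart_smooth_diff[OF sF q] and ddA = chart_smooth_diff[OF sdA q]
  have card': "CARD('d) - 1 = p + Suc p" using card by simp
  have "(\<Sum>\<sigma>\<in>UNIV. \<Sum>\<mu> | length \<mu> = CARD('d) - 1. levi_civita (\<sigma> # \<mu>) *
      ?D \<sigma> (\<lambda>q. dA c q (take p \<mu>) * ?F q (drop p \<mu>)) q)
    = (\<Sum>\<sigma>\<in>UNIV. \<Sum>\<mu> | length \<mu> = p. \<Sum>\<nu> | length \<nu> = Suc p.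
        ?F q \<nu> * (levi_civita (\<sigma> # \<mu> @ \<nu>) * ?D \<sigma> (\<lambda>q. dA c q \<mu>) q))
    + (\<Sum>\<sigma>\<in>UNIV. \<Sum>\<mu> | length \<mu> = p. \<Sum>\<nu> | length \<nu> = Suc p.
        dA c q \<mu> * (levi_civita (\<sigma> # \<mu> @ \<nu>) * ?D \<sigma> (\<lambda>q. ?F q \<nu>) q))"
    unfolding card' sum_lists_append sum.distrib[symmetric]
    by (intro sum.cong refl) (simp add: chart_partial_mult ch q dF ddA algebra_simps)
  also have "(\<Sum>\<sigma>\<in>UNIV. \<Sum>\<mu> | length \<mu> = p. \<Sum>\<nu> | length \<nu> = Suc p.
        ?F q \<nu> * (levi_civita (\<sigma> # \<mu> @ \<nu>) * ?D \<sigma> (\<lambda>q. dA c q \<mu>) q))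
     = (\<Sum>\<nu> | length \<nu> = Suc p. ?F q \<nu> * (\<Sum>\<sigma>\<in>UNIV. \<Sum>\<mu> | length \<mu> = p.
        levi_civita (\<sigma> # \<mu> @ \<nu>) * ?D \<sigma> (\<lambda>q. dA c q \<mu>) q))"
  proof -
    have "(\<Sum>\<sigma>\<in>UNIV. \<Sum>\<mu> | length \<mu> = p. \<Sum>\<nu> | length \<nu> = Suc p.
        ?F q \<nu> * (levi_civita (\<sigma> # \<mu> @ \<nu>) * ?D \<sigma> (\<lambda>q. dA c q \<mu>) q))
      = (\<Sum>\<sigma>\<in>UNIV. \<Sum>\<nu> | length \<nu> = Suc p. \<Sum>\<mu> | length \<mu> = p.
        ?F q \<nu> * (levi_civita (\<sigma> # \<mu> @ \<nu>) * ?D \<sigma> (\<lambda>q. dA c q \<mu>) q))"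
      by (rule sum.cong[OF refl], rule sum.swap)
    also have "\<dots> = (\<Sum>\<nu> | length \<nu> = Suc p. \<Sum>\<sigma>\<in>UNIV. \<Sum>\<mu> | length \<mu> = p.
        ?F q \<nu> * (levi_civita (\<sigma> # \<mu> @ \<nu>) * ?D \<sigma> (\<lambda>q. dA c q \<mu>) q))"
      by (rule sum.swap)
    finally show ?thesis by (simp add: sum_distrib_left)
  qed
  also have "\<dots> = (\<Sum>\<nu> | length \<nu> = Suc p. ?F q \<nu> *
      ((\<Sum>\<mu> | length \<mu> = Suc p. levi_civita (\<mu> @ \<nu>) * field_strength p dA c q \<mu>) / Suc p))"
  proof (rule sum.cong[OF refl])
    fix \<nu> :: "'d list" assume "\<nu> \<in> {\<nu>. length \<nu> = Suc p}"
    hence "antisymmetric (Suc p) (\<lambda>\<mu>. levi_civita (\<mu> @ \<nu>))"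
      using antisymmetric_levi_civita_block[of "[]" "Suc p" \<nu>] card by simp
    from sum_antisymmetric_field_strength[OF this, of dA c q]
    show "?F q \<nu> * (\<Sum>\<sigma>\<in>UNIV. \<Sum>\<mu> | length \<mu> = p. levi_civita (\<sigma> # \<mu> @ \<nu>) * ?D \<sigma> (\<lambda>q. dA c q \<mu>) q)
      = ?F q \<nu> * ((\<Sum>\<mu> | length \<mu> = Suc p. levi_civita (\<mu> @ \<nu>) * field_strength p dA c q \<mu>) / Suc p)"
      by (simp del: of_nat_Suc)
  qed
  also have "\<dots> = eps_pair p (field_strength p dA c q) (?F q) / Suc p"
    unfolding eps_pair_def
    by (subst sum.swap) (simp add: sum_distrib_left sum_distrib_right sum_divide_distrib mult_ac del: of_nat_Suc)
  also have "(\<Sum>\<sigma>\<in>UNIV. \<Sum>\<mu> | length \<mu> = p. \<Sum>\<nu> | length \<nu> = Suc p.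
        dA c q \<mu> * (levi_civita (\<sigma> # \<mu> @ \<nu>) * ?D \<sigma> (\<lambda>q. ?F q \<nu>) q))
      = (\<Sum>\<mu> | length \<mu> = p. dA c q \<mu> * (\<Sum>\<sigma>\<in>UNIV. \<Sum>\<nu> | length \<nu> = Suc p.
          levi_civita (\<sigma> # \<mu> @ \<nu>) * ?D \<sigma> (\<lambda>q. ?F q \<nu>) q))"
    by (subst sum.swap) (simp add: sum_distrib_left)
  also have "\<dots> = 0"
  proof (rule sum.neutral, rule ballI)
    fix \<mu> :: "'d list" assume "\<mu> \<in> {\<mu>. length \<mu> = p}"
    hence \<mu>: "length \<mu> = p" by simp
    \<comment> \<open>The part of the Bianchi term with fixed derivative indices \<sigma> and
      \<tau>; it is antisymmetric in them because mixed partials commute.\<close>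
    define H where "H \<sigma> \<tau> = (\<Sum>\<nu> | length \<nu> = p. levi_civita (\<sigma> # \<mu> @ \<tau> # \<nu>) * ?D \<sigma> (?D \<tau> (\<lambda>q. A c q \<nu>)) q)" for \<sigma> \<tau>
    have "(\<Sum>\<nu> | length \<nu> = Suc p. levi_civita (\<sigma> # \<mu> @ \<nu>) * ?D \<sigma> (\<lambda>q. ?F q \<nu>) q) = Suc p * (\<Sum>\<tau>\<in>UNIV. H \<sigma> \<tau>)" for \<sigma>
    proof -
      have anti: "antisymmetric (Suc p) (\<lambda>\<nu>. levi_civita (\<sigma> # \<mu> @ \<nu>))"
        using antisymmetric_levi_civita_block[of "\<sigma> # \<mu>" "Suc p" "[]"] \<mu> card by simp
      have d2: "chart_diff c (?D \<tau> (\<lambda>q. A c q \<nu>)) q" for \<tau> \<nu>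
        by (rule chart_smooth_diff[OF chart_smooth_partial[OF W sA] q])
      have "(\<Sum>\<nu> | length \<nu> = Suc p. levi_civita (\<sigma> # \<mu> @ \<nu>) * ?D \<sigma> (\<lambda>q. ?F q \<nu>) q)
          = ?D \<sigma> (\<lambda>q. \<Sum>\<nu> | length \<nu> = Suc p. levi_civita (\<sigma> # \<mu> @ \<nu>) * ?F q \<nu>) q"
        by (simp add: chart_partial_sum chart_partial_cmult chart_diff_mult dF)
      also have "\<dots> = ?D \<sigma> (\<lambda>q. Suc p * (\<Sum>\<tau>\<in>UNIV. \<Sum>\<nu> | length \<nu> = p.
          levi_civita (\<sigma> # \<mu> @ \<tau> # \<nu>) * ?D \<tau> (\<lambda>q. A c q \<nu>) q)) q"
        by (simp only: sum_antisymmetric_field_strength[OF anti])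
      also have "\<dots> = Suc p * (\<Sum>\<tau>\<in>UNIV. H \<sigma> \<tau>)"
        unfolding H_def
        by (simp add: chart_partial_sum chart_partial_cmult chart_diff_mult chart_diff_sum d2 del: of_nat_Suc)
      finally show ?thesis .
    qed
    moreover have "(\<Sum>\<sigma>\<in>UNIV. \<Sum>\<tau>\<in>UNIV. H \<sigma> \<tau>) = 0"
    proof (rule sum_sum_antisymmetric_eq_0)
      fix \<sigma> \<tau> :: 'd
      \<comment> \<open>Moving the leading index across \<mu> costs the same sign on both sides, so
        only the swap of the neighbours \<sigma> and \<tau> remains.\<close>
      have "levi_civita (\<sigma> # \<mu> @ \<tau> # \<nu>) = - levi_civita (\<tau> # \<mu> @ \<sigma> # \<nu>)" if "length \<nu> = p" for \<nu>
        using antisymmetric_move[OF antisymmetric_levi_civita, of "[]" \<sigma> \<mu> "\<tau> # \<nu>"]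
          antisymmetric_move[OF antisymmetric_levi_civita, of "[]" \<tau> \<mu> "\<sigma> # \<nu>"]
          levi_civita_swap[OF card, of \<mu> \<sigma> \<tau> \<nu>] that \<mu> card by simp
      thus "H \<sigma> \<tau> = - H \<tau> \<sigma>"
        unfolding H_def sum_negf[symmetric]
        by (intro sum.cong refl) (simp add: chart_partial_commute[OF W q sA, of \<sigma> \<tau>])
    qed
    ultimately show "dA c q \<mu> * (\<Sum>\<sigma>\<in>UNIV. \<Sum>\<nu> | length \<nu> = Suc p.
          levi_civita (\<sigma> # \<mu> @ \<nu>) * ?D \<sigma> (\<lambda>q. ?F q \<nu>) q) = 0"
      by (simp flip: sum_distrib_left del: of_nat_Suc)
  qed
  finally show ?thesis by simp
qed

end


section \<open>The first variation of the Lagrangian\<close>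

text \<open>The derivative of the normalized covector w / sqrt(-w.w) in the direction w1. The second
  term, along w, comes from the normalization.\<close>

definition covector_variation :: "'d::finite matrix \<Rightarrow> 'd coords \<Rightarrow> 'd coords \<Rightarrow> 'd coords" where
  "covector_variation g w w1 = (1 / sqrt (- covector_norm2 g w)) *\<^sub>R w1
     + ((w \<bullet> (matrix_inv g *v w1)) / ((- covector_norm2 g w) * sqrt (- covector_norm2 g w))) *\<^sub>R w"

lemma inner_matrix_inv_commute:
  assumes "lorentzian (g :: 'd::finite matrix)"
  shows "x \<bullet> (matrix_inv g *v y) = y \<bullet> (matrix_inv g *v x)"
  using lorentzian_inverse(3)[OF assms]
  by (metis dot_lmul_matrix inner_commute transpose_matrix_vector)

lemma inner_unit_covector:
  assumes "covector_norm2 g w < 0"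
  shows "unit_covector g w \<bullet> (matrix_inv g *v unit_covector g w) = -1"
proof -
  define M where "M = - covector_norm2 g w"
  have M: "M > 0" using assms by (simp add: M_def)
  have "unit_covector g w \<bullet> (matrix_inv g *v unit_covector g w) = (1 / sqrt M) * (1 / sqrt M) * - M"
    by (simp add: unit_covector_def M_def covector_norm2_def matrix_vector_mult_scaleR)
  also have "\<dots> = - (M / (sqrt M * sqrt M))" by simp
  finally show ?thesis using M by simp
qed

text \<open>The infinitesimal form of the fact that normalization keeps v.v = -1. It is the
  orthogonality that \<open>kinetic_variation\<close> requires.\<close>

lemma inner_covector_variation:
  assumes g: "lorentzian g" and "covector_norm2 g w < 0"
  shows "covector_variation g w w1 \<bullet> unit_vector g w = 0"
proof -
  define M y where "M = - covector_norm2 g w" and "y = w \<bullet> (matrix_inv g *v w1)"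
  have M: "M > 0" using assms by (simp add: M_def)
  have "w \<bullet> (matrix_inv g *v w) = - M" by (simp add: M_def covector_norm2_def)
  moreover have "w1 \<bullet> (matrix_inv g *v w) = y" using inner_matrix_inv_commute[OF g] by (simp add: y_def)
  ultimately have "covector_variation g w w1 \<bullet> unit_vector g w
      = 1 / sqrt M * (1 / sqrt M * y) + y / (M * sqrt M) * (1 / sqrt M * - M)"
    by (simp add: covector_variation_def unit_vector_def unit_covector_def matrix_vector_mult_scaleR
        inner_add_left M_def[symmetric] y_def[symmetric])
  thus ?thesis using M by (simp add: field_simps)
qed

text \<open>The derivative of the integrand exactly as the product rule delivers it, so that it
  matches both the uniform expansion and the algebraic identity for the kinetic terms. The function
  \<open>V\<close> is absent since its arguments stay fixed.\<close>

definition lagrangian_variation ::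
    "nat \<Rightarrow> 'd matrix \<Rightarrow> 'd coords \<Rightarrow> 'd coords \<Rightarrow> 'd::{finite,linorder} tensor \<Rightarrow> 'd tensor \<Rightarrow> 'd tensor \<Rightarrow> real" where
  "lagrangian_variation p g w w1 F dF \<Lambda> = (let
      v = unit_vector g w;
      x = matrix_inv g *v covector_variation g w w1;
      E = contract_last p F v;
      B = contract_last p (hodge g (p + 1) F) v;
      l = contract_last p \<Lambda> v;
      E1 = (\<lambda>\<mu>. contract_last p dF v \<mu> + contract_last p F x \<mu>);
      B1 = (\<lambda>\<mu>. contract_last p (hodge g (p + 1) dF) v \<mu> + contract_last p (hodge g (p + 1) F) x \<mu>);
      l1 = contract_last p \<Lambda> x
    in 1 / fact p * (1/2 * (full_contraction g p E1 B + full_contraction g p E B1)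
      - 1/2 * (full_contraction g p B1 B + full_contraction g p B B1)
      + (full_contraction g p (\<lambda>\<mu>. B1 \<mu> + l1 \<mu>) (\<lambda>\<mu>. B \<mu> + l \<mu>)
        + full_contraction g p (\<lambda>\<mu>. B \<mu> + l \<mu>) (\<lambda>\<mu>. B1 \<mu> + l1 \<mu>))))"

lemma first_order_contract_last:
  assumes K: "compact K" and T: "\<And>\<mu>. first_order K (\<lambda>\<epsilon> q. T \<epsilon> q \<mu>) (\<lambda>q. T1 q \<mu>)"
    and v: "\<And>\<nu>. first_order K (\<lambda>\<epsilon> q. v \<epsilon> q $ \<nu>) (\<lambda>q. v1 q $ \<nu>)"
  shows "first_order K (\<lambda>\<epsilon> q. contract_last r (T \<epsilon> q) (v \<epsilon> q) \<mu>)
    (\<lambda>q. contract_last r (T1 q) (v 0 q) \<mu> + contract_last r (T 0 q) (v1 q) \<mu>)"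
proof (cases "length \<mu> = r")
  case True
  have "first_order K (\<lambda>\<epsilon> q. \<Sum>\<nu>\<in>UNIV. T \<epsilon> q (\<mu> @ [\<nu>]) * v \<epsilon> q $ \<nu>)
      (\<lambda>q. \<Sum>\<nu>\<in>UNIV. T1 q (\<mu> @ [\<nu>]) * v 0 q $ \<nu> + T 0 q (\<mu> @ [\<nu>]) * v1 q $ \<nu>)"
    by (intro first_order_sum first_order_mult K T v)
  with True show ?thesis by (simp add: contract_last_def sum.distrib)
qed (simp add: contract_last_def first_order_const)

lemma first_order_full_contraction:
  assumes K: "compact K" and g: "\<And>i j. continuous_on K (\<lambda>q. matrix_inv (g q) $ i $ j)"
    and S: "\<And>\<mu>. first_order K (\<lambda>\<epsilon> q. S \<epsilon> q \<mu>) (\<lambda>q. S1 q \<mu>)"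
    and T: "\<And>\<mu>. first_order K (\<lambda>\<epsilon> q. T \<epsilon> q \<mu>) (\<lambda>q. T1 q \<mu>)"
  shows "first_order K (\<lambda>\<epsilon> q. full_contraction (g q) r (S \<epsilon> q) (T \<epsilon> q))
    (\<lambda>q. full_contraction (g q) r (S1 q) (T 0 q) + full_contraction (g q) r (S 0 q) (T1 q))"
proof -
  have *: "first_order K (\<lambda>\<epsilon> q. contract_all (matrix_inv (g q)) r (T \<epsilon> q) \<mu>)
      (\<lambda>q. contract_all (matrix_inv (g q)) r (T1 q) \<mu>)" for \<mu>
  proof (cases "length \<mu> = r")
    case True
    have "first_order K (\<lambda>\<epsilon> q. \<Sum>\<nu> | length \<nu> = r. (\<Prod>i<r. matrix_inv (g q) $ (\<mu> ! i) $ (\<nu> ! i)) * T \<epsilon> q \<nu>)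
      (\<lambda>q. \<Sum>\<nu> | length \<nu> = r. 0 * T 0 q \<nu> + (\<Prod>i<r. matrix_inv (g q) $ (\<mu> ! i) $ (\<nu> ! i)) * T1 q \<nu>)"
      by (intro first_order_sum first_order_mult K T first_order_const continuous_on_prod g)
    with True show ?thesis by (simp add: contract_all_def)
  qed (simp add: contract_all_def first_order_const)
  have "first_order K (\<lambda>\<epsilon> q. \<Sum>\<mu> | length \<mu> = r. S \<epsilon> q \<mu> * contract_all (matrix_inv (g q)) r (T \<epsilon> q) \<mu>)
    (\<lambda>q. \<Sum>\<mu> | length \<mu> = r. S1 q \<mu> * contract_all (matrix_inv (g q)) r (T 0 q) \<mu>
        + S 0 q \<mu> * contract_all (matrix_inv (g q)) r (T1 q) \<mu>)"
    by (intro first_order_sum first_order_mult K S *)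
  thus ?thesis by (simp add: full_contraction_def sum.distrib)
qed

lemma first_order_unit_vector:
  fixes g :: "'m::topological_space \<Rightarrow> 'd::finite matrix"
  assumes K: "compact K" and g: "\<And>i j. continuous_on K (\<lambda>q. matrix_inv (g q) $ i $ j)"
    and w: "\<And>i. continuous_on K (\<lambda>q. w q $ i)" "\<And>i. continuous_on K (\<lambda>q. w1 q $ i)"
    and lor: "\<And>q. q \<in> K \<Longrightarrow> lorentzian (g q)" and neg: "\<And>q. q \<in> K \<Longrightarrow> covector_norm2 (g q) (w q) < 0"
  shows "first_order K (\<lambda>\<epsilon> q. unit_vector (g q) (w q + \<epsilon> *\<^sub>R w1 q) $ k)
    (\<lambda>q. (matrix_inv (g q) *v covector_variation (g q) (w q) (w1 q)) $ k)"
proof -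
  define W where "W \<epsilon> q = w q + \<epsilon> *\<^sub>R w1 q" for \<epsilon> q
  have W0: "W 0 q = w q" for q by (simp add: W_def)
  have W: "first_order K (\<lambda>\<epsilon> q. W \<epsilon> q $ i) (\<lambda>q. w1 q $ i)" for i
    unfolding W_def by (simp add: first_order_affine w)
  have up: "first_order K (\<lambda>\<epsilon> q. (matrix_inv (g q) *v W \<epsilon> q) $ i) (\<lambda>q. (matrix_inv (g q) *v w1 q) $ i)" for i
  proof -
    have "first_order K (\<lambda>\<epsilon> q. \<Sum>j\<in>UNIV. matrix_inv (g q) $ i $ j * W \<epsilon> q $ j)
        (\<lambda>q. \<Sum>j\<in>UNIV. 0 * W 0 q $ j + matrix_inv (g q) $ i $ j * w1 q $ j)"
      by (intro first_order_sum first_order_mult K W first_order_const g)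
    thus ?thesis by (simp add: matrix_vector_mult_def)
  qed
  have "first_order K (\<lambda>\<epsilon> q. - 1 * (\<Sum>i\<in>UNIV. W \<epsilon> q $ i * (matrix_inv (g q) *v W \<epsilon> q) $ i))
      (\<lambda>q. - 1 * (\<Sum>i\<in>UNIV. w1 q $ i * (matrix_inv (g q) *v W 0 q) $ i + W 0 q $ i * (matrix_inv (g q) *v w1 q) $ i))"
    by (intro first_order_sum first_order_mult first_order_cmult K W up)
  \<comment> \<open>Symmetry of the inverse metric merges the two terms of the product rule, whence
    the factor 2.\<close>
  hence N: "first_order K (\<lambda>\<epsilon> q. - covector_norm2 (g q) (W \<epsilon> q)) (\<lambda>q. - 2 * (w q \<bullet> (matrix_inv (g q) *v w1 q)))"
    by (rule first_order_cong)
       (simp_all add: covector_norm2_def inner_vec_def sum.distrib W0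
         flip: inner_matrix_inv_commute[OF lor, unfolded inner_vec_def inner_real_def])
  have s: "first_order K (\<lambda>\<epsilon> q. 1 / sqrt (- covector_norm2 (g q) (W \<epsilon> q)))
      (\<lambda>q. (w q \<bullet> (matrix_inv (g q) *v w1 q)) / ((- covector_norm2 (g q) (w q)) * sqrt (- covector_norm2 (g q) (w q))))"
    by (rule first_order_cong[OF first_order_inverse_sqrt[OF K N]])
       (use neg in \<open>auto simp: W0 field_simps\<close>)
  have "first_order K (\<lambda>\<epsilon> q. 1 / sqrt (- covector_norm2 (g q) (W \<epsilon> q)) * (matrix_inv (g q) *v W \<epsilon> q) $ k)
    (\<lambda>q. (w q \<bullet> (matrix_inv (g q) *v w1 q)) / ((- covector_norm2 (g q) (w q)) * sqrt (- covector_norm2 (g q) (w q)))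
          * (matrix_inv (g q) *v W 0 q) $ k
        + 1 / sqrt (- covector_norm2 (g q) (W 0 q)) * (matrix_inv (g q) *v w1 q) $ k)"
    by (intro first_order_mult K s up)
  thus ?thesis
    by (rule first_order_cong)
       (simp_all add: W_def[symmetric] W0 unit_vector_def unit_covector_def covector_variation_def
         matrix_vector_mult_scaleR matrix_vector_right_distrib matrix_vector_mult_diff_distrib)
qed

text \<open>\<open>V\<close> has the same arguments in both Lagrangians and cancels. The rest is
  polynomial in the unit vector and in fields that are affine in \<epsilon>, the dual being
  linear.\<close>

lemma first_order_lagrangian:
  fixes g :: "'m::topological_space \<Rightarrow> 'd::{finite,linorder} matrix"
  assumes K: "compact K" and g: "\<And>i j. continuous_on K (\<lambda>q. matrix_inv (g q) $ i $ j)"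
    and w: "\<And>i. continuous_on K (\<lambda>q. w q $ i)" "\<And>i. continuous_on K (\<lambda>q. w1 q $ i)"
    and lor: "\<And>q. q \<in> K \<Longrightarrow> lorentzian (g q)" and neg: "\<And>q. q \<in> K \<Longrightarrow> covector_norm2 (g q) (w q) < 0"
    and F: "\<And>\<mu>. continuous_on K (\<lambda>q. F q \<mu>)" "\<And>\<mu>. continuous_on K (\<lambda>q. dF q \<mu>)"
    and H: "\<And>\<mu>. continuous_on K (\<lambda>q. hodge (g q) (p + 1) (F q) \<mu>)"
      "\<And>\<mu>. continuous_on K (\<lambda>q. hodge (g q) (p + 1) (dF q) \<mu>)"
    and \<Lambda>: "\<And>\<mu>. continuous_on K (\<lambda>q. \<Lambda> q \<mu>)"
  shows "first_order K (\<lambda>\<epsilon> q. lagrangian p V (g q) (w q + \<epsilon> *\<^sub>R w1 q) (\<lambda>\<mu>. F q \<mu> + \<epsilon> * dF q \<mu>) (\<Lambda> q)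
      - lagrangian p V (g q) (w q) (F q) (\<Lambda> q))
    (\<lambda>q. lagrangian_variation p (g q) (w q) (w1 q) (F q) (dF q) (\<Lambda> q))"
proof -
  define v where "v \<epsilon> q = unit_vector (g q) (w q + \<epsilon> *\<^sub>R w1 q)" for \<epsilon> q
  define x where "x q = matrix_inv (g q) *v covector_variation (g q) (w q) (w1 q)" for q
  have v: "first_order K (\<lambda>\<epsilon> q. v \<epsilon> q $ i) (\<lambda>q. x q $ i)" for i
    unfolding v_def x_def by (rule first_order_unit_vector[OF K g w lor neg])
  define E B l where "E \<epsilon> q = contract_last p (\<lambda>\<mu>. F q \<mu> + \<epsilon> * dF q \<mu>) (v \<epsilon> q)"
    and "B \<epsilon> q = contract_last p (\<lambda>\<mu>. hodge (g q) (p + 1) (F q) \<mu> + \<epsilon> * hodge (g q) (p + 1) (dF q) \<mu>) (v \<epsilon> q)"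
    and "l \<epsilon> q = contract_last p (\<Lambda> q) (v \<epsilon> q)" for \<epsilon> q
  define E1 B1 l1 where "E1 q = (\<lambda>\<mu>. contract_last p (dF q) (v 0 q) \<mu> + contract_last p (F q) (x q) \<mu>)"
    and "B1 q = (\<lambda>\<mu>. contract_last p (hodge (g q) (p + 1) (dF q)) (v 0 q) \<mu> + contract_last p (hodge (g q) (p + 1) (F q)) (x q) \<mu>)"
    and "l1 q = contract_last p (\<Lambda> q) (x q)" for q
  have E: "first_order K (\<lambda>\<epsilon> q. E \<epsilon> q \<mu>) (\<lambda>q. E1 q \<mu>)" for \<mu>
    using first_order_contract_last[OF K first_order_affine[OF F] v, where r = p and \<mu> = \<mu>] by (simp add: E_def E1_def)
  have B: "first_order K (\<lambda>\<epsilon> q. B \<epsilon> q \<mu>) (\<lambda>q. B1 q \<mu>)" for \<mu>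
    using first_order_contract_last[OF K first_order_affine[OF H] v, where r = p and \<mu> = \<mu>] by (simp add: B_def B1_def)
  have l: "first_order K (\<lambda>\<epsilon> q. l \<epsilon> q \<mu>) (\<lambda>q. l1 q \<mu>)" for \<mu>
    using first_order_contract_last[OF K first_order_const[OF \<Lambda>] v, where r = p and \<mu> = \<mu>]
    by (simp add: l_def l1_def contract_last_def cong: if_cong)
  let ?fc = "\<lambda>q. full_contraction (g q) p"
  define kin where "kin \<epsilon> q = 1 / fact p * ((1/2 * ?fc q (E \<epsilon> q) (B \<epsilon> q) + - 1/2 * ?fc q (B \<epsilon> q) (B \<epsilon> q))
    + ?fc q (\<lambda>\<mu>. B \<epsilon> q \<mu> + l \<epsilon> q \<mu>) (\<lambda>\<mu>. B \<epsilon> q \<mu> + l \<epsilon> q \<mu>))" for \<epsilon> q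
  have kin: "first_order K kin (\<lambda>q. 1 / fact p * ((1/2 * (?fc q (E1 q) (B 0 q) + ?fc q (E 0 q) (B1 q))
      + - 1/2 * (?fc q (B1 q) (B 0 q) + ?fc q (B 0 q) (B1 q)))
      + (?fc q (\<lambda>\<mu>. B1 q \<mu> + l1 q \<mu>) (\<lambda>\<mu>. B 0 q \<mu> + l 0 q \<mu>)
        + ?fc q (\<lambda>\<mu>. B 0 q \<mu> + l 0 q \<mu>) (\<lambda>\<mu>. B1 q \<mu> + l1 q \<mu>))))"
    unfolding kin_def
    by (intro first_order_cmult first_order_add first_order_full_contraction K g E B l)
  have "continuous_on K (kin 0)" using kin by (rule first_orderE)
  hence "first_order K (\<lambda>\<epsilon> q. - kin 0 q) (\<lambda>q. 0)" by (intro first_order_const continuous_on_minus)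
  from first_order_add[OF kin this] show ?thesis
  proof (rule first_order_cong)
    fix \<epsilon> q
    have "lagrangian p V (g q) (w q + \<epsilon> *\<^sub>R w1 q) (\<lambda>\<mu>. F q \<mu> + \<epsilon> * dF q \<mu>) (\<Lambda> q) = kin \<epsilon> q - V (\<Lambda> q) (g q)" for \<epsilon>
      by (simp add: lagrangian_def Let_def kin_def E_def B_def l_def v_def hodge_add hodge_scale)
    from this[of \<epsilon>] this[of 0]
    show "kin \<epsilon> q + - kin 0 q = lagrangian p V (g q) (w q + \<epsilon> *\<^sub>R w1 q) (\<lambda>\<mu>. F q \<mu> + \<epsilon> * dF q \<mu>) (\<Lambda> q)
      - lagrangian p V (g q) (w q) (F q) (\<Lambda> q)" by simp
  qed (simp add: lagrangian_variation_def Let_def E_def B_def l_def E1_def B1_def l1_def v_def x_def)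
qed

lemma lagrangian_variation_eq:
  fixes F dF \<Lambda> :: "'d::{finite,linorder} tensor" and g :: "'d matrix"
  assumes card: "CARD('d) = 2 * Suc p" and "even p" and g: "lorentzian g" and neg: "covector_norm2 g w < 0"
    and F: "antisymmetric (Suc p) F" "tensor_of_rank (Suc p) F" and dF: "antisymmetric (Suc p) dF"
    and \<Lambda>: "antisymmetric (Suc p) \<Lambda>" "self_dual g (Suc p) \<Lambda>"
  defines "u \<equiv> unit_covector g w" and "v \<equiv> unit_vector g w"
  defines "G \<equiv> (\<lambda>\<mu>. contract_last p F v \<mu> + contract_last p (hodge g (Suc p) F) v \<mu> + 2 * contract_last p \<Lambda> v \<mu>)"
  shows "sqrt_minus_det g * lagrangian_variation p g w w1 F dF \<Lambda> = 1 / (fact p * fact (Suc p)) *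
    (- eps_pair p dF F / (2 * Suc p) + eps_cov p G u dF - Suc p / 2 * eps_cov2 p (covector_variation g w w1) u G G)"
proof -
  have "u \<bullet> v = -1" using inner_unit_covector[OF neg] by (simp add: u_def v_def unit_vector_def)
  from kinetic_variation[OF card \<open>even p\<close> g F dF \<Lambda> _ refl this inner_covector_variation[OF g neg, folded v_def], of w1]
  have "lagrangian_variation p g w w1 F dF \<Lambda> = 1 / fact p * (- (1 / (fact (Suc p) * sqrt_minus_det g)) / (2 * Suc p) * eps_pair p dF F
      + 1 / (fact (Suc p) * sqrt_minus_det g) * eps_cov p G u dF
      - 1 / (fact (Suc p) * sqrt_minus_det g) * Suc p / 2 * eps_cov2 p (covector_variation g w w1) u G G)"
    unfolding lagrangian_variation_def Let_def Suc_eq_plus1[symmetric] v_def[symmetric] G_def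
    by (simp add: u_def v_def unit_vector_def)
  thus ?thesis
    using sqrt_minus_det_pos[OF g] by (simp add: divide_simps del: fact_Suc of_nat_Suc) (simp add: algebra_simps)
qed


section \<open>Invariance of the action\<close>

locale action_setting = spacetime \<A> g
  for \<A> :: "('m::t2_space, 'd::{finite,linorder}) chart set" and g :: "('m, 'd) metric_field" +
  fixes vol :: "'m measure" and p :: nat and V :: "'d tensor \<Rightarrow> 'd matrix \<Rightarrow> real"
    and A \<Lambda> :: "('m, 'd) tensor_field" and a :: "'m \<Rightarrow> real"
  assumes volume: "volume_measure \<A> g vol"
    and card: "CARD('d) = 2 * Suc p" and even: "even p"
    and V: "scalar_function (p + 1) V"
    and A: "covariant_field \<A> p A"
    and a: "smooth_scalar \<A> a" and timelike: "timelike_gradient \<A> g a"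
    and \<Lambda>_form: "form_field \<A> (p + 1) \<Lambda>"
    and \<Lambda>_dual: "\<forall>c\<in>\<A>. \<forall>q\<in>dom_ch c. self_dual (g c q) (p + 1) (\<Lambda> c q)"
begin

lemma \<Lambda>_field: "covariant_field \<A> (Suc p) \<Lambda>"
  using \<Lambda>_form by (simp add: form_field_def)

lemma \<Lambda>_at:
  assumes "c \<in> \<A>" "q \<in> dom_ch c"
  shows "tensor_of_rank (Suc p) (\<Lambda> c q)" "antisymmetric (Suc p) (\<Lambda> c q)" "self_dual (g c q) (Suc p) (\<Lambda> c q)"
  using assms \<Lambda>_form \<Lambda>_dual covariant_fieldD(1)[OF \<Lambda>_field assms] by (auto simp: form_field_def)

lemma norm_neg: "c \<in> \<A> \<Longrightarrow> q \<in> dom_ch c \<Longrightarrow> covector_norm2 (g c q) (gradient c a q) < 0"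
  using timelike unfolding timelike_gradient_def by blast

lemma chart_at: "chart_at \<A> q \<in> \<A>" "q \<in> dom_ch (chart_at \<A> q)"
proof -
  have "\<exists>c. c \<in> \<A> \<and> q \<in> dom_ch c" using atlas unfolding oriented_atlas_def by blast
  from someI_ex[OF this] show "chart_at \<A> q \<in> \<A>" "q \<in> dom_ch (chart_at \<A> q)"
    by (simp_all add: chart_at_def)
qed

text \<open>\<open>chart_at\<close> need not vary continuously from point to point; this permits the
  use of one fixed chart throughout a compact piece of the region.\<close>

lemma lagrangian_field_in_chart:
  assumes A': "covariant_field \<A> p A'" and a': "smooth_scalar \<A> a'" and c: "c \<in> \<A>" "q \<in> dom_ch c"
  shows "lagrangian_field \<A> g p V A' a' \<Lambda> q
    = lagrangian p V (g c q) (gradient c a' q) (field_strength p A' c q) (\<Lambda> c q)"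
proof -
  let ?c = "chart_at \<A> q"
  note c' = chart_at[of q]
  define J where "J = jacobian ?c c q"
  have J: "det J > 0" using det_jacobian_pos[OF c'(1) c(1) c'(2) c(2)] by (simp add: J_def)
  have "gradient ?c a' q = transpose J *v gradient c a' q"
    using covector_fieldD(2)[OF covector_field_gradient[OF a'] c'(1) c(1) c'(2) c(2)] unfolding J_def .
  moreover have "field_strength p A' ?c q = pull (p + 1) J (field_strength p A' c q)"
    using covariant_fieldD(3)[OF covariant_field_field_strength[OF A'] c'(1) c(1) c'(2) c(2)] by (simp add: J_def)
  moreover have "\<Lambda> ?c q = pull (p + 1) J (\<Lambda> c q)"
    using covariant_fieldD(3)[OF \<Lambda>_field c'(1) c(1) c'(2) c(2)] by (simp add: J_def)
  moreover have "g ?c q = pull_metric J (g c q)"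
    using metricD(3)[OF c'(1) c(1) c'(2) c(2)] by (simp add: J_def)
  moreover have "lagrangian p V (pull_metric J (g c q)) (transpose J *v gradient c a' q)
      (pull (p + 1) J (field_strength p A' c q)) (pull (p + 1) J (\<Lambda> c q))
    = lagrangian p V (g c q) (gradient c a' q) (field_strength p A' c q) (\<Lambda> c q)"
    by (rule lagrangian_pull[OF card J metricD(1)[OF c] V]) (use \<Lambda>_at[OF c] in simp_all)
  ultimately show ?thesis by (simp only: lagrangian_field_def Let_def)
qed

lemma gradient_perturbed:
  assumes \<phi>: "smooth_scalar \<A> \<phi>" and c: "c \<in> \<A>" "q \<in> dom_ch c"
  shows "gradient c (\<lambda>q. a q + \<epsilon> * \<phi> q) q = gradient c a q + \<epsilon> *\<^sub>R gradient c \<phi> q"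
  using chart_smooth_diff[OF smooth_scalarD[OF a c(1)] c(2)] chart_smooth_diff[OF smooth_scalarD[OF \<phi> c(1)] c(2)]
  by (simp add: gradient_def vec_eq_iff chart_partial_add chart_partial_cmult chart_diff_mult)

lemma field_strength_perturbed:
  assumes dA: "covariant_field \<A> p dA" and c: "c \<in> \<A>" "q \<in> dom_ch c"
  shows "field_strength p (\<lambda>c q \<mu>. A c q \<mu> + \<epsilon> * dA c q \<mu>) c q
    = (\<lambda>\<mu>. field_strength p A c q \<mu> + \<epsilon> * field_strength p dA c q \<mu>)"
  using chart_smooth_diff[OF covariant_fieldD(2)[OF A c(1)] c(2)]
    chart_smooth_diff[OF covariant_fieldD(2)[OF dA c(1)] c(2)]
  by (simp add: field_strength_eq chart_partial_add chart_partial_cmult chart_diff_mult antisymmetrize_add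
      antisymmetrize_scale algebra_simps)

lemma smooth_scalar_perturbed: "smooth_scalar \<A> \<phi> \<Longrightarrow> smooth_scalar \<A> (\<lambda>q. a q + \<epsilon> * \<phi> q)"
  unfolding smooth_scalar_def smooth_in_chart_iff
  by (intro ballI chart_smooth_add chart_smooth_mult chart_smooth_const chart_dom)
     (auto intro: smooth_scalarD a simp: smooth_scalar_def smooth_in_chart_iff)

text \<open>Reduces invariance to a pointwise identity in a chart: the exterior derivative of a form
  X of degree d - 1 equals the density of the first variation. The boundary current is the dual of
  X, so it vanishes wherever X does.\<close>

theorem invariance_criterion:
  assumes dA: "covariant_field \<A> p dA" and \<phi>: "smooth_scalar \<A> \<phi>"
    and X: "covariant_field \<A> (CARD('d) - 1) X"
    and local: "\<And>c q. c \<in> \<A> \<Longrightarrow> q \<in> dom_ch c \<Longrightarrow> q \<in> Z \<Longrightarrow> X c q = (\<lambda>\<mu>. 0)"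
    and div: "\<And>c q. c \<in> \<A> \<Longrightarrow> q \<in> dom_ch c \<Longrightarrow>
      (\<Sum>\<sigma>\<in>UNIV. \<Sum>\<mu> | length \<mu> = CARD('d) - 1. levi_civita (\<sigma> # \<mu>) * chart_partial c \<sigma> (\<lambda>q. X c q \<mu>) q)
      = sqrt_minus_det (g c q) * lagrangian_variation p (g c q) (gradient c a q) (gradient c \<phi> q)
          (field_strength p A c q) (field_strength p dA c q) (\<Lambda> c q)"
  shows "invariant_up_to_boundary_terms \<A> g vol p V A a \<Lambda> dA \<phi> (\<lambda>c q \<mu>s. 0) Z"
  unfolding invariant_up_to_boundary_terms_def
proof (intro exI[of _ "current X"] conjI ballI allI impI)
  show "contravariant_vector_field \<A> (current X)" using X by (rule contravariant_vector_field_current)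
next
  fix c q assume "c \<in> \<A>" "q \<in> dom_ch c \<inter> interior Z"
  hence "X c q = (\<lambda>\<mu>. 0)" using local interior_subset by blast
  thus "current X c q = 0" by (simp add: current_def vec_eq_iff)
next
  fix C assume C: "compact C \<and> set_integrable vol C (lagrangian_field \<A> g p V A a \<Lambda>)"
  define LV where "LV c q = lagrangian_variation p (g c q) (gradient c a q) (gradient c \<phi> q)
          (field_strength p A c q) (field_strength p dA c q) (\<Lambda> c q)" for c q
  define L where "L \<epsilon> = lagrangian_field \<A> g p V (\<lambda>c q \<mu>s. A c q \<mu>s + \<epsilon> * dA c q \<mu>s) (\<lambda>q. a q + \<epsilon> * \<phi> q) \<Lambda>" for \<epsilon>
  \<comment> \<open>The arbitrary function \<open>V\<close> cancels in this difference;
    \<open>L 0\<close> is only known to be integrable over C.\<close>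
  define h where "h \<epsilon> q = L \<epsilon> q - L 0 q" for \<epsilon> q
  have div': "divergence g (current X) c q = LV c q" if c: "c \<in> \<A>" and q: "q \<in> dom_ch c" for c q
  proof -
    note sX = covariant_fieldD(2)[OF X c]
    have "chart_partial c \<sigma> (\<lambda>q. sqrt_minus_det (g c q) * current X c q $ \<sigma>) q
        = (\<Sum>\<mu> | length \<mu> = CARD('d) - 1. levi_civita (\<sigma> # \<mu>) * chart_partial c \<sigma> (\<lambda>q. X c q \<mu>) q)" for \<sigma>
    proof -
      have "chart_partial c \<sigma> (\<lambda>q. sqrt_minus_det (g c q) * current X c q $ \<sigma>) q
        = chart_partial c \<sigma> (\<lambda>q. \<Sum>\<mu> | length \<mu> = CARD('d) - 1. levi_civita (\<sigma> # \<mu>) * X c q \<mu>) q"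
        by (rule chart_partial_cong[OF chart_dom[OF c] q])
           (use sqrt_minus_det_metric_nz[OF c] in \<open>simp add: current_def\<close>)
      thus ?thesis using chart_smooth_diff[OF sX q]
        by (simp add: chart_partial_sum chart_partial_cmult chart_diff_mult)
    qed
    hence "divergence g (current X) c q = 1 / sqrt_minus_det (g c q) * (sqrt_minus_det (g c q) * LV c q)"
      unfolding divergence_def LV_def div[OF c q, symmetric] by simp
    thus ?thesis using sqrt_minus_det_metric_nz[OF c q] by simp
  qed
  have L_chart: "L \<epsilon> q = lagrangian p V (g c q) (gradient c a q + \<epsilon> *\<^sub>R gradient c \<phi> q)
      (\<lambda>\<mu>. field_strength p A c q \<mu> + \<epsilon> * field_strength p dA c q \<mu>) (\<Lambda> c q)"
    if c: "c \<in> \<A>" "q \<in> dom_ch c" for c q \<epsilon>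
    unfolding L_def
    by (subst lagrangian_field_in_chart[OF covariant_field_add[OF A covariant_field_cscale[OF dA]]
          smooth_scalar_perturbed[OF \<phi>] c])
       (simp only: gradient_perturbed[OF \<phi> c] field_strength_perturbed[OF dA c])
  have fo: "first_order K h (LV c)" if c: "c \<in> \<A>" and K: "compact K" "K \<subseteq> dom_ch c" for c K
  proof -
    have cont: "continuous_on K f" if "chart_smooth c (dom_ch c) f" for f
      by (rule continuous_on_subset[OF chart_smooth_continuous[OF chart_dom[OF c] that] K(2)])
    have Fs: "covariant_field \<A> (p + 1) (field_strength p A)" "covariant_field \<A> (p + 1) (field_strength p dA)"
      using covariant_field_field_strength[OF A] covariant_field_field_strength[OF dA] by simp_all
    have card': "CARD('d) = 2 * (p + 1)" using card by simp
    have "first_order K (\<lambda>\<epsilon> q. lagrangian p V (g c q) (gradient c a q + \<epsilon> *\<^sub>R gradient c \<phi> q)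
        (\<lambda>\<mu>. field_strength p A c q \<mu> + \<epsilon> * field_strength p dA c q \<mu>) (\<Lambda> c q)
        - lagrangian p V (g c q) (gradient c a q) (field_strength p A c q) (\<Lambda> c q)) (LV c)"
      unfolding LV_def
      by (intro first_order_lagrangian K cont smooth_inverse_metric c covector_fieldD(1)[OF covector_field_gradient]
          a \<phi> covariant_fieldD(2)[OF Fs(1)] covariant_fieldD(2)[OF Fs(2)] covariant_fieldD(2)[OF \<Lambda>_field]
          covariant_fieldD(2)[OF covariant_field_hodge[OF card' Fs(1)]]
          covariant_fieldD(2)[OF covariant_field_hodge[OF card' Fs(2)]])
         (use K(2) metricD(1)[OF c] norm_neg[OF c] in blast)+
    thus ?thesis
    proof (rule first_order_cong)
      fix \<epsilon> q assume "q \<in> K"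
      hence q: "q \<in> dom_ch c" using K(2) by blast
      show "lagrangian p V (g c q) (gradient c a q + \<epsilon> *\<^sub>R gradient c \<phi> q)
          (\<lambda>\<mu>. field_strength p A c q \<mu> + \<epsilon> * field_strength p dA c q \<mu>) (\<Lambda> c q)
          - lagrangian p V (g c q) (gradient c a q) (field_strength p A c q) (\<Lambda> c q) = h \<epsilon> q"
        unfolding h_def L_chart[OF c q] by simp
    qed simp
  qed
  \<comment> \<open>The function \<open>h\<close> does not refer to the chart c, and at a single
    point its derivative in \<epsilon> is \<open>LV\<close> in each chart. Uniqueness of derivatives
    thus replaces a transformation law for the variation.\<close>
  have LV_chart: "LV c q = LV (chart_at \<A> q) q" if "c \<in> \<A>" "q \<in> dom_ch c" for c q
    using first_order_imp_DERIV[OF fo[of c "{q}"], of q] first_order_imp_DERIV[OF fo[of "chart_at \<A> q" "{q}"], of q]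
      that chart_at[of q] by (auto intro: DERIV_unique)
  obtain \<F> where \<F>: "finite \<F>" "\<Union>\<F> = C" "\<And>K. K \<in> \<F> \<Longrightarrow> compact K \<and> (\<exists>c\<in>\<A>. K \<subseteq> dom_ch c)"
    using compact_chart_cover[OF atlas, of C] C by blast
  have "first_order K h (\<lambda>q. divergence g (current X) (chart_at \<A> q) q)" if "K \<in> \<F>" for K
  proof -
    obtain c where c: "c \<in> \<A>" "K \<subseteq> dom_ch c" "compact K" using \<F>(3)[OF \<open>K \<in> \<F>\<close>] by blast
    show ?thesis
      by (rule first_order_cong[OF fo[OF c(1,3,2)]])
         (use c(2) LV_chart[OF c(1)] div' chart_at in auto)
  qed
  hence fo_C: "first_order C h (\<lambda>q. divergence g (current X) (chart_at \<A> q) q)"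
    using first_order_Union[OF \<F>(1), of h] \<F>(2,3) compact_imp_closed by blast
  have "((\<lambda>\<epsilon>. LINT q:C|vol. L \<epsilon> q) has_real_derivative
      (LINT q:C|vol. divergence g (current X) (chart_at \<A> q) q)) (at 0)"
  proof (rule set_integral_first_order[OF _ _ _ _ fo_C])
    show "sets vol = sets borel" using volume by (simp add: volume_measure_def)
    show "compact C" using C by simp
    show "emeasure vol C < \<infinity>" using volume_compact_finite[OF atlas metric volume] C by simp
    show "set_integrable vol C (L 0)" using C by (simp add: L_def)
  qed (simp_all add: h_def)
  thus "((\<lambda>\<epsilon>. action \<A> g vol p V C (\<lambda>c q \<mu>s. A c q \<mu>s + \<epsilon> * dA c q \<mu>s) (\<lambda>q. a q + \<epsilon> * \<phi> q)
        (\<lambda>c q \<mu>s. \<Lambda> c q \<mu>s + \<epsilon> * 0)) has_real_derivative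
      (LINT q:C|vol. divergence g (current X) (chart_at \<A> q) q)) (at 0)"
    by (simp add: action_def L_def)
qed

text \<open>The factor N in v = N da, which is the lapse function of the foliation by the level sets
  of a.\<close>

definition lapse :: "('m, 'd) chart \<Rightarrow> 'm \<Rightarrow> real" where
  "lapse c q = 1 / sqrt (- covector_norm2 (g c q) (gradient c a q))"

definition normal :: "('m, 'd) vector_field" where
  "normal c q = unit_covector (g c q) (gradient c a q)"

definition normal_vector :: "('m, 'd) vector_field" where
  "normal_vector c q = unit_vector (g c q) (gradient c a q)"

lemma normal_eq: "normal c q $ \<mu> = lapse c q * chart_partial c \<mu> a q"
  by (simp add: normal_def unit_covector_def lapse_def gradient_def)

lemma gradient_change:
  "c \<in> \<A> \<Longrightarrow> c' \<in> \<A> \<Longrightarrow> q \<in> dom_ch c \<Longrightarrow> q \<in> dom_ch c' \<Longrightarrow>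
    gradient c a q = transpose (jacobian c c' q) *v gradient c' a q"
  by (rule covector_fieldD(2)[OF covector_field_gradient[OF a]])

lemma scalar_field_lapse: "scalar_field \<A> lapse"
  unfolding scalar_field_def smooth_in_chart_iff
proof (intro conjI ballI)
  fix c assume c: "c \<in> \<A>"
  note s = covector_fieldD(1)[OF covector_field_gradient[OF a] c] smooth_inverse_metric[OF c]
  show "chart_smooth c (dom_ch c) (lapse c)"
    unfolding lapse_def[abs_def] covector_norm2_def inner_vec_def matrix_vector_mult_def vec_lambda_beta inner_real_def
  proof (intro chart_smooth_divide chart_smooth_sqrt chart_smooth_minus chart_smooth_sum chart_smooth_mult
      chart_smooth_const chart_dom c s)
    fix q assume "q \<in> dom_ch c"
    from norm_neg[OF c this]
    show "- (\<Sum>i\<in>UNIV. gradient c a q $ i * (\<Sum>j\<in>UNIV. matrix_inv (g c q) $ i $ j * gradient c a q $ j)) > 0"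
      by (simp add: covector_norm2_def inner_vec_def matrix_vector_mult_def)
    thus "sqrt (- (\<Sum>i\<in>UNIV. gradient c a q $ i * (\<Sum>j\<in>UNIV. matrix_inv (g c q) $ i $ j * gradient c a q $ j))) \<noteq> 0"
      by simp
  qed
next
  fix c c' q assume c: "c \<in> \<A>" "c' \<in> \<A>" and "q \<in> dom_ch c \<inter> dom_ch c'"
  hence q: "q \<in> dom_ch c" "q \<in> dom_ch c'" by auto
  have J: "det (jacobian c c' q) \<noteq> 0" using det_jacobian_pos[OF c q] by simp
  show "lapse c q = lapse c' q"
    unfolding lapse_def gradient_change[OF c q] metricD(3)[OF c q] covector_norm2_pull[OF J metricD(1)[OF c(2) q(2)]] ..
qed

lemma covector_field_normal: "covector_field \<A> normal"
  unfolding covector_field_def smooth_in_chart_iff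
proof (intro conjI ballI allI)
  fix c \<mu> assume c: "c \<in> \<A>"
  show "chart_smooth c (dom_ch c) (\<lambda>q. normal c q $ \<mu>)"
    unfolding normal_eq
    by (intro chart_smooth_mult scalar_fieldD(1)[OF scalar_field_lapse] chart_smooth_partial smooth_scalarD[OF a] chart_dom c)
next
  fix c c' q assume c: "c \<in> \<A>" "c' \<in> \<A>" and "q \<in> dom_ch c \<inter> dom_ch c'"
  hence q: "q \<in> dom_ch c" "q \<in> dom_ch c'" by auto
  have J: "det (jacobian c c' q) \<noteq> 0" using det_jacobian_pos[OF c q] by simp
  show "normal c q = transpose (jacobian c c' q) *v normal c' q"
    unfolding normal_def gradient_change[OF c q] metricD(3)[OF c q] unit_covector_pull[OF J metricD(1)[OF c(2) q(2)]] ..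
qed

lemma contravariant_vector_field_normal_vector: "contravariant_vector_field \<A> normal_vector"
  unfolding contravariant_vector_field_def smooth_in_chart_iff
proof (intro conjI ballI allI)
  fix c \<mu> assume c: "c \<in> \<A>"
  have "chart_smooth c (dom_ch c) (\<lambda>q. \<Sum>j\<in>UNIV. matrix_inv (g c q) $ \<mu> $ j * normal c q $ j)"
    by (intro chart_smooth_sum chart_smooth_mult covector_fieldD(1)[OF covector_field_normal] smooth_inverse_metric chart_dom c)
  thus "chart_smooth c (dom_ch c) (\<lambda>q. normal_vector c q $ \<mu>)"
    by (simp add: normal_vector_def unit_vector_def normal_def matrix_vector_mult_def)
next
  fix c c' q assume c: "c \<in> \<A>" "c' \<in> \<A>" and "q \<in> dom_ch c \<inter> dom_ch c'"
  hence q: "q \<in> dom_ch c" "q \<in> dom_ch c'" by auto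
  have J: "det (jacobian c c' q) \<noteq> 0" using det_jacobian_pos[OF c q] by simp
  show "normal_vector c' q = jacobian c c' q *v normal_vector c q"
    unfolding normal_vector_def gradient_change[OF c q] metricD(3)[OF c q] unit_vector_pull[OF J metricD(1)[OF c(2) q(2)]] ..
qed

text \<open>The combination E + B + 2\<lambda> is both the coefficient of \<delta>F in the variation
  and, up to a scalar factor, \<delta>A in the second transformation.\<close>

definition G :: "('m, 'd) tensor_field" where
  "G c q = (\<lambda>\<mu>. contract_last p (field_strength p A c q) (normal_vector c q) \<mu>
     + contract_last p (hodge (g c q) (Suc p) (field_strength p A c q)) (normal_vector c q) \<mu>
     + 2 * contract_last p (\<Lambda> c q) (normal_vector c q) \<mu>)"

lemma covariant_field_G: "covariant_field \<A> p G"
  unfolding G_def[abs_def]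
  by (intro covariant_field_add covariant_field_cscale covariant_field_contract_last
      contravariant_vector_field_normal_vector covariant_field_hodge card covariant_field_field_strength A \<Lambda>_field)

text \<open>The normalization part of the variation of v is parallel to da and dies in the wedge
  with v, so N d\<phi> alone remains of w.\<close>

lemma variation_eq:
  assumes c: "c \<in> \<A>" "q \<in> dom_ch c"
  shows "sqrt_minus_det (g c q) * lagrangian_variation p (g c q) (gradient c a q) (gradient c \<phi> q)
          (field_strength p A c q) (field_strength p dA c q) (\<Lambda> c q)
    = 1 / (fact p * fact (Suc p)) * (- eps_pair p (field_strength p dA c q) (field_strength p A c q) / (2 * Suc p)
      + Suc p * wedge4 p (\<lambda>\<mu> \<rho> \<sigma> \<nu>. G c q \<mu> * normal c q $ \<rho> * chart_partial c \<sigma> (\<lambda>q. dA c q \<nu>) q)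
      + Suc p / 2 * (lapse c q * wedge4 p (\<lambda>\<mu> \<rho> \<sigma> \<nu>. G c q \<mu> * normal c q $ \<rho> * chart_partial c \<sigma> \<phi> q * G c q \<nu>)))"
proof -
  let ?da = "gradient c a q" and ?g = "g c q"
  define k where "k = (?da \<bullet> (matrix_inv ?g *v gradient c \<phi> q)) /
      ((- covector_norm2 ?g ?da) * sqrt (- covector_norm2 ?g ?da))"
  have k: "covector_variation ?g ?da (gradient c \<phi> q) = lapse c q *\<^sub>R gradient c \<phi> q + k *\<^sub>R ?da"
    by (simp add: covector_variation_def lapse_def k_def)
  have "wedge4 p (\<lambda>\<mu> \<rho> \<sigma> \<nu>. G c q \<mu> * normal c q $ \<rho> * covector_variation ?g ?da (gradient c \<phi> q) $ \<sigma> * G c q \<nu>)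
      = wedge4 p (\<lambda>\<mu> \<rho> \<sigma> \<nu>. lapse c q * (G c q \<mu> * normal c q $ \<rho> * chart_partial c \<sigma> \<phi> q * G c q \<nu>)
          + k * (G c q \<mu> * normal c q $ \<rho> * chart_partial c \<sigma> a q * G c q \<nu>))"
    by (rule wedge4_cong, unfold k) (simp add: gradient_def algebra_simps)
  also have "\<dots> = lapse c q * wedge4 p (\<lambda>\<mu> \<rho> \<sigma> \<nu>. G c q \<mu> * normal c q $ \<rho> * chart_partial c \<sigma> \<phi> q * G c q \<nu>)"
    unfolding wedge4_add wedge4_scale
    using wedge4_symmetric[OF card, of "\<lambda>\<mu> \<rho> \<sigma> \<nu>. G c q \<mu> * normal c q $ \<rho> * chart_partial c \<sigma> a q * G c q \<nu>"]
    by (simp add: normal_eq mult_ac)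
  finally have Q: "eps_cov2 p (covector_variation ?g ?da (gradient c \<phi> q)) (normal c q) (G c q) (G c q)
      = - (lapse c q * wedge4 p (\<lambda>\<mu> \<rho> \<sigma> \<nu>. G c q \<mu> * normal c q $ \<rho> * chart_partial c \<sigma> \<phi> q * G c q \<nu>))"
    by (simp add: eps_cov2_eq_wedge4[OF card even])
  have F: "tensor_of_rank (Suc p) (field_strength p A c q)"
    by (rule covariant_fieldD(1)[OF covariant_field_field_strength[OF A] c])
  show ?thesis
    using lagrangian_variation_eq[OF card even metricD(1)[OF c] norm_neg[OF c] antisymmetric_field_strength[of p A c q] F
        antisymmetric_field_strength[of p dA c q] \<Lambda>_at(2,3)[OF c], of "gradient c \<phi> q"]
    unfolding G_def[symmetric] normal_vector_def[symmetric] normal_def[symmetric]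
    by (simp add: Q eps_cov_field_strength[OF card] del: fact_Suc of_nat_Suc)
qed

text \<open>The two boundary terms, as forms of degree \<open>d - 1\<close>: \<open>\<delta>A \<and> F\<close> absorbs the asymmetry of
  \<open>\<delta>E\<cdot>B\<close> and \<open>E\<cdot>\<delta>B\<close>, and \<open>\<phi> N v \<and> G \<and> G\<close> (with \<open>v = N da\<close>) what remains of \<open>G\<cdot>\<delta>B\<close>.\<close>

definition chern_simons :: "('m, 'd) tensor_field \<Rightarrow> ('m, 'd) tensor_field" where
  "chern_simons dA c q = (\<lambda>\<mu>. - 1 / (2 * fact p * fact (Suc p)) * (dA c q (take p \<mu>) * field_strength p A c q (drop p \<mu>)))"

lemma covariant_field_chern_simons:
  assumes "covariant_field \<A> p dA"
  shows "covariant_field \<A> (CARD('d) - 1) (chern_simons dA)"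
proof -
  have "CARD('d) - 1 = p + Suc p" using card by simp
  thus ?thesis unfolding chern_simons_def[abs_def]
    by (simp only:) (intro covariant_field_cscale covariant_field_outer covariant_field_field_strength A assms)
qed

lemma divergence_chern_simons:
  assumes dA: "covariant_field \<A> p dA" and c: "c \<in> \<A>" "q \<in> dom_ch c"
  shows "(\<Sum>\<sigma>\<in>UNIV. \<Sum>\<mu> | length \<mu> = CARD('d) - 1. levi_civita (\<sigma> # \<mu>) * chart_partial c \<sigma> (\<lambda>q. chern_simons dA c q \<mu>) q)
    = 1 / (fact p * fact (Suc p)) * (- eps_pair p (field_strength p dA c q) (field_strength p A c q) / (2 * Suc p))"
proof -
  \<comment> \<open>The exterior derivative of \<delta>A \<and> F carries a factor 1/(p + 1), the
    same as the pairing term of the variation, so k only has to supply the remaining -1/2 and the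
    two factorials.\<close>
  define k :: real where "k = - 1 / (2 * fact p * fact (Suc p))"
  have diff: "chart_diff c (\<lambda>q. dA c q \<mu> * field_strength p A c q \<nu>) q" for \<mu> \<nu>
    by (intro chart_diff_mult chart_smooth_diff[OF covariant_fieldD(2)[OF dA c(1)] c(2)]
        chart_smooth_diff[OF covariant_fieldD(2)[OF covariant_field_field_strength[OF A] c(1)] c(2)])
  have "(\<Sum>\<sigma>\<in>UNIV. \<Sum>\<mu> | length \<mu> = CARD('d) - 1. levi_civita (\<sigma> # \<mu>) * chart_partial c \<sigma> (\<lambda>q. chern_simons dA c q \<mu>) q)
    = k * (\<Sum>\<sigma>\<in>UNIV. \<Sum>\<mu> | length \<mu> = CARD('d) - 1. levi_civita (\<sigma> # \<mu>) *
      chart_partial c \<sigma> (\<lambda>q. dA c q (take p \<mu>) * field_strength p A c q (drop p \<mu>)) q)"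
    unfolding chern_simons_def k_def[symmetric]
    by (simp add: chart_partial_cmult[OF diff] sum_distrib_left mult_ac)
  thus ?thesis unfolding divergence_potential_field_strength[OF card A dA c] k_def
    by (simp del: fact_Suc of_nat_Suc mult_Suc_right)
qed

text \<open>The second summand is symmetric in the derivative index and the component, so it
  disappears in every wedge; the first is proportional to v again.\<close>

lemma normal_partial:
  assumes c: "c \<in> \<A>" "q \<in> dom_ch c"
  shows "chart_partial c \<sigma> (\<lambda>q. normal c q $ \<tau>) q
    = (chart_partial c \<sigma> (lapse c) q / lapse c q) * normal c q $ \<tau>
      + lapse c q * chart_partial c \<sigma> (chart_partial c \<tau> a) q"
proof -
  have "lapse c q \<noteq> 0" using norm_neg[OF c] by (simp add: lapse_def)
  moreover have "chart_diff c (lapse c) q" "chart_diff c (chart_partial c \<tau> a) q"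
    by (rule chart_smooth_diff[OF _ c(2)], intro scalar_fieldD(1)[OF scalar_field_lapse] chart_smooth_partial
        smooth_scalarD[OF a] chart_dom c)+
  ultimately show ?thesis unfolding normal_eq
    by (simp add: chart_partial_mult[OF chart[OF c(1)] c(2)])
qed

section \<open>The first transformation\<close>

lemma invariance_psi:
  assumes p: "p = Suc k" and \<psi>: "covariant_field \<A> (p - 1) \<psi>"
    and Z: "\<And>c q. c \<in> \<A> \<Longrightarrow> q \<in> dom_ch c \<Longrightarrow> q \<in> Z \<Longrightarrow> \<psi> c q = (\<lambda>\<mu>. 0)"
  shows "invariant_up_to_boundary_terms \<A> g vol p V A a \<Lambda> (delta_A_psi g p a \<psi>) (\<lambda>q. 0) (\<lambda>c q \<mu>s. 0) Z"
proof -
  let ?dA = "delta_A_psi g p a \<psi>"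
  have dA_eq: "?dA c q \<mu> = real p * antisymmetrize p (\<lambda>\<nu>. normal c q $ hd \<nu> * \<psi> c q (tl \<nu>)) \<mu>" for c q \<mu>
    by (simp add: delta_A_psi_def normal_def)
  have dA: "covariant_field \<A> p ?dA"
  proof -
    have "covariant_field \<A> (1 + (p - 1)) (\<lambda>c q \<mu>. covector_tensor (normal c q) (take 1 \<mu>) * \<psi> c q (drop 1 \<mu>))"
      by (intro covariant_field_outer covariant_field_covector covector_field_normal \<psi>)
    hence "covariant_field \<A> p (\<lambda>c q \<mu>. real p * antisymmetrize p (\<lambda>\<mu>. covector_tensor (normal c q) (take 1 \<mu>) * \<psi> c q (drop 1 \<mu>)) \<mu>)"
      using p by (intro covariant_field_cscale covariant_field_antisymmetrize) simp
    moreover have "antisymmetrize p (\<lambda>\<mu>. covector_tensor (normal c q) (take 1 \<mu>) * \<psi> c q (drop 1 \<mu>)) \<mu>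
        = antisymmetrize p (\<lambda>\<nu>. normal c q $ hd \<nu> * \<psi> c q (tl \<nu>)) \<mu>" for c q \<mu>
    proof (rule antisymmetrize_cong)
      fix \<nu> :: "'d list" assume "length \<nu> = p"
      then obtain b \<nu>' where "\<nu> = b # \<nu>'" using p by (metis length_Suc_conv)
      thus "covector_tensor (normal c q) (take 1 \<nu>) * \<psi> c q (drop 1 \<nu>) = normal c q $ hd \<nu> * \<psi> c q (tl \<nu>)"
        by (simp add: covector_tensor_def)
    qed
    ultimately show ?thesis by (simp add: dA_eq[abs_def])
  qed
  have zero: "smooth_scalar \<A> (\<lambda>q. 0)"
    unfolding smooth_scalar_def smooth_in_chart_iff by (auto intro: chart_smooth_const chart_dom)
  show ?thesis
  proof (rule invariance_criterion[OF dA zero covariant_field_chern_simons[OF dA]])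
    fix c q assume c: "c \<in> \<A>" "q \<in> dom_ch c" and "q \<in> Z"
    hence "?dA c q \<mu> = 0" for \<mu> using Z[OF c] by (simp add: dA_eq antisymmetrize_def)
    thus "chern_simons ?dA c q = (\<lambda>\<mu>. 0)" by (simp add: chern_simons_def)
  next
    fix c q assume c: "c \<in> \<A>" "q \<in> dom_ch c"
    note W = chart_dom[OF c(1)]
    have d: "chart_diff c (\<lambda>q. ?dA c q \<nu>) q" "chart_diff c (\<lambda>q. \<psi> c q \<nu>) q" "chart_diff c (\<lambda>q. normal c q $ \<tau>) q" for \<nu> \<tau>
      by (rule chart_smooth_diff[OF _ c(2)], intro covariant_fieldD(2)[OF dA] covariant_fieldD(2)[OF \<psi>]
          covector_fieldD(1)[OF covector_field_normal] c)+
    let ?u = "normal c q" and ?l = "\<lambda>\<sigma>. chart_partial c \<sigma> (lapse c) q / lapse c q"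
    let ?S = "\<lambda>\<sigma> \<tau>. lapse c q * chart_partial c \<sigma> (chart_partial c \<tau> a) q"
    let ?d\<psi> = "\<lambda>\<sigma> \<nu>. chart_partial c \<sigma> (\<lambda>q. \<psi> c q \<nu>) q"
    have S: "?S \<sigma> \<tau> = ?S \<tau> \<sigma>" for \<sigma> \<tau>
      using chart_partial_commute[OF W c(2) smooth_scalarD[OF a c(1)]] by simp
    \<comment> \<open>The symbol absorbs the antisymmetrization in \<delta>A before the derivative
      is taken, so the product rule is applied to the plain product of v and \<psi>.\<close>
    have row: "(\<Sum>\<nu> | length \<nu> = p. levi_civita (\<mu> @ \<rho> # \<sigma> # \<nu>) * chart_partial c \<sigma> (\<lambda>q. ?dA c q \<nu>) q)
        = (\<Sum>\<nu> | length \<nu> = p. levi_civita (\<mu> @ \<rho> # \<sigma> # \<nu>) * (p * chart_partial c \<sigma> (\<lambda>q. normal c q $ hd \<nu> * \<psi> c q (tl \<nu>)) q))"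
      if \<mu>: "length \<mu> = p" for \<mu> and \<rho> \<sigma> :: 'd
    proof -
      have anti: "antisymmetric p (\<lambda>\<nu>. levi_civita (\<mu> @ \<rho> # \<sigma> # \<nu>))"
        using antisymmetric_levi_civita_block[of "\<mu> @ [\<rho>, \<sigma>]" p "[]"] \<mu> card by simp
      have "(\<Sum>\<nu> | length \<nu> = p. levi_civita (\<mu> @ \<rho> # \<sigma> # \<nu>) * ?dA c q \<nu>)
          = (\<Sum>\<nu> | length \<nu> = p. levi_civita (\<mu> @ \<rho> # \<sigma> # \<nu>) * (p * (normal c q $ hd \<nu> * \<psi> c q (tl \<nu>))))" for q
      proof -
        have "(\<Sum>\<nu> | length \<nu> = p. levi_civita (\<mu> @ \<rho> # \<sigma> # \<nu>) * ?dA c q \<nu>)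
            = p * (\<Sum>\<nu> | length \<nu> = p. levi_civita (\<mu> @ \<rho> # \<sigma> # \<nu>) * antisymmetrize p (\<lambda>\<nu>. normal c q $ hd \<nu> * \<psi> c q (tl \<nu>)) \<nu>)"
          by (simp add: dA_eq sum_distrib_left mult_ac)
        thus ?thesis unfolding sum_antisymmetric_antisymmetrize[OF anti] by (simp add: sum_distrib_left mult_ac)
      qed
      hence "chart_partial c \<sigma> (\<lambda>q. \<Sum>\<nu> | length \<nu> = p. levi_civita (\<mu> @ \<rho> # \<sigma> # \<nu>) * ?dA c q \<nu>) q
          = chart_partial c \<sigma> (\<lambda>q. \<Sum>\<nu> | length \<nu> = p. levi_civita (\<mu> @ \<rho> # \<sigma> # \<nu>) * (p * (normal c q $ hd \<nu> * \<psi> c q (tl \<nu>)))) q"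
        by simp
      thus ?thesis by (simp add: chart_partial_sum chart_partial_cmult chart_diff_mult d)
    qed
    have "wedge4 p (\<lambda>\<mu> \<rho> \<sigma> \<nu>. G c q \<mu> * ?u $ \<rho> * chart_partial c \<sigma> (\<lambda>q. ?dA c q \<nu>) q)
        = (\<Sum>\<mu> | length \<mu> = p. \<Sum>\<rho>\<in>UNIV. \<Sum>\<sigma>\<in>UNIV. G c q \<mu> * ?u $ \<rho> *
            (\<Sum>\<nu> | length \<nu> = p. levi_civita (\<mu> @ \<rho> # \<sigma> # \<nu>) * chart_partial c \<sigma> (\<lambda>q. ?dA c q \<nu>) q))"
      by (simp add: wedge4_def sum_distrib_left mult_ac)
    also have "\<dots> = (\<Sum>\<mu> | length \<mu> = p. \<Sum>\<rho>\<in>UNIV. \<Sum>\<sigma>\<in>UNIV. G c q \<mu> * ?u $ \<rho> *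
            (\<Sum>\<nu> | length \<nu> = p. levi_civita (\<mu> @ \<rho> # \<sigma> # \<nu>) * (p * chart_partial c \<sigma> (\<lambda>q. normal c q $ hd \<nu> * \<psi> c q (tl \<nu>)) q)))"
      by (intro sum.cong[OF refl] arg_cong[of _ _ "(*) _"] row) simp
    also have "\<dots> = wedge4 p (\<lambda>\<mu> \<rho> \<sigma> \<nu>. G c q \<mu> * ?u $ \<rho> * (p * chart_partial c \<sigma> (\<lambda>q. normal c q $ hd \<nu> * \<psi> c q (tl \<nu>)) q))"
      by (simp add: wedge4_def sum_distrib_left mult_ac)
    \<comment> \<open>The summands are grouped by the reason for vanishing: two factors of v in the
      first, a second derivative of a in the second.\<close>
    also have "\<dots> = wedge4 p (\<lambda>\<mu> \<rho> \<sigma> \<nu>.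
          (p * G c q \<mu> * ?u $ \<rho> * ?u $ hd \<nu> * (?l \<sigma> * \<psi> c q (tl \<nu>) + ?d\<psi> \<sigma> (tl \<nu>)))
        + (p * G c q \<mu> * ?u $ \<rho> * ?S \<sigma> (hd \<nu>) * \<psi> c q (tl \<nu>)))"
      by (rule wedge4_cong)
         (simp add: chart_partial_mult[OF chart[OF c(1)] c(2)] d normal_partial[OF c] algebra_simps)
    also have "\<dots> = 0"
    proof -
      have "wedge4 p (\<lambda>\<mu> \<rho> \<sigma> \<nu>. p * G c q \<mu> * ?u $ \<rho> * ?u $ hd \<nu> * (?l \<sigma> * \<psi> c q (tl \<nu>) + ?d\<psi> \<sigma> (tl \<nu>))) = 0"
        by (rule wedge4_symmetric_hd[OF card p,
              of "\<lambda>\<mu> \<rho> \<sigma> \<tau> \<nu>. p * G c q \<mu> * ?u $ \<rho> * ?u $ \<tau> * (?l \<sigma> * \<psi> c q \<nu> + ?d\<psi> \<sigma> \<nu>)"]) (simp add: mult_ac)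
      moreover have "wedge4 p (\<lambda>\<mu> \<rho> \<sigma> \<nu>. p * G c q \<mu> * ?u $ \<rho> * ?S \<sigma> (hd \<nu>) * \<psi> c q (tl \<nu>)) = 0"
        by (rule wedge4_symmetric_hd[OF card p, of "\<lambda>\<mu> \<rho> \<sigma> \<tau> \<nu>. p * G c q \<mu> * ?u $ \<rho> * ?S \<sigma> \<tau> * \<psi> c q \<nu>"])
           (rule disjI1, intro allI, simp only: S)
      ultimately show ?thesis unfolding wedge4_add by simp
    qed
    finally have T: "wedge4 p (\<lambda>\<mu> \<rho> \<sigma> \<nu>. G c q \<mu> * ?u $ \<rho> * chart_partial c \<sigma> (\<lambda>q. ?dA c q \<nu>) q) = 0" .
    have "wedge4 p (\<lambda>\<mu> \<rho> \<sigma> \<nu>. G c q \<mu> * ?u $ \<rho> * chart_partial c \<sigma> (\<lambda>q. 0) q * G c q \<nu>) = 0"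
      by (simp add: wedge4_def)
    with T show "(\<Sum>\<sigma>\<in>UNIV. \<Sum>\<mu> | length \<mu> = CARD('d) - 1. levi_civita (\<sigma> # \<mu>) * chart_partial c \<sigma> (\<lambda>q. chern_simons ?dA c q \<mu>) q)
      = sqrt_minus_det (g c q) * lagrangian_variation p (g c q) (gradient c a q) (gradient c (\<lambda>q. 0) q)
          (field_strength p A c q) (field_strength p ?dA c q) (\<Lambda> c q)"
      unfolding divergence_chern_simons[OF dA c] variation_eq[OF c] by simp
  qed
qed

section \<open>The second transformation\<close>

lemma scalar_field_mult: "scalar_field \<A> f \<Longrightarrow> scalar_field \<A> h \<Longrightarrow> scalar_field \<A> (\<lambda>c q. f c q * h c q)"
  unfolding scalar_field_def smooth_in_chart_iff
proof (intro conjI ballI, goal_cases)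
  case (1 c)
  thus ?case by (intro chart_smooth_mult chart_dom) auto
next
  case (2 c c' q)
  hence "f c q = f c' q" "h c q = h c' q" by blast+
  thus ?case by simp
qed

text \<open>The first index belongs to v, the two blocks of length p to the factors G. For the
  constant: (p + 1) / (p! (p + 1)!) is 1 / (p!)^2, and the further 1/2 compensates that
  differentiation produces the terms with d(ln N) and with dG twice.\<close>

definition lapse_current :: "('m \<Rightarrow> real) \<Rightarrow> ('m, 'd) tensor_field" where
  "lapse_current \<phi> c q = (\<lambda>\<mu>. 1 / (2 * (fact p)\<^sup>2) * ((\<phi> q * lapse c q) *
     (covector_tensor (normal c q) (take 1 \<mu>) * (G c q (take p (drop 1 \<mu>)) * G c q (drop p (drop 1 \<mu>))))))"

lemma covariant_field_lapse_current:
  assumes "smooth_scalar \<A> \<phi>"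
  shows "covariant_field \<A> (CARD('d) - 1) (lapse_current \<phi>)"
proof -
  have "CARD('d) - 1 = 1 + (p + p)" using card by simp
  thus ?thesis unfolding lapse_current_def[abs_def]
    by (simp only:) (intro covariant_field_cscale covariant_field_scale covariant_field_outer covariant_field_covector
        covector_field_normal covariant_field_G scalar_field_mult scalar_field_smooth_scalar assms scalar_field_lapse)
qed

lemma delta_A_phi_eq: "delta_A_phi g p A a \<Lambda> \<phi> c q \<mu> = - 1 * ((\<phi> q * lapse c q) * G c q \<mu>)"
  by (simp add: delta_A_phi_def Let_def G_def lapse_def normal_vector_def)

lemma invariance_phi:
  assumes \<phi>: "smooth_scalar \<A> \<phi>" and Z: "\<And>q. q \<in> Z \<Longrightarrow> \<phi> q = 0"
  shows "invariant_up_to_boundary_terms \<A> g vol p V A a \<Lambda> (delta_A_phi g p A a \<Lambda> \<phi>) \<phi> (\<lambda>c q \<mu>s. 0) Z"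
proof -
  let ?dA = "delta_A_phi g p A a \<Lambda> \<phi>"
  have "covariant_field \<A> p (\<lambda>c q \<mu>. - 1 * ((\<phi> q * lapse c q) * G c q \<mu>))"
    by (intro covariant_field_cscale covariant_field_scale scalar_field_mult scalar_field_smooth_scalar \<phi>
        scalar_field_lapse covariant_field_G)
  hence dA: "covariant_field \<A> p ?dA" by (simp only: delta_A_phi_eq[abs_def])
  show ?thesis
  proof (rule invariance_criterion[OF dA \<phi> covariant_field_add[OF covariant_field_chern_simons[OF dA]
          covariant_field_lapse_current[OF \<phi>]]])
    fix c q assume "q \<in> Z"
    thus "(\<lambda>\<mu>. chern_simons ?dA c q \<mu> + lapse_current \<phi> c q \<mu>) = (\<lambda>\<mu>. 0)"
      using Z by (simp add: chern_simons_def lapse_current_def delta_A_phi_eq)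
  next
    fix c q assume c: "c \<in> \<A>" "q \<in> dom_ch c"
    note ch = chart[OF c(1)] and W = chart_dom[OF c(1)]
    let ?D = "chart_partial c" and ?u = "normal c q" and ?G = "G c q" and ?dG = "\<lambda>\<sigma> \<mu>. chart_partial c \<sigma> (\<lambda>q. G c q \<mu>) q"
    let ?\<chi> = "\<phi> q * lapse c q"
    \<comment> \<open>The components of d(ln N), in which derivatives of N and of v are both
      expressed.\<close>
    define l where "l \<sigma> = ?D \<sigma> (lapse c) q / lapse c q" for \<sigma>
    have d: "chart_diff c \<phi> q" "chart_diff c (lapse c) q" "chart_diff c (\<lambda>q. normal c q $ \<tau>) q" "chart_diff c (\<lambda>q. G c q \<mu>) q" for \<tau> \<mu>
      by (rule chart_smooth_diff[OF _ c(2)], intro smooth_scalarD[OF \<phi>] scalar_fieldD(1)[OF scalar_field_lapse]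
          covector_fieldD(1)[OF covector_field_normal] covariant_fieldD(2)[OF covariant_field_G] c)+
    have lapse: "lapse c q \<noteq> 0" using norm_neg[OF c] by (simp add: lapse_def)
    have d\<chi>: "?D \<sigma> (\<lambda>q. \<phi> q * lapse c q) q = lapse c q * ?D \<sigma> \<phi> q + ?\<chi> * l \<sigma>" for \<sigma>
      using lapse by (simp add: chart_partial_mult[OF ch c(2)] d l_def)
    \<comment> \<open>These are G \<and> v \<and> \<alpha> \<and> G with \<alpha> = d\<phi> for
      \<open>R1\<close> and \<alpha> = d(ln N) for \<open>R2\<close>, and G \<and> v \<and> dG for
      \<open>P\<close>, up to normalization. Both the variation and the divergence are combinations
      of the three.\<close>
    define R1 R2 P where "R1 = wedge4 p (\<lambda>\<mu> \<rho> \<sigma> \<nu>. ?G \<mu> * ?u $ \<rho> * ?D \<sigma> \<phi> q * ?G \<nu>)"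
      and "R2 = wedge4 p (\<lambda>\<mu> \<rho> \<sigma> \<nu>. ?G \<mu> * ?u $ \<rho> * l \<sigma> * ?G \<nu>)"
      and "P = wedge4 p (\<lambda>\<mu> \<rho> \<sigma> \<nu>. ?G \<mu> * ?u $ \<rho> * ?dG \<sigma> \<nu>)"
    have T: "wedge4 p (\<lambda>\<mu> \<rho> \<sigma> \<nu>. ?G \<mu> * ?u $ \<rho> * ?D \<sigma> (\<lambda>q. ?dA c q \<nu>) q) = - (lapse c q * R1 + ?\<chi> * R2 + ?\<chi> * P)"
    proof -
      have "wedge4 p (\<lambda>\<mu> \<rho> \<sigma> \<nu>. ?G \<mu> * ?u $ \<rho> * ?D \<sigma> (\<lambda>q. ?dA c q \<nu>) q)
          = wedge4 p (\<lambda>\<mu> \<rho> \<sigma> \<nu>. (- lapse c q) * (?G \<mu> * ?u $ \<rho> * ?D \<sigma> \<phi> q * ?G \<nu>)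
              + ((- ?\<chi>) * (?G \<mu> * ?u $ \<rho> * l \<sigma> * ?G \<nu>) + (- ?\<chi>) * (?G \<mu> * ?u $ \<rho> * ?dG \<sigma> \<nu>)))"
      proof (rule wedge4_cong)
        fix \<mu> \<nu> :: "'d list" and \<rho> \<sigma> :: 'd
        have eq: "?D \<sigma> (\<lambda>q. ?dA c q \<nu>) q = - 1 * ((lapse c q * ?D \<sigma> \<phi> q + ?\<chi> * l \<sigma>) * ?G \<nu> + ?\<chi> * ?dG \<sigma> \<nu>)"
          unfolding delta_A_phi_eq d\<chi>[symmetric]
          by (subst chart_partial_cmult, intro chart_diff_mult d, subst chart_partial_mult[OF ch c(2)], intro chart_diff_mult d, rule d, rule refl)
        show "?G \<mu> * ?u $ \<rho> * ?D \<sigma> (\<lambda>q. ?dA c q \<nu>) q = (- lapse c q) * (?G \<mu> * ?u $ \<rho> * ?D \<sigma> \<phi> q * ?G \<nu>)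
              + ((- ?\<chi>) * (?G \<mu> * ?u $ \<rho> * l \<sigma> * ?G \<nu>) + (- ?\<chi>) * (?G \<mu> * ?u $ \<rho> * ?dG \<sigma> \<nu>))"
          unfolding eq by algebra
      qed
      thus ?thesis unfolding wedge4_add wedge4_scale R1_def R2_def P_def by simp
    qed
    define \<gamma> :: real where "\<gamma> = 1 / (2 * (fact p)\<^sup>2)"
    have "(\<Sum>\<sigma>\<in>UNIV. \<Sum>\<mu> | length \<mu> = CARD('d) - 1. levi_civita (\<sigma> # \<mu>) * ?D \<sigma> (\<lambda>q. lapse_current \<phi> c q \<mu>) q)
        = - wedge4 p (\<lambda>\<mu> \<rho> \<sigma> \<nu>. ?D \<sigma> (\<lambda>q. lapse_current \<phi> c q (\<rho> # \<mu> @ \<nu>)) q)"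
      by (rule sum_levi_civita_eq_wedge4[OF card even])
    also have "wedge4 p (\<lambda>\<mu> \<rho> \<sigma> \<nu>. ?D \<sigma> (\<lambda>q. lapse_current \<phi> c q (\<rho> # \<mu> @ \<nu>)) q)
        = wedge4 p (\<lambda>\<mu> \<rho> \<sigma> \<nu>. \<gamma> * (lapse c q * (?G \<mu> * ?u $ \<rho> * ?D \<sigma> \<phi> q * ?G \<nu>)
            + (2 * ?\<chi> * (?G \<mu> * ?u $ \<rho> * l \<sigma> * ?G \<nu>)
            + (?\<chi> * (lapse c q * ?D \<sigma> (?D \<rho> a) q * ?G \<mu> * ?G \<nu>)
            + (?\<chi> * (?G \<nu> * ?u $ \<rho> * ?dG \<sigma> \<mu>) + ?\<chi> * (?G \<mu> * ?u $ \<rho> * ?dG \<sigma> \<nu>))))))"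
    \<comment> \<open>The factor 2 in front of the terms with \<open>l\<close> has two sources, the
      derivative of \<phi> N and the derivative of v.\<close>
    proof (rule wedge4_cong)
      fix \<mu> \<nu> :: "'d list" and \<rho> \<sigma> :: 'd assume len: "length \<mu> = p" "length \<nu> = p"
      have "lapse_current \<phi> c q (\<rho> # \<mu> @ \<nu>) = \<gamma> * ((\<phi> q * lapse c q) * (normal c q $ \<rho> * (G c q \<mu> * G c q \<nu>)))" for q
        using len by (simp add: lapse_current_def covector_tensor_def \<gamma>_def)
      hence "?D \<sigma> (\<lambda>q. lapse_current \<phi> c q (\<rho> # \<mu> @ \<nu>)) q
          = ?D \<sigma> (\<lambda>q. \<gamma> * ((\<phi> q * lapse c q) * (normal c q $ \<rho> * (G c q \<mu> * G c q \<nu>)))) q" by simp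
      also have "\<dots> = \<gamma> * (?D \<sigma> (\<lambda>q. \<phi> q * lapse c q) q * (?u $ \<rho> * (?G \<mu> * ?G \<nu>))
          + ?\<chi> * (?D \<sigma> (\<lambda>q. normal c q $ \<rho>) q * (?G \<mu> * ?G \<nu>) + ?u $ \<rho> * (?dG \<sigma> \<mu> * ?G \<nu> + ?G \<mu> * ?dG \<sigma> \<nu>)))"
        by (simp only: chart_partial_cmult chart_partial_mult[OF ch c(2)] chart_diff_mult d)
      finally show "?D \<sigma> (\<lambda>q. lapse_current \<phi> c q (\<rho> # \<mu> @ \<nu>)) q = \<gamma> * (lapse c q * (?G \<mu> * ?u $ \<rho> * ?D \<sigma> \<phi> q * ?G \<nu>)
            + (2 * ?\<chi> * (?G \<mu> * ?u $ \<rho> * l \<sigma> * ?G \<nu>)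
            + (?\<chi> * (lapse c q * ?D \<sigma> (?D \<rho> a) q * ?G \<mu> * ?G \<nu>)
            + (?\<chi> * (?G \<nu> * ?u $ \<rho> * ?dG \<sigma> \<mu>) + ?\<chi> * (?G \<mu> * ?u $ \<rho> * ?dG \<sigma> \<nu>)))))"
        unfolding d\<chi> normal_partial[OF c] l_def[symmetric] by algebra
    qed
    also have "\<dots> = \<gamma> * (lapse c q * R1 + 2 * ?\<chi> * R2 + 2 * ?\<chi> * P)"
    proof -
      \<comment> \<open>The symmetric part of the derivative of v drops out, and commuting the two
        factors G makes both derivative terms equal to \<open>P\<close>.\<close>
      have "wedge4 p (\<lambda>\<mu> \<rho> \<sigma> \<nu>. lapse c q * ?D \<sigma> (?D \<rho> a) q * ?G \<mu> * ?G \<nu>) = 0"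
        by (rule wedge4_symmetric[OF card]) (simp only: chart_partial_commute[OF W c(2) smooth_scalarD[OF a c(1)]])
      moreover have "wedge4 p (\<lambda>\<mu> \<rho> \<sigma> \<nu>. ?G \<nu> * ?u $ \<rho> * ?dG \<sigma> \<mu>) = P"
        unfolding P_def by (rule wedge4_commute[OF card even])
      ultimately show ?thesis
        unfolding wedge4_add wedge4_scale R1_def[symmetric] R2_def[symmetric] P_def[symmetric] by simp
    qed
    finally have S2: "(\<Sum>\<sigma>\<in>UNIV. \<Sum>\<mu> | length \<mu> = CARD('d) - 1. levi_civita (\<sigma> # \<mu>) * ?D \<sigma> (\<lambda>q. lapse_current \<phi> c q \<mu>) q)
        = - (\<gamma> * (lapse c q * R1 + 2 * ?\<chi> * R2 + 2 * ?\<chi> * P))" .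
    have dX: "chart_diff c (\<lambda>q. chern_simons ?dA c q \<mu>) q" "chart_diff c (\<lambda>q. lapse_current \<phi> c q \<mu>) q" for \<mu>
      by (rule chart_smooth_diff[OF _ c(2)], intro covariant_fieldD(2)[OF covariant_field_chern_simons[OF dA]]
          covariant_fieldD(2)[OF covariant_field_lapse_current[OF \<phi>]] c)+
    define s where "s = - eps_pair p (field_strength p ?dA c q) (field_strength p A c q) / (2 * Suc p)"
    have "(\<Sum>\<sigma>\<in>UNIV. \<Sum>\<mu> | length \<mu> = CARD('d) - 1. levi_civita (\<sigma> # \<mu>) *
          ?D \<sigma> (\<lambda>q. chern_simons ?dA c q \<mu> + lapse_current \<phi> c q \<mu>) q)
        = 1 / (fact p * fact (Suc p)) * s - \<gamma> * (lapse c q * R1 + 2 * ?\<chi> * R2 + 2 * ?\<chi> * P)"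
      unfolding chart_partial_add[OF dX] distrib_left sum.distrib divergence_chern_simons[OF dA c] S2 s_def by simp
    also have "\<dots> = 1 / (fact p * fact (Suc p)) *
        (s + Suc p * - (lapse c q * R1 + ?\<chi> * R2 + ?\<chi> * P) + Suc p / 2 * (lapse c q * R1))"
    proof -
      have f: "fact (Suc p) = real (Suc p) * fact p" by (rule fact_Suc)
      \<comment> \<open>To be read with x = p! and y = p + 1. The variation contributes -y + y/2
        copies of L, which is half the weight of M and N, in agreement with the divergence.\<close>
      have *: "1 / (x * (y * x)) * s - 1 / (2 * x\<^sup>2) * (L + 2 * M + 2 * N) = 1 / (x * (y * x)) * (s + y * - (L + M + N) + y / 2 * L)"
        if "x \<noteq> 0" "y \<noteq> 0" for x y L M N :: real
        using that by (simp add: field_simps power2_eq_square)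
      show ?thesis unfolding f \<gamma>_def
        using *[of "fact p" "real (Suc p)" "lapse c q * R1" "?\<chi> * R2" "?\<chi> * P"] by (simp only: mult.assoc) simp
    qed
    finally show "(\<Sum>\<sigma>\<in>UNIV. \<Sum>\<mu> | length \<mu> = CARD('d) - 1. levi_civita (\<sigma> # \<mu>) *
          ?D \<sigma> (\<lambda>q. chern_simons ?dA c q \<mu> + lapse_current \<phi> c q \<mu>) q)
      = sqrt_minus_det (g c q) * lagrangian_variation p (g c q) (gradient c a q) (gradient c \<phi> q)
          (field_strength p A c q) (field_strength p ?dA c q) (\<Lambda> c q)"
      unfolding variation_eq[OF c] T R1_def[symmetric] s_def .
  qed
qed

end

theorem mainTheorem5:
  fixes n p :: nat
    and \<A> :: "('m::{t2_space,second_countable_topology}, 'd::{finite,linorder}) chart set"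
    and g :: "('m, 'd) metric_field"
    and vol :: "'m measure"
    and V :: "'d tensor \<Rightarrow> 'd matrix \<Rightarrow> real"
    and A \<Lambda> :: "('m, 'd) tensor_field"
    and a :: "'m \<Rightarrow> real"
  assumes "n \<ge> 1" and "p = 2 * n" and "CARD('d) = 4 * n + 2"
    and "oriented_atlas \<A>" and "lorentzian_metric \<A> g" and "volume_measure \<A> g vol"
    and "scalar_function (p + 1) V"
    and "form_field \<A> p A"
    and "smooth_scalar \<A> a" and "timelike_gradient \<A> g a"
    and "form_field \<A> (p + 1) \<Lambda>"
    and "\<forall>c\<in>\<A>. \<forall>q\<in>dom_ch c. self_dual (g c q) (p + 1) (\<Lambda> c q)"
  shows "(\<forall>\<psi>. covariant_field \<A> (p - 1) \<psi> \<longrightarrow>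
            invariant_up_to_boundary_terms \<A> g vol p V A a \<Lambda>
              (delta_A_psi g p a \<psi>) (\<lambda>q. 0) (\<lambda>c q \<mu>s. 0)
              {q. \<forall>c\<in>\<A>. q \<in> dom_ch c \<longrightarrow> \<psi> c q = (\<lambda>\<mu>s. 0)})
       \<and> (\<forall>\<phi>. smooth_scalar \<A> \<phi> \<longrightarrow>
            invariant_up_to_boundary_terms \<A> g vol p V A a \<Lambda>
              (delta_A_phi g p A a \<Lambda> \<phi>) \<phi> (\<lambda>c q \<mu>s. 0)
              {q. \<phi> q = 0})"
proof -
  interpret action_setting \<A> g vol p V A \<Lambda> a
    using assms by unfold_locales (auto simp: form_field_def)
  \<comment> \<open>Positivity makes p - 1 a true predecessor, so that \<delta>A = v \<and> \<psi>
    has rank p and lists of length p have a head.\<close>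
  have "p > 0" using assms(1,2) by simp
  then obtain k where p: "p = Suc k" using gr0_conv_Suc by blast
  show ?thesis
    by (intro conjI allI impI invariance_psi[OF p] invariance_phi) auto
qed

end
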